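(* (i) Any local embedding of a CR structure into the flag space $F=\mathrm{SL}(3,\mathbb C)/B$ coincides locally, up to a translation, with $\varphi_{CR}:\mathbb S^3\to F$. That is, if $M$ is a real 3-manifold with a CR structure $(T^1,T^2)$, $T^2=\overline{T^1}$, and $f:U\to F$ is a totally real embedding of an open set $U\subset M$ with $f_*(T^i)=\mathfrak T^i$ for $i=1,2$, then every point of $U$ has a neighbourhood $V\subset U$ for which there are $g\in\mathrm{SL}(3,\mathbb C)$ and a diffeomorphism $k$ from $V$ onto an open subset of $\mathbb S^3$ with $f|_V=g\circ\varphi_{CR}\circ k$. In particular, only spherical CR structures can be locally embedded. (ii) Any local embedding of a (real) path structure into $F$ coincides locally, up to a translation, with $\varphi_{\mathbb R}:\mathrm{SL}(3,\mathbb R)/B_{\mathbb R}\to F$. That is, if $M$ is a real 3-manifold with a path structure $(T^1,T^2)$ and $f:U\to F$ is a totally real embedding of an open set $U\subset M$ with $f_*(T^i)=\mathfrak T^i$ for $i=1,2$, then every point of $U$ has a neighbourhood $V\subset U$ for which there are $g\in\mathrm{SL}(3,\mathbb C)$ and a diffeomorphism $k$ from $V$ onto an open subset of $\mathrm{SL}(3,\mathbb R)/B_{\mathbb R}$ with $f|_V=g\circ\varphi_{\mathbb R}\circ k$. In particular, only flat path geometries can be locally embedded.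
   Context: Flag structure: for a real 3-manifold $M$ put $T^{\mathbb C}=TM\otimes\mathbb C$. A flag structure is a choice of two complex line sub-bundles $T^1,T^2\subset T^{\mathbb C}$ with $T^1\cap T^2=\{0\}$ such that $T^1\oplus T^2$ is a contact distribution (locally the kernel of a complex-valued 1-form $\theta$ with $d\theta\wedge\theta$ nowhere zero). It is a CR structure if $T^2=\overline{T^1}$, and a (real) path structure (path geometry) if $T^1$ and $T^2$ are complexifications of real one-dimensional sub-bundles of $TM$. Flag space: $B\subset\mathrm{SL}(3,\mathbb C)$ is the group of upper triangular matrices and $F=\mathrm{SL}(3,\mathbb C)/B$ is the space of complete flags, identified with the set of pairs $(z,l)\in\mathbb P(\mathbb C^3)\times\mathbb P({\mathbb C^3}^* )$ with $l(z)=0$. The two fields of complex lines $\mathfrak T^1,\mathfrak T^2$ on $F$ are the kernels of the differentials of the projections $F\to\mathbb P(\mathbb C^3)$ and $F\to\mathbb P({\mathbb C^3}^* )$ respectively. $\mathrm{SL}(3,\mathbb C)$ acts on $F$ by translations preserving them. For an embedding $\varphi:M\to F$ of a real 3-manifold extend $\varphi_*$ to $TM\otimes\mathbb C\to TF$ by $\varphi_*(iv)=J\varphi_*(v)$, $J$ being the complex structure of $F$; $\varphi$ is totally real if $\varphi_*:T_pM\otimes\mathbb C\to T_{\varphi(p)}F$ is an isomorphism for every $p$. A totally real embedding induces on $M$ the flag structure with $\varphi_*(T^i)=\mathfrak T^i$. A local embedding of a flag structure into $F$ is a totally real embedding of an open set inducing the given structure. Models: let $\langle z,w\rangle=w^*Jz$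 on $\mathbb C^3$ with $J=\begin{pmatrix}0&0&1\\0&1&0\\1&0&0\end{pmatrix}$ here denoting this matrix, and $\mathbb S^3=\{[x,y,z]\in\mathbb P(\mathbb C^3): x\bar z+|y|^2+z\bar x=0\}$. Then $\varphi_{CR}:\mathbb S^3\to F$, $\varphi_{CR}(x)=(x,\langle\,\cdot\,,x\rangle)$, is a totally real embedding inducing the standard CR structure of $\mathbb S^3$. $B_{\mathbb R}\subset\mathrm{SL}(3,\mathbb R)$ is the group of real upper triangular matrices and $\varphi_{\mathbb R}:\mathrm{SL}(3,\mathbb R)/B_{\mathbb R}\to F$ is the inclusion of real flags, a totally real embedding. A CR structure is spherical if it is locally equivalent, as a flag structure, to $\mathbb S^3$ with the structure induced by $\varphi_{CR}$; a path structure is flat if it is locally equivalent to $\mathrm{SL}(3,\mathbb R)/B_{\mathbb R}$ with the structure induced by $\varphi_{\mathbb R}$. *)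

theory Defs
  imports "HOL-Analysis.Analysis"
begin

section \<open>Smooth maps and smooth manifolds\<close>

text \<open>For functions on an open set of a finite-dimensional space this is the usual class
  \<open>C\<^sup>k\<close>, and \<open>smooth_on\<close> is \<open>C\<^sup>\<infinity>\<close>. Only open sets are ever used below.\<close>

primrec C_k_on :: "nat \<Rightarrow> 'a::real_normed_vector set \<Rightarrow> ('a \<Rightarrow> 'b::real_normed_vector) \<Rightarrow> bool" where
  "C_k_on 0 S f \<longleftrightarrow> continuous_on S f"
| "C_k_on (Suc k) S f \<longleftrightarrow> (\<forall>x\<in>S. f differentiable (at x)) \<and>
     (\<forall>v. C_k_on k S (\<lambda>x. frechet_derivative f (at x) v))"

definition smooth_on :: "'a::real_normed_vector set \<Rightarrow> ('a \<Rightarrow> 'b::real_normed_vector) \<Rightarrow> bool" where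
  "smooth_on S f \<longleftrightarrow> (\<forall>k. C_k_on k S f)"

text \<open>A chart is a pair of its domain and its coordinate map; the values of the coordinate map
  outside the domain are irrelevant. A manifold is given by an atlas, that is, a set of charts; its
  set of points and its topology are those determined by the atlas.\<close>

type_synonym ('a, 'e) chart = "'a set \<times> ('a \<Rightarrow> 'e)"

definition chart_inv :: "('a, 'e) chart \<Rightarrow> 'e \<Rightarrow> 'a" where
  "chart_inv c = inv_into (fst c) (snd c)"

definition mtop :: "('a, 'e::topological_space) chart set \<Rightarrow> 'a topology" where
  "mtop M = topology_generated_by {fst c \<inter> snd c -` O' | c O'. c \<in> M \<and> open O'}"

definition smooth_manifold :: "('a, 'e::euclidean_space) chart set \<Rightarrow> bool" where
  "smooth_manifold M \<longleftrightarrow>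
     (\<forall>c\<in>M. inj_on (snd c) (fst c) \<and> open (snd c ` fst c)) \<and>
     (\<forall>c\<in>M. \<forall>d\<in>M. open (snd c ` (fst c \<inter> fst d)) \<and>
        smooth_on (snd c ` (fst c \<inter> fst d)) (snd d \<circ> chart_inv c)) \<and>
     Hausdorff_space (mtop M) \<and> second_countable (mtop M)"

text \<open>Smooth maps defined on an open set \<open>U\<close> of the manifold \<open>M\<close>.\<close>

definition smooth_map ::
  "('a, 'e::euclidean_space) chart set \<Rightarrow> 'a set \<Rightarrow> ('b, 'd::euclidean_space) chart set \<Rightarrow> ('a \<Rightarrow> 'b) \<Rightarrow> bool"
  where
  "smooth_map M U N f \<longleftrightarrow> continuous_map (subtopology (mtop M) U) (mtop N) f \<and>
     (\<forall>c\<in>M. \<forall>d\<in>N. smooth_on (snd c ` (U \<inter> fst c \<inter> f -` fst d)) (snd d \<circ> f \<circ> chart_inv c))"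

text \<open>Diffeomorphisms from the open set \<open>V\<close> of \<open>M\<close> onto some open subset of \<open>N\<close>.\<close>

definition diffeo_onto_open ::
  "('a, 'e::euclidean_space) chart set \<Rightarrow> 'a set \<Rightarrow> ('b, 'd::euclidean_space) chart set \<Rightarrow> ('a \<Rightarrow> 'b) \<Rightarrow> bool"
  where
  "diffeo_onto_open M V N k \<longleftrightarrow> inj_on k V \<and> openin (mtop N) (k ` V) \<and>
     smooth_map M V N k \<and> smooth_map N (k ` V) M (inv_into V k)"


section \<open>Tangent vectors\<close>

text \<open>A tangent vector at \<open>p\<close> is given by its coordinates in every chart around \<open>p\<close>, which transform
  by the derivatives of the coordinate changes (and by convention vanish for all other charts).\<close>

type_synonym ('a, 'e) tvec = "('a, 'e) chart \<Rightarrow> 'e"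

definition charts_at :: "('a, 'e) chart set \<Rightarrow> 'a \<Rightarrow> ('a, 'e) chart set" where
  "charts_at M p = {c \<in> M. p \<in> fst c}"

definition tangent_space :: "('a, 'e::real_normed_vector) chart set \<Rightarrow> 'a \<Rightarrow> ('a, 'e) tvec set" where
  "tangent_space M p = {v.
     (\<forall>c\<in>charts_at M p. \<forall>d\<in>charts_at M p.
        v d = frechet_derivative (snd d \<circ> chart_inv c) (at (snd c p)) (v c)) \<and>
     (\<forall>c. c \<notin> charts_at M p \<longrightarrow> v c = 0)}"

text \<open>The differential of \<open>f\<close> at \<open>p\<close>. On tangent vectors it does not depend on the chosen chart.\<close>

definition pushforward ::
  "('a, 'e::real_normed_vector) chart set \<Rightarrow> ('b, 'd::real_normed_vector) chart set \<Rightarrow> ('a \<Rightarrow> 'b) \<Rightarrow> 'a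
     \<Rightarrow> ('a, 'e) tvec \<Rightarrow> ('b, 'd) tvec" where
  "pushforward M N f p v = (let c = (SOME c. c \<in> charts_at M p) in
     (\<lambda>d. if d \<in> charts_at N (f p)
          then frechet_derivative (snd d \<circ> f \<circ> chart_inv c) (at (snd c p)) (v c) else 0))"

text \<open>Complexified tangent vectors: the pair \<open>(u, w)\<close> stands for \<open>u + i w\<close>.\<close>

type_synonym ('a, 'e) ctvec = "('a, 'e) tvec \<times> ('a, 'e) tvec"

definition ctangent_space :: "('a, 'e::real_normed_vector) chart set \<Rightarrow> 'a \<Rightarrow> ('a, 'e) ctvec set" where
  "ctangent_space M p = tangent_space M p \<times> tangent_space M p"

definition czero :: "('a, 'e::real_normed_vector) ctvec" where
  "czero = ((\<lambda>c. 0), (\<lambda>c. 0))"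

definition cadd :: "('a, 'e::real_normed_vector) ctvec \<Rightarrow> ('a, 'e) ctvec \<Rightarrow> ('a, 'e) ctvec" where
  "cadd X Y = ((\<lambda>c. fst X c + fst Y c), (\<lambda>c. snd X c + snd Y c))"

definition cscale :: "complex \<Rightarrow> ('a, 'e::real_normed_vector) ctvec \<Rightarrow> ('a, 'e) ctvec" where
  "cscale z X = ((\<lambda>c. Re z *\<^sub>R fst X c - Im z *\<^sub>R snd X c), (\<lambda>c. Re z *\<^sub>R snd X c + Im z *\<^sub>R fst X c))"

definition cconj :: "('a, 'e::real_normed_vector) ctvec \<Rightarrow> ('a, 'e) ctvec" where
  "cconj X = (fst X, (\<lambda>c. - snd X c))"

text \<open>The complex-linear extension of \<open>f\<^sub>*\<close> to a map between complexified tangent spaces, and, when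
  the target is a complex manifold with holomorphic charts in \<open>\<complex>\<^sup>n\<close> (so that its complex structure
  \<open>J\<close> is multiplication by \<open>\<i>\<close> in each chart), the extension with values in the tangent space of the
  target given by \<open>f\<^sub>*(u + i w) = f\<^sub>* u + J (f\<^sub>* w)\<close>.\<close>

definition cpushforward ::
  "('a, 'e::real_normed_vector) chart set \<Rightarrow> ('b, 'd::real_normed_vector) chart set \<Rightarrow> ('a \<Rightarrow> 'b) \<Rightarrow> 'a
     \<Rightarrow> ('a, 'e) ctvec \<Rightarrow> ('b, 'd) ctvec" where
  "cpushforward M N f p X = (pushforward M N f p (fst X), pushforward M N f p (snd X))"

definition Jpushforward ::
  "('a, 'e::real_normed_vector) chart set \<Rightarrow> ('b, complex^'n) chart set \<Rightarrow> ('a \<Rightarrow> 'b) \<Rightarrow> 'a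
     \<Rightarrow> ('a, 'e) ctvec \<Rightarrow> ('b, complex^'n) tvec" where
  "Jpushforward M N f p X =
     (\<lambda>d. pushforward M N f p (fst X) d + \<i> *s pushforward M N f p (snd X) d)"


section \<open>Flag structures, CR structures and path structures\<close>

definition smooth_vector_field ::
  "('a, 'e::real_normed_vector) chart set \<Rightarrow> 'a set \<Rightarrow> ('a \<Rightarrow> ('a, 'e) tvec) \<Rightarrow> bool" where
  "smooth_vector_field M W X \<longleftrightarrow> (\<forall>q\<in>W. X q \<in> tangent_space M q) \<and>
     (\<forall>c\<in>M. smooth_on (snd c ` (W \<inter> fst c)) (\<lambda>x. X (chart_inv c x) c))"

definition real_line_bundle ::
  "('a, 'e::real_normed_vector) chart set \<Rightarrow> ('a \<Rightarrow> ('a, 'e) tvec set) \<Rightarrow> bool" where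
  "real_line_bundle M L \<longleftrightarrow> (\<forall>p\<in>topspace (mtop M). \<exists>W X. openin (mtop M) W \<and> p \<in> W \<and>
     smooth_vector_field M W X \<and>
     (\<forall>q\<in>W. X q \<noteq> (\<lambda>c. 0) \<and> L q = range (\<lambda>r::real. (\<lambda>c. r *\<^sub>R X q c))))"

definition complex_line_bundle ::
  "('a, 'e::real_normed_vector) chart set \<Rightarrow> ('a \<Rightarrow> ('a, 'e) ctvec set) \<Rightarrow> bool" where
  "complex_line_bundle M T \<longleftrightarrow> (\<forall>p\<in>topspace (mtop M). \<exists>W X. openin (mtop M) W \<and> p \<in> W \<and>
     smooth_vector_field M W (\<lambda>q. fst (X q)) \<and> smooth_vector_field M W (\<lambda>q. snd (X q)) \<and>
     (\<forall>q\<in>W. X q \<noteq> czero \<and> T q = range (\<lambda>z. cscale z (X q))))"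

text \<open>\<open>\<alpha> x v\<close> is the value at \<open>v\<close> of a complex-valued 1-form at the point \<open>x\<close> of an open set of a
  vector space.\<close>

definition ext_deriv ::
  "('e::real_normed_vector \<Rightarrow> 'e \<Rightarrow> complex) \<Rightarrow> 'e \<Rightarrow> 'e \<Rightarrow> 'e \<Rightarrow> complex" where
  "ext_deriv \<alpha> x u v = frechet_derivative (\<lambda>y. \<alpha> y v) (at x) u - frechet_derivative (\<lambda>y. \<alpha> y u) (at x) v"

definition d_wedge ::
  "('e::real_normed_vector \<Rightarrow> 'e \<Rightarrow> complex) \<Rightarrow> 'e \<Rightarrow> 'e \<Rightarrow> 'e \<Rightarrow> 'e \<Rightarrow> complex" where
  "d_wedge \<alpha> x u v w =
     ext_deriv \<alpha> x u v * \<alpha> x w + ext_deriv \<alpha> x v w * \<alpha> x u + ext_deriv \<alpha> x w u * \<alpha> x v"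

text \<open>Around every point, the distribution is the kernel of (the complex-linear extension of) a smooth
  complex-valued 1-form \<open>\<theta>\<close>, here written as \<open>\<alpha>\<close> in a chart, such that \<open>d\<theta> \<and> \<theta>\<close> vanishes
  nowhere.\<close>

definition contact_distribution ::
  "('a, 'e::real_normed_vector) chart set \<Rightarrow> ('a \<Rightarrow> ('a, 'e) ctvec set) \<Rightarrow> bool" where
  "contact_distribution M D \<longleftrightarrow> (\<forall>p\<in>topspace (mtop M). \<exists>c\<in>charts_at M p. \<exists>W \<alpha>.
     open W \<and> snd c p \<in> W \<and> W \<subseteq> snd c ` fst c \<and>
     (\<forall>x\<in>W. linear (\<alpha> x)) \<and> (\<forall>v. smooth_on W (\<lambda>x. \<alpha> x v)) \<and>
     (\<forall>x\<in>W. D (chart_inv c x) =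
        {X \<in> ctangent_space M (chart_inv c x). \<alpha> x (fst X c) + \<i> * \<alpha> x (snd X c) = 0}) \<and>
     (\<forall>x\<in>W. \<exists>u v w. d_wedge \<alpha> x u v w \<noteq> 0))"

definition flag_structure ::
  "('a, real^3) chart set \<Rightarrow> ('a \<Rightarrow> ('a, real^3) ctvec set) \<Rightarrow> ('a \<Rightarrow> ('a, real^3) ctvec set) \<Rightarrow> bool"
  where
  "flag_structure M T1 T2 \<longleftrightarrow> complex_line_bundle M T1 \<and> complex_line_bundle M T2 \<and>
     (\<forall>p\<in>topspace (mtop M). T1 p \<inter> T2 p = {czero}) \<and>
     contact_distribution M (\<lambda>p. {cadd X Y | X Y. X \<in> T1 p \<and> Y \<in> T2 p})"

definition CR_structure ::
  "('a, real^3) chart set \<Rightarrow> ('a \<Rightarrow> ('a, real^3) ctvec set) \<Rightarrow> ('a \<Rightarrow> ('a, real^3) ctvec set) \<Rightarrow> bool"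
  where
  "CR_structure M T1 T2 \<longleftrightarrow> flag_structure M T1 T2 \<and>
     (\<forall>p\<in>topspace (mtop M). T2 p = cconj ` T1 p)"

definition path_structure ::
  "('a, real^3) chart set \<Rightarrow> ('a \<Rightarrow> ('a, real^3) ctvec set) \<Rightarrow> ('a \<Rightarrow> ('a, real^3) ctvec set) \<Rightarrow> bool"
  where
  "path_structure M T1 T2 \<longleftrightarrow> flag_structure M T1 T2 \<and>
     (\<exists>L1 L2. real_line_bundle M L1 \<and> real_line_bundle M L2 \<and>
        (\<forall>p\<in>topspace (mtop M). T1 p = L1 p \<times> L1 p \<and> T2 p = L2 p \<times> L2 p))"

text \<open>Local equivalence, at every point of the open set \<open>U\<close>, of the flag structure \<open>(T1, T2)\<close> on \<open>M\<close>
  with the homogeneous model \<open>(S1, S2)\<close> on \<open>N\<close>.\<close>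

definition locally_equivalent_on ::
  "('a, real^3) chart set \<Rightarrow> 'a set \<Rightarrow> ('a \<Rightarrow> ('a, real^3) ctvec set) \<Rightarrow> ('a \<Rightarrow> ('a, real^3) ctvec set)
    \<Rightarrow> ('b, real^3) chart set \<Rightarrow> ('b \<Rightarrow> ('b, real^3) ctvec set) \<Rightarrow> ('b \<Rightarrow> ('b, real^3) ctvec set) \<Rightarrow> bool"
  where
  "locally_equivalent_on M U T1 T2 N S1 S2 \<longleftrightarrow> (\<forall>p\<in>U. \<exists>V k. openin (mtop M) V \<and> p \<in> V \<and> V \<subseteq> U \<and>
     diffeo_onto_open M V N k \<and>
     (\<forall>q\<in>V. cpushforward M N k q ` T1 q = S1 (k q) \<and> cpushforward M N k q ` T2 q = S2 (k q)))"


section \<open>Projective planes and flag spaces\<close>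

text \<open>The following is used for the fields of real and of complex numbers. Points of a projective
  plane are lines through the origin of \<open>k\<^sup>3\<close>; a linear form on \<open>k\<^sup>3\<close> is represented by its row of
  coefficients, so that \<open>l(z) = (\<Sum>i\<in>UNIV. l $ i * z $ i)\<close>.\<close>

definition line :: "'k::field^3 \<Rightarrow> ('k^3) set" where
  "line z = range (\<lambda>c. c *s z)"

definition flag_space :: "(('k::field^3) set \<times> ('k^3) set) set" where
  "flag_space = {(line z, line l) | z l. z \<noteq> 0 \<and> l \<noteq> 0 \<and> (\<Sum>i\<in>UNIV. l $ i * z $ i) = 0}"

definition proj_act :: "'k::field^3^3 \<Rightarrow> ('k^3) set \<Rightarrow> ('k^3) set" where
  "proj_act g L = (\<lambda>z. g *v z) ` L"

text \<open>The linear form \<open>l\<close> is moved to \<open>l \<circ> g\<^sup>-\<^sup>1\<close>.\<close>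

definition flag_act :: "'k::field^3^3 \<Rightarrow> ('k^3) set \<times> ('k^3) set \<Rightarrow> ('k^3) set \<times> ('k^3) set" where
  "flag_act g x = (proj_act g (fst x), (\<lambda>l. l v* matrix_inv g) ` snd x)"

definition SL3 :: "('k::field^3^3) set" where
  "SL3 = {g. det g = 1}"

text \<open>Affine charts of the projective plane.\<close>

definition proj_param :: "'k::field^3^3 \<Rightarrow> 'k^2 \<Rightarrow> ('k^3) set" where
  "proj_param g a = proj_act g (line (vector [1, a$1, a$2]))"

definition proj_atlas :: "(('k::field^3) set, 'k^2) chart set" where
  "proj_atlas = {(range (proj_param g), inv (proj_param g)) | g. g \<in> SL3}"

text \<open>Charts of \<open>SL(3,k)/B\<close>: the translates of the orbit of the standard flag under the lower unipotent
  matrices \<open>n = ((1,0,0),(a\<^sub>1,1,0),(a\<^sub>2,a\<^sub>3,1))\<close>. The flag \<open>n B\<close> consists of the line of the first column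
  of \<open>n\<close> and of the plane of the first two columns, which is the kernel of the form
  \<open>(a\<^sub>1 a\<^sub>3 - a\<^sub>2, - a\<^sub>3, 1)\<close>.\<close>

definition flag_param :: "'k::field^3^3 \<Rightarrow> 'k^3 \<Rightarrow> ('k^3) set \<times> ('k^3) set" where
  "flag_param g a = flag_act g
     (line (vector [1, a$1, a$2]), line (vector [a$1 * a$3 - a$2, - a$3, 1]))"

definition flag_atlas :: "(('k::field^3) set \<times> ('k^3) set, 'k^3) chart set" where
  "flag_atlas = {(range (flag_param g), inv (flag_param g)) | g. g \<in> SL3}"

type_synonym cflag = "(complex^3) set \<times> (complex^3) set"
type_synonym rflag = "(real^3) set \<times> (real^3) set"

abbreviation F_atlas :: "(cflag, complex^3) chart set" where
  "F_atlas \<equiv> flag_atlas"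

abbreviation FR_atlas :: "(rflag, real^3) chart set" where
  "FR_atlas \<equiv> flag_atlas"

definition T1_F :: "cflag \<Rightarrow> (cflag, complex^3) tvec set" where
  "T1_F x = {v \<in> tangent_space F_atlas x. pushforward F_atlas proj_atlas fst x v = (\<lambda>c. 0)}"

definition T2_F :: "cflag \<Rightarrow> (cflag, complex^3) tvec set" where
  "T2_F x = {v \<in> tangent_space F_atlas x. pushforward F_atlas proj_atlas snd x v = (\<lambda>c. 0)}"

definition totally_real_embedding ::
  "('a, real^3) chart set \<Rightarrow> 'a set \<Rightarrow> ('a \<Rightarrow> cflag) \<Rightarrow> bool" where
  "totally_real_embedding M U f \<longleftrightarrow> smooth_map M U F_atlas f \<and>
     embedding_map (subtopology (mtop M) U) (mtop F_atlas) f \<and>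
     (\<forall>p\<in>U. bij_betw (Jpushforward M F_atlas f p) (ctangent_space M p) (tangent_space F_atlas (f p)))"

text \<open>The flag structure induced on \<open>M\<close> by a totally real embedding \<open>f\<close>: since \<open>f\<^sub>*\<close> is an isomorphism
  from the complexified tangent spaces of \<open>M\<close> to those of the flag space, this is the only one that
  \<open>f\<^sub>*\<close> maps onto the two line fields of the flag space.\<close>

definition induced :: "('a, real^3) chart set \<Rightarrow> ('a \<Rightarrow> cflag) \<Rightarrow> (cflag \<Rightarrow> (cflag, complex^3) tvec set)
     \<Rightarrow> 'a \<Rightarrow> ('a, real^3) ctvec set" where
  "induced M f T p = {X \<in> ctangent_space M p. Jpushforward M F_atlas f p X \<in> T (f p)}"

definition local_embedding ::
  "('a, real^3) chart set \<Rightarrow> ('a \<Rightarrow> ('a, real^3) ctvec set) \<Rightarrow> ('a \<Rightarrow> ('a, real^3) ctvec set)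
     \<Rightarrow> 'a set \<Rightarrow> ('a \<Rightarrow> cflag) \<Rightarrow> bool" where
  "local_embedding M T1 T2 U f \<longleftrightarrow> openin (mtop M) U \<and> totally_real_embedding M U f \<and>
     (\<forall>p\<in>U. Jpushforward M F_atlas f p ` T1 p = T1_F (f p) \<and>
            Jpushforward M F_atlas f p ` T2 p = T2_F (f p))"


section \<open>The two models\<close>

definition J_mat :: "complex^3^3" where
  "J_mat = vector [vector [0, 0, 1], vector [0, 1, 0], vector [1, 0, 0]]"

definition herm :: "complex^3 \<Rightarrow> complex^3 \<Rightarrow> complex" where
  "herm z w = (\<Sum>i\<in>UNIV. cnj (w $ i) * (J_mat *v z) $ i)"

definition S3 :: "(complex^3) set set" where
  "S3 = {line z | z. z \<noteq> 0 \<and> z$1 * cnj (z$3) + z$2 * cnj (z$2) + z$3 * cnj (z$1) = 0}"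

text \<open>\<open>S3\<close> minus the point \<open>[1,0,0]\<close> consists of the points \<open>[- (s\<^sup>2 + t\<^sup>2)/2 + i u, s + i t, 1]\<close> with
  \<open>s, t, u\<close> real (Heisenberg coordinates). The charts are the translates of this one by the unitary
  group of the form, which acts on \<open>S3\<close>; they give \<open>S3\<close> its structure of submanifold of the complex
  projective plane.\<close>

definition S3_param :: "complex^3^3 \<Rightarrow> real^3 \<Rightarrow> (complex^3) set" where
  "S3_param g a = proj_act g
     (line (vector [Complex (- ((a$1)\<^sup>2 + (a$2)\<^sup>2) / 2) (a$3), Complex (a$1) (a$2), 1]))"

definition S3_atlas :: "((complex^3) set, real^3) chart set" where
  "S3_atlas = {(range (S3_param g), inv (S3_param g)) | g. \<forall>z w. herm (g *v z) (g *v w) = herm z w}"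

text \<open>The form \<open>\<langle>\<cdot>, x\<rangle>\<close> has coefficients \<open>\<langle>e\<^sub>i, x\<rangle>\<close>.\<close>

definition phi_CR :: "(complex^3) set \<Rightarrow> cflag" where
  "phi_CR L = (L, {c *s (\<chi> i. herm (axis i 1) x) | c x. x \<in> L})"

text \<open>A real line is sent to its complex span.\<close>

definition complexify_line :: "(real^3) set \<Rightarrow> (complex^3) set" where
  "complexify_line L = {c *s (\<chi> i. of_real (x $ i)) | c x. x \<in> L}"

definition phi_R :: "rflag \<Rightarrow> cflag" where
  "phi_R x = (complexify_line (fst x), complexify_line (snd x))"

definition spherical_on ::
  "('a, real^3) chart set \<Rightarrow> 'a set \<Rightarrow> ('a \<Rightarrow> ('a, real^3) ctvec set) \<Rightarrow> ('a \<Rightarrow> ('a, real^3) ctvec set) \<Rightarrow> bool"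
  where
  "spherical_on M U T1 T2 \<longleftrightarrow>
     locally_equivalent_on M U T1 T2 S3_atlas (induced S3_atlas phi_CR T1_F) (induced S3_atlas phi_CR T2_F)"

definition flat_on ::
  "('a, real^3) chart set \<Rightarrow> 'a set \<Rightarrow> ('a \<Rightarrow> ('a, real^3) ctvec set) \<Rightarrow> ('a \<Rightarrow> ('a, real^3) ctvec set) \<Rightarrow> bool"
  where
  "flat_on M U T1 T2 \<longleftrightarrow>
     locally_equivalent_on M U T1 T2 FR_atlas (induced FR_atlas phi_R T1_F) (induced FR_atlas phi_R T2_F)"


section \<open>The charts cover exactly the flag space and the sphere\<close>

lemma topspace_mtop: "topspace (mtop M) = (\<Union>c\<in>M. fst c)"
  unfolding mtop_def topology_generated_by_topspace by (auto, metis open_UNIV UNIV_I vimage_UNIV Int_UNIV_right)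

lemma proj_act_line: "proj_act g (line z) = line (g *v z)"
  unfolding proj_act_def line_def image_image by (simp add: vector_scalar_commute)

lemma line_scale: "c \<noteq> 0 \<Longrightarrow> line (c *s z) = line z"
proof -
  assume "c \<noteq> 0"
  then have "line (c *s z) = (\<lambda>c. c *s z) ` range (\<lambda>d. d * c)"
    by (simp add: line_def image_image)
  also have "range (\<lambda>d. d * c) = UNIV"
    using \<open>c \<noteq> 0\<close> by (intro surjI[of _ "\<lambda>d. d / c"]) simp
  finally show ?thesis by (simp add: line_def)
qed

lemma form_act_line: "(\<lambda>l. l v* A) ` line l = line (l v* (A :: 'k::field^3^3))"
  unfolding line_def image_image
  by (simp add: vector_matrix_mult_def vector_scalar_mult_def vec_eq_iff sum_distrib_left mult_ac)

lemma flag_act_line: "flag_act g (line z, line l) = (line (g *v z), line (l v* matrix_inv g))"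
  by (simp add: flag_act_def proj_act_line form_act_line)

lemma SL3_inv:
  assumes "g \<in> SL3"
  shows "g ** matrix_inv g = mat 1" "matrix_inv g ** g = mat 1"
proof -
  have "invertible g" using assms by (simp add: SL3_def invertible_det_nz)
  then have "g ** matrix_inv g = mat 1 \<and> matrix_inv g ** g = mat 1"
    unfolding invertible_def matrix_inv_def by (rule someI_ex)
  then show "g ** matrix_inv g = mat 1" "matrix_inv g ** g = mat 1" by auto
qed

lemma flag_act_flag_space:
  assumes g: "g \<in> SL3" and x: "x \<in> flag_space"
  shows "flag_act g x \<in> flag_space"
proof -
  obtain z l where x: "x = (line z, line l)" and z: "z \<noteq> 0" and l: "l \<noteq> 0"
    and zl: "(\<Sum>i\<in>UNIV. l $ i * z $ i) = 0"
    using x by (auto simp: flag_space_def)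
  note i = SL3_inv[OF g]
  have 1: "g *v z \<noteq> 0"
    by (metis i(2) z matrix_vector_mul_assoc matrix_vector_mul_lid matrix_vector_mult_0_right)
  have l': "(l v* matrix_inv g) v* g = l"
    by (simp add: vector_matrix_mul_assoc i)
  have 2: "l v* matrix_inv g \<noteq> 0"
  proof
    assume "l v* matrix_inv g = 0"
    then have "l = 0 v* g" using l' by simp
    then show False using l by (simp add: vector_matrix_mult_def vec_eq_iff)
  qed
  have dot: "(\<Sum>i\<in>UNIV. m $ i * (g *v z) $ i) = (\<Sum>i\<in>UNIV. (m v* g) $ i * z $ i)" for m
    by (simp add: vector_matrix_mult_def matrix_vector_mult_def sum_3 algebra_simps)
  have "(\<Sum>i\<in>UNIV. (l v* matrix_inv g) $ i * (g *v z) $ i) = 0"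
    unfolding dot l' zl ..
  then show ?thesis
    unfolding x flag_act_line flag_space_def using 1 2 by blast
qed

lemma topspace_flag_atlas: "topspace (mtop (flag_atlas :: (_, 'k::{field,topological_space}^3) chart set)) = flag_space"
proof (intro set_eqI iffI)
  fix x :: "('k^3) set \<times> ('k^3) set"
  assume "x \<in> topspace (mtop (flag_atlas :: (_, 'k^3) chart set))"
  then obtain g a where g: "g \<in> SL3" and x: "x = flag_param g a"
    by (auto simp: topspace_mtop flag_atlas_def)
  have "(line (vector [1, a$1, a$2]), line (vector [a$1 * a$3 - a$2, - a$3, 1])) \<in> flag_space"
    unfolding flag_space_def
    by (intro CollectI exI[of _ "vector [1, a$1, a$2]"] exI[of _ "vector [a$1 * a$3 - a$2, - a$3, 1]"])
      (auto simp: sum_3 vec_eq_iff forall_3 algebra_simps)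
  then show "x \<in> flag_space" unfolding x flag_param_def by (rule flag_act_flag_space[OF g])
next
  fix x :: "('k^3) set \<times> ('k^3) set"
  assume "x \<in> flag_space"
  then obtain z l where x: "x = (line z, line l)" and z: "z \<noteq> 0" and l: "l \<noteq> 0"
    and zl: "(\<Sum>i\<in>UNIV. l $ i * z $ i) = 0"
    by (auto simp: flag_space_def)
  obtain m :: "'k^3" where m: "m$1 * z$1 + m$2 * z$2 + m$3 * z$3 \<noteq> 0"
  proof -
    obtain i where "z $ i \<noteq> 0" using z by (auto simp: vec_eq_iff)
    then have "(\<Sum>j\<in>UNIV. axis i 1 $ j * z $ j) \<noteq> 0"
      by (simp add: axis_def if_distrib[of "\<lambda>x. x * _"] cong: if_cong)
    then show ?thesis using that[of "axis i 1"] by (simp add: sum_3)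
  qed
  obtain v :: "'k^3" where v: "l$1 * v$1 + l$2 * v$2 + l$3 * v$3 \<noteq> 0"
  proof -
    obtain i where "l $ i \<noteq> 0" using l by (auto simp: vec_eq_iff)
    then have "(\<Sum>j\<in>UNIV. l $ j * axis i 1 $ j) \<noteq> 0"
      by (simp add: axis_def if_distrib[of "\<lambda>x. _ * x"] cong: if_cong)
    then show ?thesis using that[of "axis i 1"] by (simp add: sum_3)
  qed
  have zl: "l$1 * z$1 + l$2 * z$2 + l$3 * z$3 = 0" using zl by (simp add: sum_3)
  let ?mz = "m$1 * z$1 + m$2 * z$2 + m$3 * z$3" and ?lv = "l$1 * v$1 + l$2 * v$2 + l$3 * v$3"
  define t where "t = inverse (?mz * ?lv)"
  define w1 w2 w3 where "w1 = l$2 * m$3 - l$3 * m$2" "w2 = l$3 * m$1 - l$1 * m$3" "w3 = l$1 * m$2 - l$2 * m$1"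
  define g :: "'k^3^3" where
    "g = vector [vector [z$1, w1, t * v$1], vector [z$2, w2, t * v$2], vector [z$3, w3, t * v$3]]"
  have "det g = t * (?mz * ?lv - (m$1 * v$1 + m$2 * v$2 + m$3 * v$3) * (l$1 * z$1 + l$2 * z$2 + l$3 * z$3))"
    unfolding det_3 g_def w1_w2_w3_def by (simp, algebra)
  moreover have "t * (?mz * ?lv) = 1"
    unfolding t_def by (rule left_inverse) (use m v in simp)
  ultimately have "det g = 1" unfolding zl by simp
  then have g: "g \<in> SL3" by (simp add: SL3_def)
  have t: "t \<noteq> 0" using m v by (simp add: t_def)
  have 1: "g *v vector [1, 0, 0] = z"
    by (simp add: vec_eq_iff forall_3 matrix_vector_mult_def sum_3 g_def)
  have lg: "l v* g = (t * ?lv) *s vector [0, 0, 1]"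
    using zl by (simp add: vec_eq_iff forall_3 vector_matrix_mult_def sum_3 g_def w1_w2_w3_def algebra_simps)
  have "l = (l v* g) v* matrix_inv g"
    by (simp add: vector_matrix_mul_assoc SL3_inv[OF g])
  then have "line l = (\<lambda>l. l v* matrix_inv g) ` line ((t * ?lv) *s vector [0, 0, 1])"
    by (simp add: form_act_line lg)
  also have "line ((t * ?lv) *s vector [0, 0, 1 :: 'k]) = (line (vector [0, 0, 1]) :: ('k^3) set)"
    using t v by (intro line_scale) simp
  finally have "x = flag_param g 0"
    by (simp add: x flag_param_def flag_act_def proj_act_line 1)
  then show "x \<in> topspace (mtop (flag_atlas :: (_, 'k^3) chart set))"
    using g by (auto simp: topspace_mtop flag_atlas_def)
qed

lemma herm_eq: "herm z w = z$3 * cnj (w$1) + z$2 * cnj (w$2) + z$1 * cnj (w$3)"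
  by (simp add: herm_def J_mat_def sum_3 matrix_vector_mult_def)

lemma topspace_S3_atlas: "topspace (mtop S3_atlas) = S3"
proof (intro set_eqI iffI)
  fix L
  assume "L \<in> topspace (mtop S3_atlas)"
  then obtain g a where g: "\<forall>z w. herm (g *v z) (g *v w) = herm z w" and L: "L = S3_param g a"
    by (auto simp: topspace_mtop S3_atlas_def)
  define z :: "complex^3" where
    "z = vector [Complex (- ((a$1)\<^sup>2 + (a$2)\<^sup>2) / 2) (a$3), Complex (a$1) (a$2), 1]"
  have "herm z z = 0"
    by (simp add: herm_eq z_def complex_eq_iff power2_eq_square field_simps)
  then have 1: "herm (g *v z) (g *v z) = 0" using g by simp
  have 2: "g *v z \<noteq> 0"
  proof
    assume "g *v z = 0"
    then have "herm (g *v z) (g *v axis 1 1) = 0" by (simp add: herm_eq)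
    then have "herm z (axis 1 1) = 0" using g by simp
    then show False by (simp add: herm_eq z_def axis_def)
  qed
  have "L = line (g *v z)" by (simp add: L S3_param_def proj_act_line z_def)
  then show "L \<in> S3"
    unfolding S3_def using 1 2 by (auto simp: herm_eq algebra_simps intro!: exI[of _ "g *v z"])
next
  have *: "line z \<in> topspace (mtop S3_atlas)"
    if g: "\<forall>z w. herm (g *v z) (g *v w) = herm z w" and gg: "g *v (g *v z) = z"
      and z0: "(g *v z)$3 \<noteq> 0" and z: "herm z z = 0" for g z
  proof -
    define y where "y = inverse ((g *v z)$3) *s (g *v z)"
    have y3: "y$3 = 1" using z0 by (simp add: y_def)
    have "herm (g *v z) (g *v z) = 0" using g z by simp
    then have "inverse ((g *v z)$3) * cnj (inverse ((g *v z)$3)) * herm (g *v z) (g *v z) = 0" by simp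
    then have "herm y y = 0" by (simp add: y_def herm_eq algebra_simps)
    then have "Re (y$1) = - ((Re (y$2))\<^sup>2 + (Im (y$2))\<^sup>2) / 2"
      by (simp add: herm_eq y3 complex_eq_iff power2_eq_square)
    then have y: "y = vector [Complex (- ((Re (y$2))\<^sup>2 + (Im (y$2))\<^sup>2) / 2) (Im (y$1)),
        Complex (Re (y$2)) (Im (y$2)), 1]"
      by (simp add: vec_eq_iff forall_3 y3 complex_eq_iff)
    have "line z = proj_act g (line (g *v z))" by (simp add: proj_act_line gg)
    also have "line (g *v z) = line y" unfolding y_def using z0 by (simp add: line_scale)
    finally have "line z = S3_param g (vector [Re (y$2), Im (y$2), Im (y$1)])"
      unfolding S3_param_def using y by simp
    then show ?thesis using g by (auto simp: topspace_mtop S3_atlas_def)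
  qed
  fix L assume "L \<in> S3"
  then obtain z where L: "L = line z" and z0: "z \<noteq> 0" and z: "herm z z = 0"
    by (auto simp: S3_def herm_eq algebra_simps)
  show "L \<in> topspace (mtop S3_atlas)"
  proof (cases "z$3 = 0")
    case False
    then show ?thesis unfolding L by (intro *[of "mat 1"] z) auto
  next
    case True
    then have "z$2 = 0" using z by (simp add: herm_eq)
    then have z1: "z$1 \<noteq> 0" using True z0 by (auto simp: vec_eq_iff forall_3)
    have J: "J_mat *v u = vector [u$3, u$2, u$1]" for u
      by (simp add: J_mat_def vec_eq_iff forall_3 matrix_vector_mult_def sum_3)
    show ?thesis unfolding L
      by (intro *[of J_mat] z) (use z1 in \<open>auto simp: J herm_eq vec_eq_iff forall_3\<close>)
  qed
qed

end

theory Submission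
  imports Defs
begin

text \<open>
  Write the embedding in an affine chart of the flag space as \<open>(x, y, p)\<close>, three complex functions
  with \<open>dx, dy, dp\<close> linearly independent over the complex numbers. The dual complex vector fields
  commute; \<open>T\<^sup>1\<close> is spanned by \<open>P = \<partial>\<^sub>p\<close> and \<open>T\<^sup>2\<close> by \<open>X = \<partial>\<^sub>x + p \<partial>\<^sub>y\<close>.
  Let \<open>z = (1, x, y)\<close> be the point and \<open>l = (x p - y, - p, 1)\<close> the form of the flag. In the CR case
  the conjugate of \<open>l\<close>, in the path case the conjugate of \<open>z\<close>, is proportional to some \<open>(1, u, v)\<close>
  up to a constant matrix, with \<open>P u = P v = 0\<close>, \<open>X v = r X u\<close> and \<open>X r = 0\<close>. Applying \<open>X\<close> again
  gives a cubic polynomial in \<open>p\<close> whose coefficients are killed by \<open>P\<close>, so all of them vanish: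
  formally, \<open>(x, y) \<mapsto> (u, v)\<close> maps lines to lines. Hence \<open>(1, u, v)\<close> is proportional to
  \<open>H z\<close> with a constant matrix \<open>H\<close>. The reality condition makes \<open>H\<close> a Hermitian form vanishing
  along \<open>z\<close> (CR case) or a real structure, which is the standard one after a change of basis by
  Hilbert 90 (path case). In both cases the image lies in a translate of the model.\<close>

section \<open>Smooth functions\<close>

text \<open>Nothing here is analytic, and x, y, p are functions on a domain of real dimension three.
  They still behave like complex coordinates: dx, dy, dp span the complexified cotangent spaces, so
  every smooth function has partial derivatives with respect to them, these commute, and a function
  on a convex set whose three partials vanish is constant. Functions killed by P can thus be treated
  like holomorphic functions of (x, y). Conjugation exchanges the directions of P and X in the CR
  case, so X kills the conjugates of x and y while P kills that of p; in the path case it preserves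
  both directions. The four cubic coefficients leave two free functions \<alpha>, \<beta> in the
  second derivatives of u and v. Compatibility forces these to be constants divided by one affine
  function \<rho> of x and y, the denominator of the projective map. Finding \<rho> means dividing
  by 1 + \<alpha> x + \<beta> y, which is 1 at x = y = 0; hence the base flag is moved to the origin
  of a chart and the neighbourhood is shrunk.\<close>

lemma C_k_on_cong:
  assumes "open S" "C_k_on k S f" "\<And>x. x \<in> S \<Longrightarrow> f x = g x"
  shows "C_k_on k S g"
  using assms(2,3)
proof (induction k arbitrary: f g)
  case 0
  then show ?case by (simp cong: continuous_on_cong)
next
  case (Suc k)
  have g: "(g has_derivative frechet_derivative f (at x)) (at x)" if "x \<in> S" for x
  proof -
    have "(f has_derivative frechet_derivative f (at x)) (at x)"
      using Suc.prems(1) that by (simp add: frechet_derivative_works[symmetric])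
    then show ?thesis
      by (rule has_derivative_transform_within_open[OF _ \<open>open S\<close> that]) (rule Suc.prems(2))
  qed
  have "C_k_on k S (\<lambda>x. frechet_derivative g (at x) v)" for v
    by (rule Suc.IH[of "\<lambda>x. frechet_derivative f (at x) v"])
      (use Suc.prems(1) frechet_derivative_at[OF g] in auto)
  then show ?case using g by (auto simp: differentiable_def)
qed

text \<open>\<open>frechet_derivative\<close> is a choice; in this form any derivative formula found
  by the usual rules can serve in an induction on the order.\<close>

lemma C_k_on_SucI:
  assumes "open S" "\<And>x. x \<in> S \<Longrightarrow> (f has_derivative f' x) (at x)"
    "\<And>v. C_k_on k S (\<lambda>x. f' x v)"
  shows "C_k_on (Suc k) S f"
proof -
  have "f' x v = frechet_derivative f (at x) v" if "x \<in> S" for x v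
    using frechet_derivative_at[OF assms(2)[OF that]] by simp
  then have "C_k_on k S (\<lambda>x. frechet_derivative f (at x) v)" for v
    by (rule C_k_on_cong[OF assms(1,3)])
  then show ?thesis using assms(2) by (auto simp: differentiable_def)
qed

lemma C_k_on_SucD:
  assumes "C_k_on (Suc k) S f"
  shows "\<And>x. x \<in> S \<Longrightarrow> (f has_derivative frechet_derivative f (at x)) (at x)"
    "C_k_on k S (\<lambda>x. frechet_derivative f (at x) v)"
  using assms by (auto simp: frechet_derivative_works[symmetric])

lemma C_k_on_mono: "C_k_on (Suc k) S f \<Longrightarrow> C_k_on k S f"
proof (induction k arbitrary: f)
  case 0
  then show ?case
    by (auto intro!: continuous_at_imp_continuous_on differentiable_imp_continuous_within)
next
  case (Suc k)
  then show ?case by auto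
qed

lemma C_k_on_subset: "C_k_on k S f \<Longrightarrow> T \<subseteq> S \<Longrightarrow> C_k_on k T f"
  by (induction k arbitrary: f) (auto intro: continuous_on_subset)

lemma C_k_on_const: "C_k_on k S (\<lambda>x. c)"
  by (induction k arbitrary: c) auto

lemma C_k_on_linear:
  assumes "open S" "bounded_linear L" "C_k_on k S f"
  shows "C_k_on k S (\<lambda>x. L (f x))"
  using assms(3)
proof (induction k arbitrary: f)
  case 0
  then show ?case
    using bounded_linear.continuous_on[OF assms(2)] by simp
next
  case (Suc k)
  show ?case
    by (rule C_k_on_SucI[OF \<open>open S\<close> bounded_linear.has_derivative[OF assms(2) C_k_on_SucD(1)[OF Suc.prems]]])
      (auto intro!: Suc.IH C_k_on_SucD(2)[OF Suc.prems])
qed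

lemma C_k_on_add:
  assumes "open S" "C_k_on k S f" "C_k_on k S g"
  shows "C_k_on k S (\<lambda>x. f x + g x)"
  using assms(2-)
proof (induction k arbitrary: f g)
  case 0
  then show ?case by (simp add: continuous_on_add)
next
  case (Suc k)
  show ?case
    by (rule C_k_on_SucI[OF \<open>open S\<close> has_derivative_add[OF C_k_on_SucD(1)[OF Suc.prems(1)] C_k_on_SucD(1)[OF Suc.prems(2)]]])
      (auto intro!: Suc.IH C_k_on_SucD(2)[OF Suc.prems(1)] C_k_on_SucD(2)[OF Suc.prems(2)])
qed

text \<open>The product rule gives two products, each with one factor differentiated. The induction
  therefore varies both functions and uses \<open>C_k_on_mono\<close> on the undifferentiated
  factor.\<close>

lemma C_k_on_bilinear:
  assumes "open S" "bounded_bilinear B" "C_k_on k S f" "C_k_on k S g"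
  shows "C_k_on k S (\<lambda>x. B (f x) (g x))"
  using assms(3-)
proof (induction k arbitrary: f g)
  case 0
  then show ?case by (simp add: bounded_bilinear.continuous_on[OF assms(2)])
next
  case (Suc k)
  show ?case
    by (rule C_k_on_SucI[OF \<open>open S\<close> bounded_bilinear.FDERIV[OF assms(2) C_k_on_SucD(1)[OF Suc.prems(1)] C_k_on_SucD(1)[OF Suc.prems(2)]]])
      (auto intro!: C_k_on_add[OF \<open>open S\<close>] Suc.IH C_k_on_SucD(2)[OF Suc.prems(1)] C_k_on_SucD(2)[OF Suc.prems(2)]
         C_k_on_mono[OF Suc.prems(1)] C_k_on_mono[OF Suc.prems(2)])
qed

lemma C_k_on_inverse:
  fixes f :: "'a::real_normed_vector \<Rightarrow> 'b::real_normed_field"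
  assumes "open S" "C_k_on k S f" "\<And>x. x \<in> S \<Longrightarrow> f x \<noteq> 0"
  shows "C_k_on k S (\<lambda>x. inverse (f x))"
  using assms(2)
proof (induction k)
  case 0
  then show ?case using assms(3) by (simp add: continuous_on_inverse)
next
  case (Suc k)
  \<comment> \<open>The derivative of 1/f is - (1/f) f' (1/f), so the induction hypothesis for 1/f
    and products suffice.\<close>
  note m = C_k_on_bilinear[OF \<open>open S\<close> bounded_bilinear_mult]
  show ?case
    by (rule C_k_on_SucI[OF \<open>open S\<close> Deriv.has_derivative_inverse[OF assms(3) C_k_on_SucD(1)[OF Suc.prems(1)]]])
      (auto intro!: C_k_on_linear[OF \<open>open S\<close> bounded_linear_minus[OF bounded_linear_ident]]
         m Suc.IH C_k_on_SucD(2)[OF Suc.prems(1)] C_k_on_mono[OF Suc.prems(1)])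
qed

lemma C_k_on_sum:
  assumes "open S" "\<And>i. i \<in> I \<Longrightarrow> C_k_on k S (f i)"
  shows "C_k_on k S (\<lambda>x. \<Sum>i\<in>I. f i x)"
  using assms(2)
  by (induction I rule: infinite_finite_induct) (auto intro!: C_k_on_const C_k_on_add assms(1))

text \<open>The chain rule differentiates \<open>g\<close> in the moving direction
  \<open>?f x v\<close>, whereas \<open>C_k_on\<close> speaks of fixed directions. Expanding that
  direction in \<open>Basis\<close> gives a finite sum of fixed-direction derivatives of
  \<open>g\<close> with varying coefficients.\<close>

lemma C_k_on_compose:
  fixes f :: "'a::real_normed_vector \<Rightarrow> 'b::euclidean_space"
  assumes "open S" "open T" "C_k_on k T g" "C_k_on k S f" "f ` S \<subseteq> T"
  shows "C_k_on k S (\<lambda>x. g (f x))"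
  using assms(3,4)
proof (induction k arbitrary: g)
  case 0
  then show ?case using assms(5) continuous_on_compose2 by fastforce
next
  case (Suc k)
  let ?g = "\<lambda>x. frechet_derivative g (at x)"
  let ?f = "\<lambda>x. frechet_derivative f (at x)"
  have D: "((\<lambda>x. g (f x)) has_derivative (\<lambda>v. ?g (f x) (?f x v))) (at x)" if "x \<in> S" for x
    using has_derivative_compose[OF C_k_on_SucD(1)[OF Suc.prems(2) that] C_k_on_SucD(1)[OF Suc.prems(1), of "f x"]]
      that assms(5) by blast
  have eq: "(\<Sum>b\<in>Basis. (?f x v \<bullet> b) *\<^sub>R ?g (f x) b) = ?g (f x) (?f x v)" if "x \<in> S" for x v
  proof -
    have "linear (?g (f x))"
      using C_k_on_SucD(1)[OF Suc.prems(1), of "f x"] that assms(5) has_derivative_linear by blast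
    then have "?g (f x) (\<Sum>b\<in>Basis. (?f x v \<bullet> b) *\<^sub>R b) = (\<Sum>b\<in>Basis. (?f x v \<bullet> b) *\<^sub>R ?g (f x) b)"
      by (simp add: linear_sum linear_scale)
    then show ?thesis by (simp add: euclidean_representation)
  qed
  have f: "C_k_on k S f" using C_k_on_mono[OF Suc.prems(2)] .
  have "C_k_on k S (\<lambda>x. \<Sum>b\<in>Basis. (?f x v \<bullet> b) *\<^sub>R ?g (f x) b)" for v
    by (intro C_k_on_sum[OF \<open>open S\<close>] C_k_on_bilinear[OF \<open>open S\<close> bounded_bilinear_scaleR]
       C_k_on_linear[OF \<open>open S\<close> bounded_linear_inner_left] C_k_on_SucD(2)[OF Suc.prems(2)]
       Suc.IH[OF C_k_on_SucD(2)[OF Suc.prems(1)]] f)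
  then have "C_k_on k S (\<lambda>x. ?g (f x) (?f x v))" for v
    using eq by (rule C_k_on_cong[OF \<open>open S\<close>])
  then show ?case by (intro C_k_on_SucI[OF \<open>open S\<close> D])
qed

lemma smooth_on_subset: "smooth_on S f \<Longrightarrow> T \<subseteq> S \<Longrightarrow> smooth_on T f"
  unfolding smooth_on_def using C_k_on_subset by blast

lemma smooth_on_cong: "open S \<Longrightarrow> smooth_on S f \<Longrightarrow> (\<And>x. x \<in> S \<Longrightarrow> f x = g x) \<Longrightarrow> smooth_on S g"
  unfolding smooth_on_def using C_k_on_cong by blast

lemma smooth_on_const: "smooth_on S (\<lambda>x. c)"
  unfolding smooth_on_def using C_k_on_const by blast

lemma smooth_on_linear:
  "open S \<Longrightarrow> bounded_linear L \<Longrightarrow> smooth_on S f \<Longrightarrow> smooth_on S (\<lambda>x. L (f x))"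
  unfolding smooth_on_def using C_k_on_linear by blast

lemma smooth_on_ident: "open S \<Longrightarrow> smooth_on S (\<lambda>x. x)"
proof -
  assume "open S"
  have "C_k_on k S (\<lambda>x. x)" for k
  proof (cases k)
    case (Suc j)
    then show ?thesis
      using C_k_on_SucI[OF \<open>open S\<close> has_derivative_ident C_k_on_const] by auto
  qed simp
  then show ?thesis by (simp add: smooth_on_def)
qed

lemma smooth_on_add: "open S \<Longrightarrow> smooth_on S f \<Longrightarrow> smooth_on S g \<Longrightarrow> smooth_on S (\<lambda>x. f x + g x)"
  unfolding smooth_on_def using C_k_on_add by blast

lemma smooth_on_minus: "open S \<Longrightarrow> smooth_on S f \<Longrightarrow> smooth_on S (\<lambda>x. - f x)"
  by (rule smooth_on_linear[OF _ bounded_linear_minus[OF bounded_linear_ident]])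

lemma smooth_on_diff: "open S \<Longrightarrow> smooth_on S f \<Longrightarrow> smooth_on S g \<Longrightarrow> smooth_on S (\<lambda>x. f x - g x)"
  using smooth_on_add[OF _ _ smooth_on_minus, of S f g] by simp

lemma smooth_on_mult:
  fixes f g :: "'a::real_normed_vector \<Rightarrow> 'b::real_normed_algebra"
  shows "open S \<Longrightarrow> smooth_on S f \<Longrightarrow> smooth_on S g \<Longrightarrow> smooth_on S (\<lambda>x. f x * g x)"
  unfolding smooth_on_def using C_k_on_bilinear[OF _ bounded_bilinear_mult] by blast

lemma smooth_on_inverse:
  fixes f :: "'a::real_normed_vector \<Rightarrow> 'b::real_normed_field"
  shows "open S \<Longrightarrow> smooth_on S f \<Longrightarrow> (\<And>x. x \<in> S \<Longrightarrow> f x \<noteq> 0) \<Longrightarrow> smooth_on S (\<lambda>x. inverse (f x))"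
  unfolding smooth_on_def using C_k_on_inverse by blast

lemma smooth_on_divide:
  fixes f g :: "'a::real_normed_vector \<Rightarrow> 'b::real_normed_field"
  assumes "open S" "smooth_on S f" "smooth_on S g" "\<And>x. x \<in> S \<Longrightarrow> g x \<noteq> 0"
  shows "smooth_on S (\<lambda>x. f x / g x)"
  using smooth_on_mult[OF assms(1,2) smooth_on_inverse[OF assms(1,3,4)]] by (simp add: divide_inverse)

lemma smooth_on_sum:
  "open S \<Longrightarrow> (\<And>i. i \<in> I \<Longrightarrow> smooth_on S (f i)) \<Longrightarrow> smooth_on S (\<lambda>x. \<Sum>i\<in>I. f i x)"
  unfolding smooth_on_def by (simp add: C_k_on_sum)

lemma smooth_on_compose:
  fixes f :: "'a::real_normed_vector \<Rightarrow> 'b::euclidean_space"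
  shows "open S \<Longrightarrow> open T \<Longrightarrow> smooth_on T g \<Longrightarrow> smooth_on S f \<Longrightarrow> f ` S \<subseteq> T \<Longrightarrow> smooth_on S (\<lambda>x. g (f x))"
  unfolding smooth_on_def using C_k_on_compose by blast

lemma smooth_on_has_derivative:
  "smooth_on S f \<Longrightarrow> x \<in> S \<Longrightarrow> (f has_derivative frechet_derivative f (at x)) (at x)"
  unfolding smooth_on_def using C_k_on_SucD(1) by blast

lemma smooth_on_differentiable: "smooth_on S f \<Longrightarrow> x \<in> S \<Longrightarrow> f differentiable (at x)"
  using smooth_on_has_derivative differentiable_def by blast

lemma smooth_on_frechet_derivative:
  "smooth_on S f \<Longrightarrow> smooth_on S (\<lambda>x. frechet_derivative f (at x) v)"
  unfolding smooth_on_def using C_k_on_SucD(2) by blast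

lemma smooth_on_continuous: "smooth_on S f \<Longrightarrow> continuous_on S f"
  unfolding smooth_on_def by (metis C_k_on.simps(1))

lemma bounded_linear_axis: "bounded_linear (axis i :: 'b::real_normed_vector \<Rightarrow> 'b^'n)"
  by (rule bounded_linear_intro[where K = 1])
    (auto simp: axis_def vec_eq_iff norm_vec_def L2_set_def if_distrib[of norm] if_distrib[of "\<lambda>x. x ^ 2"] cong: if_cong)

lemma smooth_on_vec:
  fixes f :: "'a::real_normed_vector \<Rightarrow> 'b::real_normed_vector^'n"
  assumes "open S" "\<And>i. smooth_on S (\<lambda>x. f x $ i)"
  shows "smooth_on S f"
proof -
  have "smooth_on S (\<lambda>x. \<Sum>i\<in>UNIV. axis i (f x $ i))"
    by (intro smooth_on_sum smooth_on_linear[OF _ bounded_linear_axis] assms)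
  moreover have "(\<Sum>i\<in>UNIV. axis i (f x $ i)) = f x" for x
    by (simp add: vec_eq_iff axis_def if_distrib cong: if_cong)
  ultimately show ?thesis by simp
qed

lemma smooth_on_nth:
  fixes f :: "'a::real_normed_vector \<Rightarrow> 'b::real_normed_vector^'n"
  shows "open S \<Longrightarrow> smooth_on S f \<Longrightarrow> smooth_on S (\<lambda>x. f x $ i)"
  by (rule smooth_on_linear[OF _ bounded_linear_vec_nth])

lemma smooth_on_det3:
  fixes A :: "'a::real_normed_vector \<Rightarrow> 'b::real_normed_field^3^3"
  assumes "open S" "\<And>i j. smooth_on S (\<lambda>x. A x $ i $ j)"
  shows "smooth_on S (\<lambda>x. det (A x))"
  unfolding det_3 by (intro smooth_on_add smooth_on_diff smooth_on_mult assms)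

text \<open>Cramer's rule writes \<open>u\<close> as quotients of determinants. It serves for
  partial derivatives in a frame and for the derivative of an inverse map.\<close>

lemma smooth_on_solve:
  fixes A :: "'a::real_normed_vector \<Rightarrow> 'b::real_normed_field^3^3"
  assumes "open S" "\<And>i j. smooth_on S (\<lambda>x. A x $ i $ j)" "\<And>i. smooth_on S (\<lambda>x. b x $ i)"
    "\<And>x. x \<in> S \<Longrightarrow> det (A x) \<noteq> 0" "\<And>x. x \<in> S \<Longrightarrow> A x *v u x = b x"
  shows "smooth_on S u"
proof -
  have u: "u x = (\<chi> k. det (\<chi> i j. if j = k then b x $ i else A x $ i $ j) / det (A x))" if "x \<in> S" for x
    using cramer[OF assms(4)[OF that]] assms(5)[OF that] by blast
  have "smooth_on S (\<lambda>x. \<chi> k. det (\<chi> i j. if j = k then b x $ i else A x $ i $ j) / det (A x))"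
  proof (rule smooth_on_vec[OF assms(1)], simp, intro smooth_on_divide smooth_on_det3 assms(1,2,4), simp)
    show "smooth_on S (\<lambda>x. if j = k then b x $ i else A x $ i $ j)" for i j k
      using assms(2,3) by (cases "j = k") auto
  qed
  then show ?thesis
    by (rule smooth_on_cong[OF assms(1)]) (simp add: u)
qed

section \<open>Symmetry of second derivatives\<close>

lemma second_derivative_mean_value:
  fixes f :: "'a::real_normed_vector \<Rightarrow> real"
  assumes h: "h > 0" and S: "\<And>s t. 0 \<le> s \<Longrightarrow> s \<le> h \<Longrightarrow> 0 \<le> t \<Longrightarrow> t \<le> h \<Longrightarrow> m + s *\<^sub>R v + t *\<^sub>R w \<in> S"
    and f: "\<And>x. x \<in> S \<Longrightarrow> (f has_derivative f' x) (at x)"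
    and fv: "\<And>x. x \<in> S \<Longrightarrow> ((\<lambda>x. f' x v) has_derivative f'' x) (at x)"
  shows "\<exists>s t. 0 \<le> s \<and> s \<le> h \<and> 0 \<le> t \<and> t \<le> h \<and>
     f (m + h *\<^sub>R v + h *\<^sub>R w) - f (m + h *\<^sub>R v) - f (m + h *\<^sub>R w) + f m = h\<^sup>2 * f'' (m + s *\<^sub>R v + t *\<^sub>R w) w"
proof -
  \<comment> \<open>The second difference over the parallelogram with sides h v and h w, read as the
    increment in s of a first difference along w. The mean value theorem is applied in s and then in
    t.\<close>
  define g where "g s = f (m + s *\<^sub>R v + h *\<^sub>R w) - f (m + s *\<^sub>R v + 0 *\<^sub>R w)" for s
  have "(g has_derivative (\<lambda>d. f' (m + s *\<^sub>R v + h *\<^sub>R w) (d *\<^sub>R v) - f' (m + s *\<^sub>R v + 0 *\<^sub>R w) (d *\<^sub>R v))) (at s)"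
    if "0 \<le> s" "s \<le> h" for s
  proof -
    have "m + s *\<^sub>R v + h *\<^sub>R w \<in> S" "m + s *\<^sub>R v + 0 *\<^sub>R w \<in> S" using that h by (auto intro!: S simp del: scaleR_zero_left)
    then show ?thesis
      unfolding g_def
      by (intro has_derivative_diff has_derivative_compose[OF _ f]) (auto intro!: derivative_eq_intros)
  qed
  then obtain s where s: "0 \<le> s" "s \<le> h" and
    gs: "g h - g 0 = f' (m + s *\<^sub>R v + h *\<^sub>R w) (h *\<^sub>R v) - f' (m + s *\<^sub>R v + 0 *\<^sub>R w) (h *\<^sub>R v)"
    using mvt_simple[OF h, of g "\<lambda>s d. f' (m + s *\<^sub>R v + h *\<^sub>R w) (d *\<^sub>R v) - f' (m + s *\<^sub>R v + 0 *\<^sub>R w) (d *\<^sub>R v)"]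
      has_derivative_at_withinI by (metis (no_types, lifting) atLeastAtMost_iff diff_zero greaterThanLessThan_subseteq_atLeastAtMost_iff order_refl subsetD)
  define k where "k t = f' (m + s *\<^sub>R v + t *\<^sub>R w) v" for t
  have lin: "linear (f' x)" if "x \<in> S" for x using f[OF that] has_derivative_linear by blast
  have gk: "g h - g 0 = h * (k h - k 0)"
  proof -
    have "m + s *\<^sub>R v + h *\<^sub>R w \<in> S" "m + s *\<^sub>R v + 0 *\<^sub>R w \<in> S" using s h by (auto intro!: S simp del: scaleR_zero_left)
    then show ?thesis
      unfolding gs k_def by (simp only: linear_scale[OF lin]) (simp add: right_diff_distrib)
  qed
  have "(k has_derivative (\<lambda>d. f'' (m + s *\<^sub>R v + t *\<^sub>R w) (d *\<^sub>R w))) (at t)"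
    if "0 \<le> t" "t \<le> h" for t
    unfolding k_def using that h s
    by (intro has_derivative_compose[OF _ fv]) (auto intro!: derivative_eq_intros S)
  then obtain t where t: "0 \<le> t" "t \<le> h" and
    kt: "k h - k 0 = f'' (m + s *\<^sub>R v + t *\<^sub>R w) (h *\<^sub>R w)"
    using mvt_simple[OF h, of k "\<lambda>t d. f'' (m + s *\<^sub>R v + t *\<^sub>R w) (d *\<^sub>R w)"]
      has_derivative_at_withinI by (metis (no_types, lifting) atLeastAtMost_iff diff_zero greaterThanLessThan_subseteq_atLeastAtMost_iff order_refl subsetD)
  have "linear (f'' (m + s *\<^sub>R v + t *\<^sub>R w))"
    using fv[OF S[OF s t]] has_derivative_linear by blast
  then have "g h - g 0 = h\<^sup>2 * f'' (m + s *\<^sub>R v + t *\<^sub>R w) w"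
    unfolding gk kt by (simp add: linear_scale power2_eq_square)
  then show ?thesis using s t by (intro exI[of _ s] exI[of _ t]) (simp add: g_def)
qed

text \<open>The second difference over a small parallelogram is symmetric in \<open>v\<close> and
  \<open>w\<close>, and it is h^2 times either mixed derivative at some nearby point. Continuity at
  \<open>m\<close> then forces the two to agree.\<close>

lemma second_derivative_symmetric_real:
  fixes f :: "'a::real_normed_vector \<Rightarrow> real"
  assumes "open S" "m \<in> S" "C_k_on 2 S f"
  shows "frechet_derivative (\<lambda>x. frechet_derivative f (at x) v) (at m) w
       = frechet_derivative (\<lambda>x. frechet_derivative f (at x) w) (at m) v"
proof (rule ccontr)
  let ?D = "\<lambda>v w x. frechet_derivative (\<lambda>x. frechet_derivative f (at x) v) (at x) w"
  assume ne: "?D v w m \<noteq> ?D w v m"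
  have C: "C_k_on (Suc (Suc 0)) S f" using assms(3) by (simp add: numeral_2_eq_2)
  \<comment> \<open>Half of the gap: values closer than \<open>e\<close> to the two mixed
    derivatives at \<open>m\<close> cannot coincide.\<close>
  define e where "e = \<bar>?D v w m - ?D w v m\<bar> / 2"
  have e: "e > 0" using ne by (simp add: e_def)
  have "continuous_on S (?D v w)" for v w
    using C_k_on_SucD(2)[OF C_k_on_SucD(2)[OF C]] by simp
  then have "isCont (?D v w) m" for v w
    using assms(1,2) continuous_on_eq_continuous_at by blast
  then have at: "\<forall>\<^sub>F x in at m. dist (?D v w x) (?D v w m) < e" for v w
    using e unfolding isCont_def by (rule tendstoD)
  have "\<forall>\<^sub>F x in nhds m. dist (?D v w x) (?D v w m) < e" for v w
    using at[of v w] e unfolding eventually_at_filter by (elim eventually_mono) (metis UNIV_I dist_self)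
  then have "\<forall>\<^sub>F x in nhds m. dist (?D v w x) (?D v w m) < e \<and> dist (?D w v x) (?D w v m) < e \<and> x \<in> S"
    using assms(1,2) e by (auto simp: eventually_nhds_in_open intro!: eventually_conj)
  then obtain r where r: "r > 0" and R: "\<And>x. dist x m < r \<Longrightarrow> dist (?D v w x) (?D v w m) < e \<and> dist (?D w v x) (?D w v m) < e \<and> x \<in> S"
    by (auto simp: eventually_nhds_metric)
  \<comment> \<open>The summand 1 keeps the denominator positive when \<open>v\<close> and
    \<open>w\<close> vanish; the factor 2 leaves the parallelogram strictly inside the ball.\<close>
  define h where "h = r / (2 * (norm v + norm w + 1))"
  have h: "h > 0" unfolding h_def using r by (intro divide_pos_pos) (auto intro: add_nonneg_pos)
  have hb: "h * (norm v + norm w) < r"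
  proof -
    have "h * (norm v + norm w) \<le> h * (norm v + norm w + 1)" using h by simp
    also have "\<dots> = r / 2" unfolding h_def
      by (simp add: field_simps add_nonneg_eq_0_iff)
    finally show ?thesis using r by simp
  qed
  have B: "dist (m + s *\<^sub>R v + t *\<^sub>R w) m < r" if "0 \<le> s" "s \<le> h" "0 \<le> t" "t \<le> h" for s t
  proof -
    have "dist (m + s *\<^sub>R v + t *\<^sub>R w) m = norm (s *\<^sub>R v + t *\<^sub>R w)" by (simp add: dist_norm add.assoc)
    also have "\<dots> \<le> s * norm v + t * norm w" using that by (metis abs_of_nonneg norm_scaleR norm_triangle_ineq)
    also have "\<dots> \<le> h * norm v + h * norm w" using that by (intro add_mono mult_right_mono) auto
    finally show ?thesis using hb by (simp add: algebra_simps)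
  qed
  have d: "(f has_derivative frechet_derivative f (at x)) (at x)" if "x \<in> S" for x
    using C_k_on_SucD(1)[OF C that] .
  have dd: "((\<lambda>x. frechet_derivative f (at x) v) has_derivative frechet_derivative (\<lambda>x. frechet_derivative f (at x) v) (at x)) (at x)" if "x \<in> S" for x v
    using C_k_on_SucD(1)[OF C_k_on_SucD(2)[OF C] that] .
  obtain s t where 1: "0 \<le> s" "s \<le> h" "0 \<le> t" "t \<le> h"
     "f (m + h *\<^sub>R v + h *\<^sub>R w) - f (m + h *\<^sub>R v) - f (m + h *\<^sub>R w) + f m = h\<^sup>2 * ?D v w (m + s *\<^sub>R v + t *\<^sub>R w)"
    using second_derivative_mean_value[OF h _ d dd, where m = m and v = v and w = w] B R by blast
  have B': "dist (m + s *\<^sub>R w + t *\<^sub>R v) m < r" if "0 \<le> s" "s \<le> h" "0 \<le> t" "t \<le> h" for s t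
    using B[OF that(3,4,1,2)] by (simp add: algebra_simps)
  obtain s' t' where 2: "0 \<le> s'" "s' \<le> h" "0 \<le> t'" "t' \<le> h"
     "f (m + h *\<^sub>R w + h *\<^sub>R v) - f (m + h *\<^sub>R w) - f (m + h *\<^sub>R v) + f m = h\<^sup>2 * ?D w v (m + s' *\<^sub>R w + t' *\<^sub>R v)"
    using second_derivative_mean_value[OF h _ d dd, where m = m and v = w and w = v] B' R by blast
  have "h\<^sup>2 * ?D v w (m + s *\<^sub>R v + t *\<^sub>R w) = h\<^sup>2 * ?D w v (m + s' *\<^sub>R w + t' *\<^sub>R v)"
    using 1(5) 2(5) by (simp add: algebra_simps)
  then have "?D v w (m + s *\<^sub>R v + t *\<^sub>R w) = ?D w v (m + s' *\<^sub>R w + t' *\<^sub>R v)" using h by simp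
  then have "\<bar>?D v w m - ?D w v m\<bar> < e + e"
    using R[OF B[OF 1(1-4)]] R[OF B'[OF 2(1-4)]] unfolding dist_real_def by linarith
  then show False by (simp add: e_def)
qed

lemma smooth_on_second_derivative_symmetric:
  fixes f :: "'a::real_normed_vector \<Rightarrow> 'b::euclidean_space"
  assumes "open S" "m \<in> S" "smooth_on S f"
  shows "frechet_derivative (\<lambda>x. frechet_derivative f (at x) v) (at m) w
       = frechet_derivative (\<lambda>x. frechet_derivative f (at x) w) (at m) v"
proof (rule euclidean_eqI)
  fix b :: 'b assume "b \<in> Basis"
  let ?g = "\<lambda>x. f x \<bullet> b"
  have fd: "frechet_derivative ?g (at x) u = frechet_derivative f (at x) u \<bullet> b" if "x \<in> S" for x u
    using frechet_derivative_at[OF has_derivative_inner_left[OF smooth_on_has_derivative[OF assms(3) that], of b]] by metis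
  have dd: "frechet_derivative (\<lambda>x. frechet_derivative ?g (at x) v) (at m) w
      = frechet_derivative (\<lambda>x. frechet_derivative f (at x) v) (at m) w \<bullet> b" for v w
  proof -
    have "((\<lambda>x. frechet_derivative f (at x) v \<bullet> b) has_derivative
        (\<lambda>w. frechet_derivative (\<lambda>x. frechet_derivative f (at x) v) (at m) w \<bullet> b)) (at m)"
      by (rule has_derivative_inner_left[OF smooth_on_has_derivative[OF smooth_on_frechet_derivative[OF assms(3)] assms(2)]])
    then have "((\<lambda>x. frechet_derivative ?g (at x) v) has_derivative
        (\<lambda>w. frechet_derivative (\<lambda>x. frechet_derivative f (at x) v) (at m) w \<bullet> b)) (at m)"
      by (rule has_derivative_transform_within_open[OF _ assms(1,2)]) (simp add: fd)
    then show ?thesis using frechet_derivative_at by metis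
  qed
  have "smooth_on S ?g" by (rule smooth_on_linear[OF assms(1) bounded_linear_inner_left assms(3)])
  then show "frechet_derivative (\<lambda>x. frechet_derivative f (at x) v) (at m) w \<bullet> b
     = frechet_derivative (\<lambda>x. frechet_derivative f (at x) w) (at m) v \<bullet> b"
    using second_derivative_symmetric_real[OF assms(1,2), of ?g v w] by (simp add: dd smooth_on_def)
qed

section \<open>Totally real frames\<close>

text \<open>\<open>F\<close> is the embedding read in a flag chart, with components x, y, p. The
  determinant condition says that dx, dy, dp are independent over the complex numbers. Convexity
  lets vanishing derivatives imply constancy.\<close>

locale complex_frame =
  fixes W :: "(real^3) set" and F :: "real^3 \<Rightarrow> complex^3"
  assumes open_W: "open W" and convex_W: "convex W" and W_ne: "W \<noteq> {}"
    and smooth_F: "smooth_on W F"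
    and det_F: "m \<in> W \<Longrightarrow> det (\<chi> i j. frechet_derivative F (at m) (axis j 1) $ i) \<noteq> 0"
begin

abbreviation x where "x m \<equiv> F m $ 1"
abbreviation y where "y m \<equiv> F m $ 2"
abbreviation p where "p m \<equiv> F m $ 3"
abbreviation dF where "dF m \<equiv> frechet_derivative F (at m)"

text \<open>\<open>D u a b c\<close> says that \<open>du = a dx + b dy + c dp\<close> on \<open>W\<close>.\<close>

definition D :: "(real^3 \<Rightarrow> complex) \<Rightarrow> (real^3 \<Rightarrow> complex) \<Rightarrow> (real^3 \<Rightarrow> complex) \<Rightarrow> (real^3 \<Rightarrow> complex) \<Rightarrow> bool" where
  "D u a b c \<longleftrightarrow> (\<forall>m\<in>W. (u has_derivative (\<lambda>v. a m * dF m v $ 1 + b m * dF m v $ 2 + c m * dF m v $ 3)) (at m))"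

lemma F_has_derivative: "m \<in> W \<Longrightarrow> (F has_derivative dF m) (at m)"
  using smooth_on_has_derivative[OF smooth_F] .

lemma linear_dF: "m \<in> W \<Longrightarrow> linear (dF m)"
  using F_has_derivative has_derivative_linear by blast

lemma D_cong:
  assumes "D u a b c" "\<And>m. m \<in> W \<Longrightarrow> u m = u' m" "\<And>m. m \<in> W \<Longrightarrow> a m = a' m"
    "\<And>m. m \<in> W \<Longrightarrow> b m = b' m" "\<And>m. m \<in> W \<Longrightarrow> c m = c' m"
  shows "D u' a' b' c'"
  unfolding D_def
proof
  fix m assume m: "m \<in> W"
  then have "(u has_derivative (\<lambda>v. a' m * dF m v $ 1 + b' m * dF m v $ 2 + c' m * dF m v $ 3)) (at m)"
    using assms(1,3-) by (simp add: D_def)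
  then show "(u' has_derivative (\<lambda>v. a' m * dF m v $ 1 + b' m * dF m v $ 2 + c' m * dF m v $ 3)) (at m)"
    by (rule has_derivative_transform_within_open[OF _ open_W m assms(2)])
qed

text \<open>A covector that vanishes on the real basis vectors is in the kernel of the transposed
  Jacobian, which is invertible.\<close>

lemma covector_zero:
  assumes "m \<in> W" "\<And>v. a * dF m v $ 1 + b * dF m v $ 2 + c * dF m v $ 3 = 0"
  shows "a = 0" "b = 0" "c = 0"
proof -
  let ?J = "\<chi> i j. dF m (axis j 1) $ i" and ?a = "vector [a, b, c] :: complex^3"
  have "transpose ?J *v ?a = 0"
    using assms(2) by (simp add: vec_eq_iff matrix_vector_mult_def transpose_def sum_3 mult.commute)
  moreover have "invertible (transpose ?J)"
    using det_F[OF assms(1)] by (simp add: invertible_det_nz)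
  ultimately have "?a = 0"
    by (metis invertible_left_inverse matrix_left_invertible_ker)
  then have "?a $ 1 = 0" "?a $ 2 = 0" "?a $ 3 = 0" by simp_all
  then show "a = 0" "b = 0" "c = 0" by simp_all
qed

lemma D_unique:
  assumes "D u a b c" "D u a' b' c'" "m \<in> W"
  shows "a m = a' m" "b m = b' m" "c m = c' m"
proof -
  have "(\<lambda>v. a m * dF m v $ 1 + b m * dF m v $ 2 + c m * dF m v $ 3) = (\<lambda>v. a' m * dF m v $ 1 + b' m * dF m v $ 2 + c' m * dF m v $ 3)"
    by (rule has_derivative_unique) (use assms in \<open>auto simp: D_def\<close>)
  then have "a m * dF m v $ 1 + b m * dF m v $ 2 + c m * dF m v $ 3 = a' m * dF m v $ 1 + b' m * dF m v $ 2 + c' m * dF m v $ 3" for v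
    by (rule fun_cong)
  then have "(a m - a' m) * dF m v $ 1 + (b m - b' m) * dF m v $ 2 + (c m - c' m) * dF m v $ 3 = 0" for v
    by (simp add: algebra_simps)
  from covector_zero[OF assms(3) this] show "a m = a' m" "b m = b' m" "c m = c' m" by simp_all
qed

lemma D_const: "D (\<lambda>m. k) (\<lambda>m. 0) (\<lambda>m. 0) (\<lambda>m. 0)"
  by (simp add: D_def)

lemma D_coord:
  "D x (\<lambda>m. 1) (\<lambda>m. 0) (\<lambda>m. 0)" "D y (\<lambda>m. 0) (\<lambda>m. 1) (\<lambda>m. 0)" "D p (\<lambda>m. 0) (\<lambda>m. 0) (\<lambda>m. 1)"
  using bounded_linear.has_derivative[OF bounded_linear_vec_nth F_has_derivative] by (simp_all add: D_def)

lemma D_add: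
  assumes "D u a b c" "D u' a' b' c'"
  shows "D (\<lambda>m. u m + u' m) (\<lambda>m. a m + a' m) (\<lambda>m. b m + b' m) (\<lambda>m. c m + c' m)"
  unfolding D_def
proof
  fix m assume "m \<in> W"
  then have "(u has_derivative (\<lambda>v. a m * dF m v $ 1 + b m * dF m v $ 2 + c m * dF m v $ 3)) (at m)"
    "(u' has_derivative (\<lambda>v. a' m * dF m v $ 1 + b' m * dF m v $ 2 + c' m * dF m v $ 3)) (at m)"
    using assms by (auto simp: D_def)
  from has_derivative_add[OF this]
  show "((\<lambda>m. u m + u' m) has_derivative (\<lambda>v. (a m + a' m) * dF m v $ 1 + (b m + b' m) * dF m v $ 2 + (c m + c' m) * dF m v $ 3)) (at m)"
    by (rule has_derivative_eq_rhs) (auto simp: algebra_simps)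
qed

lemma D_mult:
  assumes "D u a b c" "D u' a' b' c'"
  shows "D (\<lambda>m. u m * u' m) (\<lambda>m. a m * u' m + u m * a' m) (\<lambda>m. b m * u' m + u m * b' m) (\<lambda>m. c m * u' m + u m * c' m)"
  unfolding D_def
proof
  fix m assume "m \<in> W"
  then have "(u has_derivative (\<lambda>v. a m * dF m v $ 1 + b m * dF m v $ 2 + c m * dF m v $ 3)) (at m)"
    "(u' has_derivative (\<lambda>v. a' m * dF m v $ 1 + b' m * dF m v $ 2 + c' m * dF m v $ 3)) (at m)"
    using assms by (auto simp: D_def)
  from has_derivative_mult[OF this]
  show "((\<lambda>m. u m * u' m) has_derivative (\<lambda>v. (a m * u' m + u m * a' m) * dF m v $ 1 + (b m * u' m + u m * b' m) * dF m v $ 2 + (c m * u' m + u m * c' m) * dF m v $ 3)) (at m)"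
    by (rule has_derivative_eq_rhs) (auto simp: algebra_simps)
qed

lemma D_cmult: "D u a b c \<Longrightarrow> D (\<lambda>m. k * u m) (\<lambda>m. k * a m) (\<lambda>m. k * b m) (\<lambda>m. k * c m)"
  by (rule D_cong[OF D_mult[OF D_const[of k]]]) auto

lemma D_cmult0: "D u a b (\<lambda>m. 0) \<Longrightarrow> D (\<lambda>m. k * u m) (\<lambda>m. k * a m) (\<lambda>m. k * b m) (\<lambda>m. 0)"
  by (rule D_cong[OF D_cmult[of u a b "\<lambda>m. 0" k]]) auto

lemma D_diff:
  assumes "D u a b c" "D u' a' b' c'"
  shows "D (\<lambda>m. u m - u' m) (\<lambda>m. a m - a' m) (\<lambda>m. b m - b' m) (\<lambda>m. c m - c' m)"
  by (rule D_cong[OF D_add[OF assms(1) D_cmult[OF assms(2), of "-1"]]]) auto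

lemma D_constant:
  assumes "D u (\<lambda>m. 0) (\<lambda>m. 0) (\<lambda>m. 0)"
  shows "\<exists>k. \<forall>m\<in>W. u m = k"
proof -
  have "(u has_derivative (\<lambda>v. 0)) (at m within W)" if "m \<in> W" for m
    using assms that by (auto simp: D_def intro: has_derivative_at_withinI)
  from has_derivative_zero_constant[OF convex_W this] show ?thesis by blast
qed

lemma smooth_coord: "smooth_on W x" "smooth_on W y" "smooth_on W p"
  using smooth_on_nth[OF open_W smooth_F] by auto

text \<open>Evaluating du on the standard basis gives a linear system for the coefficients whose
  matrix is the transposed Jacobian of \<open>F\<close>; Cramer's rule makes the solution
  smooth.\<close>

lemma D_exists:
  assumes u: "smooth_on W u"
  obtains a b c where "smooth_on W a" "smooth_on W b" "smooth_on W c" "D u a b c"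
proof -
  let ?J = "\<lambda>m. transpose (\<chi> i j. dF m (axis j 1) $ i)"
  let ?g = "\<lambda>m. \<chi> i. frechet_derivative u (at m) (axis i 1)"
  have "\<exists>s. ?J m *v s = ?g m" if "m \<in> W" for m
    using cramer[of "?J m" _ "?g m"] det_F[OF that] by (auto simp: det_transpose)
  then obtain s where s: "\<And>m. m \<in> W \<Longrightarrow> ?J m *v s m = ?g m" by metis
  have "smooth_on W s"
  proof (rule smooth_on_solve[OF open_W _ _ _ s])
    show "smooth_on W (\<lambda>m. ?J m $ i $ j)" for i j
      by (simp add: transpose_def) (intro smooth_on_nth[OF open_W] smooth_on_frechet_derivative smooth_F)
    show "smooth_on W (\<lambda>m. ?g m $ i)" for i
      by simp (rule smooth_on_frechet_derivative[OF u])
    show "det (?J m) \<noteq> 0" if "m \<in> W" for m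
      unfolding det_transpose by (rule det_F[OF that])
  qed
  then have 1: "smooth_on W (\<lambda>m. s m $ i)" for i by (rule smooth_on_nth[OF open_W])
  have "D u (\<lambda>m. s m $ 1) (\<lambda>m. s m $ 2) (\<lambda>m. s m $ 3)"
    unfolding D_def
  proof
    fix m assume m: "m \<in> W"
    let ?d = "frechet_derivative u (at m)"
    let ?e = "\<lambda>v. s m $ 1 * dF m v $ 1 + s m $ 2 * dF m v $ 2 + s m $ 3 * dF m v $ 3"
    have d: "(u has_derivative ?d) (at m)" using smooth_on_has_derivative[OF u m] .
    have le: "linear ?e"
      using linear_dF[OF m] by (auto simp: linear_iff algebra_simps)
    have "?d (axis i 1) = ?e (axis i 1)" for i
      using s[OF m, unfolded vec_eq_iff] by (simp add: matrix_vector_mult_def transpose_def sum_3 mult.commute)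
    then have "?d = ?e"
      using has_derivative_linear[OF d] le
      by (intro linear_eq_stdbasis) (auto simp: Basis_vec_def)
    then show "(u has_derivative ?e) (at m)" using d by simp
  qed
  then show thesis using that 1 by blast
qed

text \<open>This is d(du) = 0 in a frame of exact forms. The second derivatives of \<open>F\<close>
  enter symmetrically and cancel, which leaves the antisymmetric matrix \<open>M\<close> of
  commutation defects, evaluated on pairs of real vectors.\<close>

lemma D_commute:
  assumes u: "smooth_on W u" and d: "D u a b c" "D a a1 a2 a3" "D b b1 b2 b3" "D c c1 c2 c3" and m: "m \<in> W"
  shows "a2 m = b1 m" "a3 m = c1 m" "b3 m = c2 m"
proof -
  let ?J = "\<chi> i j. dF m (axis j 1) $ i"
  define M :: "complex^3^3" where "M = vector [vector [0, a2 m - b1 m, a3 m - c1 m],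
     vector [b1 m - a2 m, 0, b3 m - c2 m], vector [c1 m - a3 m, c2 m - b3 m, 0]]"
  define A :: "complex^3^3" where "A = vector [vector [a1 m, a2 m, a3 m],
     vector [b1 m, b2 m, b3 m], vector [c1 m, c2 m, c3 m]]"
  have fu: "frechet_derivative u (at n) v = a n * dF n v $ 1 + b n * dF n v $ 2 + c n * dF n v $ 3" if "n \<in> W" for n v
  proof -
    have "(u has_derivative (\<lambda>v. a n * dF n v $ 1 + b n * dF n v $ 2 + c n * dF n v $ 3)) (at n)"
      using d(1) that by (simp add: D_def)
    from fun_cong[OF frechet_derivative_at[OF this], of v] show ?thesis by (rule sym)
  qed
  define H where "H v w i = frechet_derivative (\<lambda>n. dF n v) (at m) w $ i" for v w i
  have Hs: "H v w i = H w v i" for v w i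
    unfolding H_def using smooth_on_second_derivative_symmetric[OF open_W m smooth_F] by metis
  have ddF: "((\<lambda>n. dF n v $ i) has_derivative (\<lambda>w. H v w i)) (at m)" for v i
    unfolding H_def
    by (rule bounded_linear.has_derivative[OF bounded_linear_vec_nth smooth_on_has_derivative[OF smooth_on_frechet_derivative[OF smooth_F] m]])
  \<comment> \<open>The part of the second derivative of \<open>u\<close> that comes from
    differentiating \<open>a\<close>, \<open>b\<close>, \<open>c\<close>; the remaining part
    contains \<open>H\<close> and is symmetric.\<close>
  define Q where "Q v w = (a1 m * dF m w $ 1 + a2 m * dF m w $ 2 + a3 m * dF m w $ 3) * dF m v $ 1
     + (b1 m * dF m w $ 1 + b2 m * dF m w $ 2 + b3 m * dF m w $ 3) * dF m v $ 2
     + (c1 m * dF m w $ 1 + c2 m * dF m w $ 2 + c3 m * dF m w $ 3) * dF m v $ 3" for v w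
  have "((\<lambda>n. frechet_derivative u (at n) v) has_derivative (\<lambda>w. Q v w + (a m * H v w 1 + b m * H v w 2 + c m * H v w 3))) (at m)" for v
  proof -
    have "((\<lambda>n. a n * dF n v $ 1 + b n * dF n v $ 2 + c n * dF n v $ 3) has_derivative (\<lambda>w. Q v w + (a m * H v w 1 + b m * H v w 2 + c m * H v w 3))) (at m)"
      using d(2-) m unfolding D_def
      by (intro has_derivative_eq_rhs[OF has_derivative_add[OF has_derivative_add[OF
          has_derivative_mult[OF _ ddF] has_derivative_mult[OF _ ddF]] has_derivative_mult[OF _ ddF]]])
       (auto simp: Q_def algebra_simps)
    then show ?thesis
      by (rule has_derivative_transform_within_open[OF _ open_W m]) (simp add: fu)
  qed
  from fun_cong[OF frechet_derivative_at[OF this], symmetric]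
  have "frechet_derivative (\<lambda>n. frechet_derivative u (at n) v) (at m) w = Q v w + (a m * H v w 1 + b m * H v w 2 + c m * H v w 3)" for v w .
  then have Qs: "Q v w = Q w v" for v w
    using smooth_on_second_derivative_symmetric[OF open_W m u, of v w] Hs[of v w] by simp
  \<comment> \<open>On real basis vectors the defect is a congruence of \<open>M\<close> by the
    Jacobian, so invertibility of the Jacobian carries its vanishing over to
    \<open>M\<close>.\<close>
  have "(transpose ?J ** M ** ?J) $ i $ j = Q (axis i 1) (axis j 1) - Q (axis j 1) (axis i 1)" for i j
    by (simp add: matrix_matrix_mult_def transpose_def sum_3 M_def Q_def algebra_simps)
  then have z: "transpose ?J ** M ** ?J = 0" using Qs by (simp add: vec_eq_iff)
  obtain B where B: "?J ** B = mat 1" using det_F[OF m] by (auto simp: invertible_det_nz[symmetric] invertible_def)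
  have B': "transpose B ** transpose ?J = mat 1"
    by (simp add: matrix_transpose_mul[symmetric] B transpose_mat)
  have "M = (transpose B ** transpose ?J) ** M ** (?J ** B)" by (simp add: B B')
  also have "\<dots> = transpose B ** (transpose ?J ** M ** ?J) ** B" by (simp add: matrix_mul_assoc)
  also have "\<dots> = 0" unfolding z by (simp add: matrix_matrix_mult_def vec_eq_iff)
  finally have "M $ 1 $ 2 = 0" "M $ 1 $ 3 = 0" "M $ 2 $ 3 = 0" by simp_all
  then show "a2 m = b1 m" "a3 m = c1 m" "b3 m = c2 m" by (simp_all add: M_def)
qed

text \<open>Since partials commute, P kills the x- and y-partials of any function that it kills.
  Iterated, this lets such a function be handled like a function of x and y alone.\<close>

lemma D_second:
  assumes u: "smooth_on W u" "D u a b (\<lambda>m. 0)" and ab: "smooth_on W a" "smooth_on W b"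
  obtains a1 a2 b2 where "smooth_on W a1" "smooth_on W a2" "smooth_on W b2"
    "D a a1 a2 (\<lambda>m. 0)" "D b a2 b2 (\<lambda>m. 0)"
proof -
  obtain a1 a2 a3 where a: "smooth_on W a1" "smooth_on W a2" "smooth_on W a3" "D a a1 a2 a3"
    by (rule D_exists[OF ab(1)])
  obtain b1 b2 b3 where b: "smooth_on W b1" "smooth_on W b2" "smooth_on W b3" "D b b1 b2 b3"
    by (rule D_exists[OF ab(2)])
  note c = D_commute[OF u a(4) b(4) D_const]
  have "D a a1 a2 (\<lambda>m. 0)" "D b a2 b2 (\<lambda>m. 0)"
    using D_cong[OF a(4)] D_cong[OF b(4)] c by auto
  then show thesis using that a b by blast
qed

text \<open>Comparing the dp-coefficients of \<open>f * g = h\<close> leaves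
  \<open>f3 * g = 0\<close>, which spares a quotient rule in the frame.\<close>

lemma D_quotient:
  assumes "D g g1 g2 (\<lambda>m. 0)" "D h h1 h2 (\<lambda>m. 0)" "smooth_on W f"
    "\<And>m. m \<in> W \<Longrightarrow> f m * g m = h m" "\<And>m. m \<in> W \<Longrightarrow> g m \<noteq> 0"
  obtains f1 f2 where "smooth_on W f1" "smooth_on W f2" "D f f1 f2 (\<lambda>m. 0)"
proof -
  obtain f1 f2 f3 where f: "smooth_on W f1" "smooth_on W f2" "smooth_on W f3" "D f f1 f2 f3"
    by (rule D_exists[OF assms(3)])
  have "D h (\<lambda>m. f1 m * g m + f m * g1 m) (\<lambda>m. f2 m * g m + f m * g2 m) (\<lambda>m. f3 m * g m)"
    by (rule D_cong[OF D_mult[OF f(4) assms(1)]]) (auto simp: assms)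
  then have "f3 m = 0" if "m \<in> W" for m
    using D_unique(3)[OF assms(2) _ that] assms(5)[OF that] by force
  then have "D f f1 f2 (\<lambda>m. 0)" using D_cong[OF f(4)] by auto
  then show thesis using that f by blast
qed

text \<open>Differentiation in the frame lowers the degree, as for polynomials in two independent
  variables; affine relations are settled first by the same method.\<close>

lemma quadratic_zero:
  assumes "\<And>m. m \<in> W \<Longrightarrow> k0 + k1 * x m + k2 * y m + k11 * x m * x m + k12 * x m * y m + k22 * y m * y m = 0"
  shows "k0 = 0" "k1 = 0" "k2 = 0" "k11 = 0" "k12 = 0" "k22 = 0"
proof -
  obtain m0 where m0: "m0 \<in> W" using W_ne by blast
  have lin: "l0 = 0 \<and> l1 = 0 \<and> l2 = 0" if "\<And>m. m \<in> W \<Longrightarrow> l0 + l1 * x m + l2 * y m = 0" for l0 l1 l2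
  proof -
    have "D (\<lambda>m. l0 + l1 * x m + l2 * y m) (\<lambda>m. l1) (\<lambda>m. l2) (\<lambda>m. 0)"
      by (rule D_cong[OF D_add[OF D_add[OF D_const[of l0] D_cmult[OF D_coord(1), of l1]] D_cmult[OF D_coord(2), of l2]]]) auto
    then have "D (\<lambda>m. 0) (\<lambda>m. l1) (\<lambda>m. l2) (\<lambda>m. 0)"
      by (rule D_cong) (auto simp: that)
    from D_unique[OF D_const this m0] show ?thesis using that[OF m0] by auto
  qed
  let ?q = "\<lambda>m. k0 + k1 * x m + k2 * y m + k11 * (x m * x m) + k12 * (x m * y m) + k22 * (y m * y m)"
  have "D ?q (\<lambda>m. k1 + 2 * k11 * x m + k12 * y m) (\<lambda>m. k2 + k12 * x m + 2 * k22 * y m) (\<lambda>m. 0)"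
    by (rule D_cong[OF D_add[OF D_add[OF D_add[OF D_add[OF D_add[OF D_const[of k0] D_cmult[OF D_coord(1), of k1]]
        D_cmult[OF D_coord(2), of k2]] D_cmult[OF D_mult[OF D_coord(1,1)], of k11]] D_cmult[OF D_mult[OF D_coord(1,2)], of k12]]
        D_cmult[OF D_mult[OF D_coord(2,2)], of k22]]]) (auto simp: algebra_simps)
  then have "D (\<lambda>m. 0) (\<lambda>m. k1 + 2 * k11 * x m + k12 * y m) (\<lambda>m. k2 + k12 * x m + 2 * k22 * y m) (\<lambda>m. 0)"
    by (rule D_cong) (use assms in \<open>auto simp: mult.assoc\<close>)
  from D_unique[OF D_const this] have "k1 + 2 * k11 * x m + k12 * y m = 0" "k2 + k12 * x m + 2 * k22 * y m = 0"
    if "m \<in> W" for m using that by (metis, metis)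
  from lin[OF this(1)] lin[OF this(2)] have "k1 = 0" "k2 = 0" "k11 = 0" "k12 = 0" "k22 = 0" by auto
  moreover from this assms[OF m0] have "k0 = 0" by simp
  ultimately show "k0 = 0" "k1 = 0" "k2 = 0" "k11 = 0" "k12 = 0" "k22 = 0" by auto
qed

text \<open>P kills the coefficients and P p = 1, so each application of P lowers the degree in p.
  Three applications isolate \<open>q3\<close>; substitution backwards gives the rest.\<close>

lemma polynomial_p_zero:
  assumes d: "D q0 a0 b0 (\<lambda>m. 0)" "D q1 a1 b1 (\<lambda>m. 0)" "D q2 a2 b2 (\<lambda>m. 0)" "D q3 a3 b3 (\<lambda>m. 0)"
    and z: "\<And>m. m \<in> W \<Longrightarrow> q0 m + q1 m * p m + q2 m * p m * p m + q3 m * p m * p m * p m = 0"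
    and m: "m \<in> W"
  shows "q0 m = 0" "q1 m = 0" "q2 m = 0" "q3 m = 0"
proof -
  have step: "\<forall>m\<in>W. q1 m + 2 * q2 m * p m + 3 * q3 m * p m * p m = 0"
    if d: "D q0 a0 b0 (\<lambda>m. 0)" "D q1 a1 b1 (\<lambda>m. 0)" "D q2 a2 b2 (\<lambda>m. 0)" "D q3 a3 b3 (\<lambda>m. 0)"
      and z: "\<forall>m\<in>W. q0 m + q1 m * p m + q2 m * p m * p m + q3 m * p m * p m * p m = 0"
    for q0 q1 q2 q3 a0 a1 a2 a3 b0 b1 b2 b3
  proof
    fix m assume m: "m \<in> W"
    note pp = D_mult[OF D_coord(3,3)]
    note ppp = D_mult[OF D_coord(3) pp]
    note e = D_add[OF D_add[OF D_add[OF d(1) D_mult[OF d(2) D_coord(3)]] D_mult[OF d(3) pp]] D_mult[OF d(4) ppp]]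
    have "0 + (0 * p m + q1 m * 1) + (0 * (p m * p m) + q2 m * (1 * p m + p m * 1)) +
       (0 * (p m * (p m * p m)) + q3 m * (1 * (p m * p m) + p m * (1 * p m + p m * 1))) = 0"
      by (rule D_unique(3)[OF D_cong[OF e] D_const m, of 0]) (use z in \<open>auto simp: mult.assoc\<close>)
    then show "q1 m + 2 * q2 m * p m + 3 * q3 m * p m * p m = 0" by (simp add: algebra_simps)
  qed
  have 1: "\<forall>m\<in>W. q1 m + 2 * q2 m * p m + 3 * q3 m * p m * p m = 0"
    by (rule step[OF d]) (use z in auto)
  \<comment> \<open>\<open>step\<close> is reused on the differentiated polynomial, whose
    coefficient list is (q1, 2 q2, 3 q3, 0).\<close>
  have 2: "\<forall>m\<in>W. 2 * q2 m + 2 * (3 * q3 m) * p m = 0"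
    using step[OF d(2) D_cmult0[OF d(3), of 2] D_cmult0[OF d(4), of 3] D_const[of 0]] 1 by auto
  have 3: "\<forall>m\<in>W. 2 * 3 * q3 m = 0"
    using step[OF D_cmult0[OF d(3), of 2] D_cmult0[OF d(4), of "2*3"] D_const[of 0] D_const[of 0]] 2 by auto
  show q3: "q3 m = 0" using 3 m by auto
  show q2: "q2 m = 0" using 2 m q3 by auto
  show q1: "q1 m = 0" using 1 m q3 q2 by auto
  show "q0 m = 0" using z[OF m] q3 q2 q1 by auto
qed

end

section \<open>Projective rigidity\<close>

context complex_frame begin

text \<open>Eliminating \<open>r\<close> from X v = r X u and its X-derivative gives the cubic in p
  which says that lines go to lines. Its four coefficients express the six second derivatives of u
  and v through two functions \<alpha>, \<beta>; commutation of third derivatives then closes the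
  system by fixing the derivatives of \<alpha> and \<beta>.\<close>

lemma projective_structure:
  assumes sm: "smooth_on W u" "smooth_on W v" "smooth_on W ux" "smooth_on W uy" "smooth_on W vx" "smooth_on W vy"
    and u: "D u ux uy (\<lambda>m. 0)" and v: "D v vx vy (\<lambda>m. 0)" and r: "D r rx ry rp"
    and rX: "\<And>m. m \<in> W \<Longrightarrow> rx m + p m * ry m = 0"
    and X: "\<And>m. m \<in> W \<Longrightarrow> vx m + p m * vy m = r m * (ux m + p m * uy m)"
    and J: "\<And>m. m \<in> W \<Longrightarrow> ux m * vy m - uy m * vx m \<noteq> 0"
  obtains \<alpha> \<beta> where "smooth_on W \<alpha>" "smooth_on W \<beta>"
    "D \<alpha> (\<lambda>m. \<alpha> m * \<alpha> m) (\<lambda>m. \<alpha> m * \<beta> m) (\<lambda>m. 0)"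
    "D \<beta> (\<lambda>m. \<alpha> m * \<beta> m) (\<lambda>m. \<beta> m * \<beta> m) (\<lambda>m. 0)"
    "D ux (\<lambda>m. 2 * \<alpha> m * ux m) (\<lambda>m. \<beta> m * ux m + \<alpha> m * uy m) (\<lambda>m. 0)"
    "D uy (\<lambda>m. \<beta> m * ux m + \<alpha> m * uy m) (\<lambda>m. 2 * \<beta> m * uy m) (\<lambda>m. 0)"
    "D vx (\<lambda>m. 2 * \<alpha> m * vx m) (\<lambda>m. \<beta> m * vx m + \<alpha> m * vy m) (\<lambda>m. 0)"
    "D vy (\<lambda>m. \<beta> m * vx m + \<alpha> m * vy m) (\<lambda>m. 2 * \<beta> m * vy m) (\<lambda>m. 0)"
proof -
  obtain uxx uxy uyy where u2: "smooth_on W uxx" "smooth_on W uxy" "smooth_on W uyy"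
    "D ux uxx uxy (\<lambda>m. 0)" "D uy uxy uyy (\<lambda>m. 0)"
    by (rule D_second[OF sm(1) u sm(3,4)])
  obtain vxx vxy vyy where v2: "smooth_on W vxx" "smooth_on W vxy" "smooth_on W vyy"
    "D vx vxx vxy (\<lambda>m. 0)" "D vy vxy vyy (\<lambda>m. 0)"
    by (rule D_second[OF sm(2) v sm(5,6)])
  obtain uxxx uxxy uxxz where u31: "D uxx uxxx uxxy (\<lambda>m. 0)" "D uxy uxxy uxxz (\<lambda>m. 0)"
    by (rule D_second[OF sm(3) u2(4,1,2)])
  obtain uyyx uyyz uyyy where u32: "D uxy uyyx uyyz (\<lambda>m. 0)" "D uyy uyyz uyyy (\<lambda>m. 0)"
    by (rule D_second[OF sm(4) u2(5,2,3)])
  obtain vxxx vxxy vxxz where v31: "D vxx vxxx vxxy (\<lambda>m. 0)" "D vxy vxxy vxxz (\<lambda>m. 0)"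
    by (rule D_second[OF sm(5) v2(4,1,2)])
  obtain vyyx vyyz vyyy where v32: "D vxy vyyx vyyz (\<lambda>m. 0)" "D vyy vyyz vyyy (\<lambda>m. 0)"
    by (rule D_second[OF sm(6) v2(5,2,3)])
  \<comment> \<open>The relation \<open>X\<close> is differentiated along X once more. Since X p = 0
    and X r = 0, both p and r pass through like constants.\<close>
  have XX: "vxx m + 2 * p m * vxy m + p m * p m * vyy m = r m * (uxx m + 2 * p m * uxy m + p m * p m * uyy m)"
    if m: "m \<in> W" for m
  proof -
    note L = D_add[OF v2(4) D_mult[OF D_coord(3) v2(5)]]
      and R = D_mult[OF r D_add[OF u2(4) D_mult[OF D_coord(3) u2(5)]]]
    note LR = D_unique[OF D_cong[OF L X] R m, of "\<lambda>m. vxx m + (0 * vy m + p m * vxy m)" "\<lambda>m. vxy m + (0 * vy m + p m * vyy m)"]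
    have 1: "vxx m + p m * vxy m = rx m * (ux m + p m * uy m) + r m * (uxx m + p m * uxy m)"
      using LR(1) by simp
    have 2: "vxy m + p m * vyy m = ry m * (ux m + p m * uy m) + r m * (uxy m + p m * uyy m)"
      using LR(2) by simp
    have "vxx m + 2 * p m * vxy m + p m * p m * vyy m = (vxx m + p m * vxy m) + p m * (vxy m + p m * vyy m)"
      by (simp add: algebra_simps)
    also have "\<dots> = (rx m + p m * ry m) * (ux m + p m * uy m) + r m * (uxx m + 2 * p m * uxy m + p m * p m * uyy m)"
      unfolding 1 2 by (simp add: algebra_simps)
    finally show ?thesis using rX[OF m] by simp
  qed
  \<comment> \<open>The coefficients of 1, p, p^2, p^3 in (XX v)(X u) - (XX u)(X v), where XX is the
    second derivative along X.\<close>
  define q0 where "q0 m = vxx m * ux m - uxx m * vx m" for m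
  define q1 where "q1 m = (2 * (vxy m * ux m) - 2 * (uxy m * vx m)) + (vxx m * uy m - uxx m * vy m)" for m
  define q2 where "q2 m = (vyy m * ux m - uyy m * vx m) + (2 * (vxy m * uy m) - 2 * (uxy m * vy m))" for m
  define q3 where "q3 m = vyy m * uy m - uyy m * vy m" for m
  have dm: "\<exists>a b. D (\<lambda>m. f m * g m) a b (\<lambda>m. 0)" if "\<exists>a b. D f a b (\<lambda>m. 0)" "\<exists>a b. D g a b (\<lambda>m. 0)" for f g
  proof -
    from that obtain a b a' b' where "D f a b (\<lambda>m. 0)" "D g a' b' (\<lambda>m. 0)" by blast
    from D_mult[OF this] show ?thesis by auto
  qed
  have da: "\<exists>a b. D (\<lambda>m. f m + g m) a b (\<lambda>m. 0)" if "\<exists>a b. D f a b (\<lambda>m. 0)" "\<exists>a b. D g a b (\<lambda>m. 0)" for f g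
  proof -
    from that obtain a b a' b' where "D f a b (\<lambda>m. 0)" "D g a' b' (\<lambda>m. 0)" by blast
    from D_add[OF this] show ?thesis by auto
  qed
  have ds: "\<exists>a b. D (\<lambda>m. f m - g m) a b (\<lambda>m. 0)" if "\<exists>a b. D f a b (\<lambda>m. 0)" "\<exists>a b. D g a b (\<lambda>m. 0)" for f g
  proof -
    from that obtain a b a' b' where "D f a b (\<lambda>m. 0)" "D g a' b' (\<lambda>m. 0)" by blast
    from D_diff[OF this] show ?thesis by auto
  qed
  have dk: "\<exists>a b. D (\<lambda>m. k) a b (\<lambda>m. 0)" for k using D_const by blast
  have base: "\<exists>a b. D ux a b (\<lambda>m. 0)" "\<exists>a b. D uy a b (\<lambda>m. 0)" "\<exists>a b. D vx a b (\<lambda>m. 0)" "\<exists>a b. D vy a b (\<lambda>m. 0)"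
    "\<exists>a b. D uxx a b (\<lambda>m. 0)" "\<exists>a b. D uxy a b (\<lambda>m. 0)" "\<exists>a b. D uyy a b (\<lambda>m. 0)"
    "\<exists>a b. D vxx a b (\<lambda>m. 0)" "\<exists>a b. D vxy a b (\<lambda>m. 0)" "\<exists>a b. D vyy a b (\<lambda>m. 0)"
    using u2 v2 u31 u32 v31 v32 by blast+
  have dq: "\<exists>a b. D q0 a b (\<lambda>m. 0)" "\<exists>a b. D q1 a b (\<lambda>m. 0)" "\<exists>a b. D q2 a b (\<lambda>m. 0)" "\<exists>a b. D q3 a b (\<lambda>m. 0)"
  proof -
    show "\<exists>a b. D q0 a b (\<lambda>m. 0)" "\<exists>a b. D q1 a b (\<lambda>m. 0)" "\<exists>a b. D q2 a b (\<lambda>m. 0)" "\<exists>a b. D q3 a b (\<lambda>m. 0)"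
      unfolding q0_def[abs_def] q1_def[abs_def] q2_def[abs_def] q3_def[abs_def]
      by (intro da ds dm dk base)+
  qed
  have q: "q0 m = 0 \<and> q1 m = 0 \<and> q2 m = 0 \<and> q3 m = 0" if m: "m \<in> W" for m
  proof -
    have "q0 m + q1 m * p m + q2 m * p m * p m + q3 m * p m * p m * p m = 0" if m: "m \<in> W" for m
    proof -
      have "q0 m + q1 m * p m + q2 m * p m * p m + q3 m * p m * p m * p m =
        (vxx m + 2 * p m * vxy m + p m * p m * vyy m) * (ux m + p m * uy m)
        - (uxx m + 2 * p m * uxy m + p m * p m * uyy m) * (vx m + p m * vy m)"
        unfolding q0_def q1_def q2_def q3_def by (simp add: algebra_simps)
      also have "\<dots> = 0" unfolding XX[OF m] X[OF m] by (simp add: algebra_simps)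
      finally show ?thesis .
    qed
    note z = this
    from dq obtain a0 b0 a1 b1 a2 b2 a3 b3 where
      "D q0 a0 b0 (\<lambda>m. 0)" "D q1 a1 b1 (\<lambda>m. 0)" "D q2 a2 b2 (\<lambda>m. 0)" "D q3 a3 b3 (\<lambda>m. 0)" by blast
    from polynomial_p_zero[OF this z m] show ?thesis by blast
  qed
  let ?J = "\<lambda>m. ux m * vy m - uy m * vx m"
  \<comment> \<open>By \<open>q0 = 0\<close> the vector (uxx, vxx) is a multiple of (ux, vx), and
    \<alpha> is half the factor; \<beta> comes in the same way from \<open>q3 = 0\<close>.\<close>
  define \<alpha> where "\<alpha> m = (uxx m * vy m - vxx m * uy m) / (2 * ?J m)" for m
  define \<beta> where "\<beta> m = (vyy m * ux m - uyy m * vx m) / (2 * ?J m)" for m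
  have sa: "smooth_on W \<alpha>" "smooth_on W \<beta>"
    unfolding \<alpha>_def[abs_def] \<beta>_def[abs_def]
    by (intro smooth_on_divide smooth_on_diff smooth_on_mult smooth_on_const open_W sm u2 v2; use J in force)+
  have a: "2 * \<alpha> m * ?J m = uxx m * vy m - vxx m * uy m" and b: "2 * \<beta> m * ?J m = vyy m * ux m - uyy m * vx m" if "m \<in> W" for m
  proof -
    have 2: "2 * ?J m \<noteq> 0" using J[OF that] by simp
    have "\<alpha> m * (2 * ?J m) = uxx m * vy m - vxx m * uy m" "\<beta> m * (2 * ?J m) = vyy m * ux m - uyy m * vx m"
      unfolding \<alpha>_def \<beta>_def by (rule nonzero_eq_divide_eq[THEN iffD1, OF 2 refl])+
    then show "2 * \<alpha> m * ?J m = uxx m * vy m - vxx m * uy m" "2 * \<beta> m * ?J m = vyy m * ux m - uyy m * vx m"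
      by algebra+
  qed
  have e: "uxx m = 2 * \<alpha> m * ux m \<and> uxy m = \<beta> m * ux m + \<alpha> m * uy m \<and> uyy m = 2 * \<beta> m * uy m \<and>
       vxx m = 2 * \<alpha> m * vx m \<and> vxy m = \<beta> m * vx m + \<alpha> m * vy m \<and> vyy m = 2 * \<beta> m * vy m" if m: "m \<in> W" for m
  proof -
    note q' = q[OF m, unfolded q0_def q1_def q2_def q3_def]
    note ab = a[OF m] b[OF m]
    have "?J m * uxx m = ?J m * (2 * \<alpha> m * ux m)" "?J m * vxx m = ?J m * (2 * \<alpha> m * vx m)"
      "?J m * uyy m = ?J m * (2 * \<beta> m * uy m)" "?J m * vyy m = ?J m * (2 * \<beta> m * vy m)"
      "2 * ?J m * uxy m = 2 * ?J m * (\<beta> m * ux m + \<alpha> m * uy m)" "2 * ?J m * vxy m = 2 * ?J m * (\<beta> m * vx m + \<alpha> m * vy m)"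
      using q' ab by algebra+
    then show ?thesis using J[OF m] by simp
  qed
  have d: "D ux (\<lambda>m. 2 * \<alpha> m * ux m) (\<lambda>m. \<beta> m * ux m + \<alpha> m * uy m) (\<lambda>m. 0)"
    "D uy (\<lambda>m. \<beta> m * ux m + \<alpha> m * uy m) (\<lambda>m. 2 * \<beta> m * uy m) (\<lambda>m. 0)"
    "D vx (\<lambda>m. 2 * \<alpha> m * vx m) (\<lambda>m. \<beta> m * vx m + \<alpha> m * vy m) (\<lambda>m. 0)"
    "D vy (\<lambda>m. \<beta> m * vx m + \<alpha> m * vy m) (\<lambda>m. 2 * \<beta> m * vy m) (\<lambda>m. 0)"
    by (rule D_cong[OF u2(4)] D_cong[OF u2(5)] D_cong[OF v2(4)] D_cong[OF v2(5)], simp_all add: e)+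
  have dJ: "\<exists>a b. D (\<lambda>m. 2 * ?J m) a b (\<lambda>m. 0)" by (intro da ds dm dk base)
  obtain \<alpha>x \<alpha>y where d\<alpha>: "D \<alpha> \<alpha>x \<alpha>y (\<lambda>m. 0)"
  proof -
    have "\<exists>a b. D (\<lambda>m. uxx m * vy m - vxx m * uy m) a b (\<lambda>m. 0)" by (intro ds dm base)
    with dJ obtain a b a' b' where
      "D (\<lambda>m. 2 * ?J m) a b (\<lambda>m. 0)" "D (\<lambda>m. uxx m * vy m - vxx m * uy m) a' b' (\<lambda>m. 0)" by blast
    from D_quotient[OF this sa(1)] that show thesis using a J by (force simp: mult_ac)
  qed
  obtain \<beta>x \<beta>y where d\<beta>: "D \<beta> \<beta>x \<beta>y (\<lambda>m. 0)"
  proof -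
    have "\<exists>a b. D (\<lambda>m. vyy m * ux m - uyy m * vx m) a b (\<lambda>m. 0)" by (intro ds dm base)
    with dJ obtain a b a' b' where
      "D (\<lambda>m. 2 * ?J m) a b (\<lambda>m. 0)" "D (\<lambda>m. vyy m * ux m - uyy m * vx m) a' b' (\<lambda>m. 0)" by blast
    from D_quotient[OF this sa(2)] that show thesis using b J by (force simp: mult_ac)
  qed
  \<comment> \<open>The commutation relations for u and v come in pairs of linear equations with
    determinant \<open>?J\<close>, which separates them into equations in \<alpha> and \<beta>
    alone.\<close>
  have ab: "\<alpha>x m = \<alpha> m * \<alpha> m \<and> \<alpha>y m = \<alpha> m * \<beta> m \<and> \<beta>x m = \<alpha> m * \<beta> m \<and> \<beta>y m = \<beta> m * \<beta> m" if m: "m \<in> W" for m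
  proof -
    have xx: "D (\<lambda>m. 2 * \<alpha> m * w m) (\<lambda>m. 2 * (\<alpha>x m * w m + \<alpha> m * wx m)) (\<lambda>m. 2 * (\<alpha>y m * w m + \<alpha> m * wy m)) (\<lambda>m. 0)"
      if "D w wx wy (\<lambda>m. 0)" for w wx wy
      by (rule D_cong[OF D_cmult[OF D_mult[OF d\<alpha> that], of 2]]) auto
    have yy: "D (\<lambda>m. 2 * \<beta> m * w m) (\<lambda>m. 2 * (\<beta>x m * w m + \<beta> m * wx m)) (\<lambda>m. 2 * (\<beta>y m * w m + \<beta> m * wy m)) (\<lambda>m. 0)"
      if "D w wx wy (\<lambda>m. 0)" for w wx wy
      by (rule D_cong[OF D_cmult[OF D_mult[OF d\<beta> that], of 2]]) auto
    have xy: "D (\<lambda>m. \<beta> m * w m + \<alpha> m * z m) (\<lambda>m. \<beta>x m * w m + \<beta> m * wx m + \<alpha>x m * z m + \<alpha> m * zx m)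
       (\<lambda>m. \<beta>y m * w m + \<beta> m * wy m + \<alpha>y m * z m + \<alpha> m * zy m) (\<lambda>m. 0)"
      if "D w wx wy (\<lambda>m. 0)" "D z zx zy (\<lambda>m. 0)" for w wx wy z zx zy
      by (rule D_cong[OF D_add[OF D_mult[OF d\<beta> that(1)] D_mult[OF d\<alpha> that(2)]]]) auto
    note c = D_commute(1)[OF sm(3) d(1) xx[OF d(1)] xy[OF d(1,2)] D_const m]
      D_commute(1)[OF sm(4) d(2) xy[OF d(1,2)] yy[OF d(2)] D_const m]
      D_commute(1)[OF sm(5) d(3) xx[OF d(3)] xy[OF d(3,4)] D_const m]
      D_commute(1)[OF sm(6) d(4) xy[OF d(3,4)] yy[OF d(4)] D_const m]
    have "?J m * (\<alpha>x m - \<alpha> m * \<alpha> m) = 0" "?J m * (2 * \<alpha>y m - \<beta>x m - \<alpha> m * \<beta> m) = 0"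
      "?J m * (\<beta>y m - \<beta> m * \<beta> m) = 0" "?J m * (2 * \<beta>x m - \<alpha>y m - \<alpha> m * \<beta> m) = 0"
      using c by algebra+
    then have "\<alpha>x m = \<alpha> m * \<alpha> m" "\<beta>y m = \<beta> m * \<beta> m"
      "2 * \<alpha>y m - \<beta>x m = \<alpha> m * \<beta> m" "2 * \<beta>x m - \<alpha>y m = \<alpha> m * \<beta> m" using J[OF m] by auto
    moreover from this(3,4) have "3 * \<alpha>y m = 3 * (\<alpha> m * \<beta> m)" "3 * \<beta>x m = 3 * (\<alpha> m * \<beta> m)" by algebra+
    ultimately show ?thesis by simp
  qed
  have "D \<alpha> (\<lambda>m. \<alpha> m * \<alpha> m) (\<lambda>m. \<alpha> m * \<beta> m) (\<lambda>m. 0)" "D \<beta> (\<lambda>m. \<alpha> m * \<beta> m) (\<lambda>m. \<beta> m * \<beta> m) (\<lambda>m. 0)"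
    by (rule D_cong[OF d\<alpha>], simp_all add: ab) (rule D_cong[OF d\<beta>], simp_all add: ab)
  then show thesis using that sa d by blast
qed

text \<open>\<alpha>, \<beta> and s = 1 + \<alpha> x + \<beta> y all solve f_x = \<alpha> f, f_y =
  \<beta> f, so \<alpha> and \<beta> are constant multiples of s. Then \<rho> = 1/s is affine in x
  and y, and multiplying u and v by it makes their second derivatives vanish.\<close>

lemma projective_map:
  assumes u: "D u ux uy (\<lambda>m. 0)" and v: "D v vx vy (\<lambda>m. 0)"
    and a: "D \<alpha> (\<lambda>m. \<alpha> m * \<alpha> m) (\<lambda>m. \<alpha> m * \<beta> m) (\<lambda>m. 0)"
    and b: "D \<beta> (\<lambda>m. \<alpha> m * \<beta> m) (\<lambda>m. \<beta> m * \<beta> m) (\<lambda>m. 0)"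
    and d: "D ux (\<lambda>m. 2 * \<alpha> m * ux m) (\<lambda>m. \<beta> m * ux m + \<alpha> m * uy m) (\<lambda>m. 0)"
    "D uy (\<lambda>m. \<beta> m * ux m + \<alpha> m * uy m) (\<lambda>m. 2 * \<beta> m * uy m) (\<lambda>m. 0)"
    "D vx (\<lambda>m. 2 * \<alpha> m * vx m) (\<lambda>m. \<beta> m * vx m + \<alpha> m * vy m) (\<lambda>m. 0)"
    "D vy (\<lambda>m. \<beta> m * vx m + \<alpha> m * vy m) (\<lambda>m. 2 * \<beta> m * vy m) (\<lambda>m. 0)"
    and J: "\<And>m. m \<in> W \<Longrightarrow> ux m * vy m - uy m * vx m \<noteq> 0"
    and s: "\<And>m. m \<in> W \<Longrightarrow> 1 + \<alpha> m * x m + \<beta> m * y m \<noteq> 0"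
  shows "\<exists>H :: complex^3^3. det H \<noteq> 0 \<and> (\<forall>m\<in>W. \<exists>c. c \<noteq> 0 \<and> H *v vector [1, x m, y m] = c *s vector [1, u m, v m])"
proof -
  define s where "s m = 1 + \<alpha> m * x m + \<beta> m * y m" for m
  have s0: "s m \<noteq> 0" if "m \<in> W" for m using s[OF that] by (simp add: s_def)
  have ds: "D s (\<lambda>m. \<alpha> m * s m) (\<lambda>m. \<beta> m * s m) (\<lambda>m. 0)"
    unfolding s_def
    by (rule D_cong[OF D_add[OF D_add[OF D_const[of 1] D_mult[OF a D_coord(1)]] D_mult[OF b D_coord(2)]]])
      (auto simp: algebra_simps)
  have ratio: "\<exists>k. \<forall>m\<in>W. f m = k * s m" if f: "D f (\<lambda>m. \<alpha> m * f m) (\<lambda>m. \<beta> m * f m) (\<lambda>m. 0)" for f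
  proof -
    have "D (\<lambda>m. f m / s m) (\<lambda>m. 0) (\<lambda>m. 0) (\<lambda>m. 0)"
      unfolding D_def
    proof
      fix m assume m: "m \<in> W"
      have "(f has_derivative (\<lambda>v. \<alpha> m * f m * dF m v $ 1 + \<beta> m * f m * dF m v $ 2 + 0 * dF m v $ 3)) (at m)"
        "(s has_derivative (\<lambda>v. \<alpha> m * s m * dF m v $ 1 + \<beta> m * s m * dF m v $ 2 + 0 * dF m v $ 3)) (at m)"
        using f ds m by (auto simp: D_def)
      from has_derivative_divide'[OF this s0[OF m]]
      show "((\<lambda>m. f m / s m) has_derivative (\<lambda>v. 0 * dF m v $ 1 + 0 * dF m v $ 2 + 0 * dF m v $ 3)) (at m)"
        by (rule has_derivative_eq_rhs) (use s0[OF m] in \<open>auto simp: field_simps\<close>)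
    qed
    then obtain k where "\<forall>m\<in>W. f m / s m = k" using D_constant by blast
    then have "\<forall>m\<in>W. f m = k * s m" using s0 by (auto simp: field_simps)
    then show ?thesis by blast
  qed
  obtain \<alpha>0 where a0: "\<And>m. m \<in> W \<Longrightarrow> \<alpha> m = \<alpha>0 * s m"
    using ratio[OF D_cong[OF a], of \<alpha>] by (auto simp: mult.commute)
  obtain \<beta>0 where b0: "\<And>m. m \<in> W \<Longrightarrow> \<beta> m = \<beta>0 * s m"
    using ratio[OF D_cong[OF b], of \<beta>] by (auto simp: mult.commute)
  define \<rho> where "\<rho> m = 1 - \<alpha>0 * x m - \<beta>0 * y m" for m
  have \<rho>s: "\<rho> m * s m = 1" if "m \<in> W" for m
    unfolding \<rho>_def using s_def[of m] a0[OF that] b0[OF that] by algebra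
  have \<rho>a: "\<rho> m * \<alpha> m = \<alpha>0" "\<rho> m * \<beta> m = \<beta>0" if "m \<in> W" for m
    using \<rho>s[OF that] a0[OF that] b0[OF that] by algebra+
  have d\<rho>: "D \<rho> (\<lambda>m. - \<alpha>0) (\<lambda>m. - \<beta>0) (\<lambda>m. 0)"
    unfolding \<rho>_def
    by (rule D_cong[OF D_diff[OF D_diff[OF D_const[of 1] D_cmult[OF D_coord(1), of \<alpha>0]] D_cmult[OF D_coord(2), of \<beta>0]]]) auto
  have affine: "\<exists>k0 k1 k2. \<forall>m\<in>W. \<rho> m * w m = k0 + k1 * x m + k2 * y m"
    if w: "D w wx wy (\<lambda>m. 0)" "D wx (\<lambda>m. 2 * \<alpha> m * wx m) (\<lambda>m. \<beta> m * wx m + \<alpha> m * wy m) (\<lambda>m. 0)"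
    "D wy (\<lambda>m. \<beta> m * wx m + \<alpha> m * wy m) (\<lambda>m. 2 * \<beta> m * wy m) (\<lambda>m. 0)" for w wx wy
  proof -
    \<comment> \<open>The function in question is the x-derivative of \<rho> w; the one treated next
      is the y-derivative.\<close>
    have "D (\<lambda>m. \<rho> m * wx m - \<alpha>0 * w m) (\<lambda>m. 0) (\<lambda>m. 0) (\<lambda>m. 0)"
    proof (rule D_cong[OF D_diff[OF D_mult[OF d\<rho> w(2)] D_cmult[OF w(1), of \<alpha>0]]])
      fix m assume "m \<in> W"
      note ab = \<rho>a[OF this]
      show "- \<alpha>0 * wx m + \<rho> m * (2 * \<alpha> m * wx m) - \<alpha>0 * wx m = 0" unfolding ab[symmetric] by (simp add: algebra_simps)
      show "- \<beta>0 * wx m + \<rho> m * (\<beta> m * wx m + \<alpha> m * wy m) - \<alpha>0 * wy m = 0" unfolding ab[symmetric] by (simp add: algebra_simps)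
    qed auto
    then obtain k1 where k1: "\<forall>m\<in>W. \<rho> m * wx m - \<alpha>0 * w m = k1" using D_constant by blast
    have "D (\<lambda>m. \<rho> m * wy m - \<beta>0 * w m) (\<lambda>m. 0) (\<lambda>m. 0) (\<lambda>m. 0)"
    proof (rule D_cong[OF D_diff[OF D_mult[OF d\<rho> w(3)] D_cmult[OF w(1), of \<beta>0]]])
      fix m assume "m \<in> W"
      note ab = \<rho>a[OF this]
      show "- \<alpha>0 * wy m + \<rho> m * (\<beta> m * wx m + \<alpha> m * wy m) - \<beta>0 * wx m = 0" unfolding ab[symmetric] by (simp add: algebra_simps)
      show "- \<beta>0 * wy m + \<rho> m * (2 * \<beta> m * wy m) - \<beta>0 * wy m = 0" unfolding ab[symmetric] by (simp add: algebra_simps)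
    qed auto
    then obtain k2 where k2: "\<forall>m\<in>W. \<rho> m * wy m - \<beta>0 * w m = k2" using D_constant by blast
    have "D (\<lambda>m. \<rho> m * w m - k1 * x m - k2 * y m) (\<lambda>m. 0) (\<lambda>m. 0) (\<lambda>m. 0)"
      by (rule D_cong[OF D_diff[OF D_diff[OF D_mult[OF d\<rho> w(1)] D_cmult[OF D_coord(1), of k1]] D_cmult[OF D_coord(2), of k2]]])
        (use k1 k2 in auto)
    then obtain k0 where "\<forall>m\<in>W. \<rho> m * w m - k1 * x m - k2 * y m = k0" using D_constant by blast
    then have "\<forall>m\<in>W. \<rho> m * w m = k0 + k1 * x m + k2 * y m" by (auto simp: algebra_simps)
    then show ?thesis by blast
  qed
  obtain k0 k1 k2 where k: "\<And>m. m \<in> W \<Longrightarrow> \<rho> m * u m = k0 + k1 * x m + k2 * y m"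
    using affine[OF u d(1,2)] by blast
  obtain l0 l1 l2 where l: "\<And>m. m \<in> W \<Longrightarrow> \<rho> m * v m = l0 + l1 * x m + l2 * y m"
    using affine[OF v d(3,4)] by blast
  define H :: "complex^3^3" where "H = vector [vector [1, - \<alpha>0, - \<beta>0], vector [k0, k1, k2], vector [l0, l1, l2]]"
  have H: "H *v vector [1, x m, y m] = \<rho> m *s vector [1, u m, v m]" if "m \<in> W" for m
    using k[OF that] l[OF that]
    by (simp add: H_def matrix_vector_mult_def vec_eq_iff forall_3 sum_3) (simp add: \<rho>_def)
  have \<rho>0: "\<rho> m \<noteq> 0" if "m \<in> W" for m using \<rho>s[OF that] by auto
  \<comment> \<open>A left kernel vector of \<open>H\<close> would be an affine relation between u
    and v, contradicting their nonzero Jacobian.\<close>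
  have "det H \<noteq> 0"
  proof
    assume "det H = 0"
    then have "\<not> invertible (transpose H)" by (simp add: invertible_det_nz)
    then obtain \<kappa> where \<kappa>: "transpose H *v \<kappa> = 0" "\<kappa> \<noteq> 0"
      by (metis invertible_left_inverse matrix_left_invertible_ker)
    have z: "\<kappa> $ 1 + \<kappa> $ 2 * u m + \<kappa> $ 3 * v m = 0" if m: "m \<in> W" for m
    proof -
      have "(\<Sum>i\<in>UNIV. \<kappa> $ i * (H *v vector [1, x m, y m]) $ i) = (\<Sum>i\<in>UNIV. (transpose H *v \<kappa>) $ i * (vector [1, x m, y m] :: complex^3) $ i)"
        by (simp add: matrix_vector_mult_def transpose_def sum_3 algebra_simps)
      then have "\<rho> m * (\<kappa> $ 1 + \<kappa> $ 2 * u m + \<kappa> $ 3 * v m) = 0"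
        using \<kappa>(1) by (simp add: H[OF m] sum_3 algebra_simps)
      then show ?thesis using \<rho>0[OF m] by simp
    qed
    have "D (\<lambda>m. 0) (\<lambda>m. \<kappa> $ 2 * ux m + \<kappa> $ 3 * vx m) (\<lambda>m. \<kappa> $ 2 * uy m + \<kappa> $ 3 * vy m) (\<lambda>m. 0)"
      by (rule D_cong[OF D_add[OF D_add[OF D_const[of "\<kappa> $ 1"] D_cmult[OF u, of "\<kappa> $ 2"]] D_cmult[OF v, of "\<kappa> $ 3"]]])
        (simp_all add: z)
    note D\<kappa> = this
    obtain m where m: "m \<in> W" using W_ne by blast
    have "\<kappa> $ 2 * ux m + \<kappa> $ 3 * vx m = 0" "\<kappa> $ 2 * uy m + \<kappa> $ 3 * vy m = 0"
      using D_unique(1,2)[OF D\<kappa> D_const m] by simp_all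
    then have "\<kappa> $ 2 * (ux m * vy m - uy m * vx m) = 0" "\<kappa> $ 3 * (ux m * vy m - uy m * vx m) = 0" by algebra+
    then have "\<kappa> $ 2 = 0" "\<kappa> $ 3 = 0" using J[OF m] by auto
    then have "\<kappa> = 0" using z[OF m] by (simp add: vec_eq_iff forall_3)
    then show False using \<kappa>(2) by simp
  qed
  moreover have "\<exists>c. c \<noteq> 0 \<and> H *v vector [1, x m, y m] = c *s vector [1, u m, v m]" if "m \<in> W" for m
    using H[OF that] \<rho>0[OF that] by blast
  ultimately show ?thesis by blast
qed

end

text \<open>The factor 1 + \<alpha> x + \<beta> y is 1 at \<open>m0\<close> and so is nonzero near
  it. A ball is taken because the smaller domain has to be convex again.\<close>

lemma (in complex_frame) locally_projective:
  assumes sm: "smooth_on W u" "smooth_on W v" "smooth_on W ux" "smooth_on W uy" "smooth_on W vx" "smooth_on W vy"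
    and u: "D u ux uy (\<lambda>m. 0)" and v: "D v vx vy (\<lambda>m. 0)" and r: "D r rx ry rp"
    and rX: "\<And>m. m \<in> W \<Longrightarrow> rx m + p m * ry m = 0"
    and X: "\<And>m. m \<in> W \<Longrightarrow> vx m + p m * vy m = r m * (ux m + p m * uy m)"
    and J: "\<And>m. m \<in> W \<Longrightarrow> ux m * vy m - uy m * vx m \<noteq> 0"
    and m0: "m0 \<in> W" "x m0 = 0" "y m0 = 0"
  shows "\<exists>W' (H :: complex^3^3). W' \<subseteq> W \<and> m0 \<in> W' \<and> complex_frame W' F \<and> det H \<noteq> 0 \<and>
     (\<forall>m\<in>W'. \<exists>c. c \<noteq> 0 \<and> H *v vector [1, x m, y m] = c *s vector [1, u m, v m])"
proof -
  obtain \<alpha> \<beta> where sa: "smooth_on W \<alpha>" "smooth_on W \<beta>"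
    and d: "D \<alpha> (\<lambda>m. \<alpha> m * \<alpha> m) (\<lambda>m. \<alpha> m * \<beta> m) (\<lambda>m. 0)"
    "D \<beta> (\<lambda>m. \<alpha> m * \<beta> m) (\<lambda>m. \<beta> m * \<beta> m) (\<lambda>m. 0)"
    "D ux (\<lambda>m. 2 * \<alpha> m * ux m) (\<lambda>m. \<beta> m * ux m + \<alpha> m * uy m) (\<lambda>m. 0)"
    "D uy (\<lambda>m. \<beta> m * ux m + \<alpha> m * uy m) (\<lambda>m. 2 * \<beta> m * uy m) (\<lambda>m. 0)"
    "D vx (\<lambda>m. 2 * \<alpha> m * vx m) (\<lambda>m. \<beta> m * vx m + \<alpha> m * vy m) (\<lambda>m. 0)"
    "D vy (\<lambda>m. \<beta> m * vx m + \<alpha> m * vy m) (\<lambda>m. 2 * \<beta> m * vy m) (\<lambda>m. 0)"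
    by (rule projective_structure[OF sm u v r rX X J])
  let ?s = "\<lambda>m. 1 + \<alpha> m * x m + \<beta> m * y m"
  have "continuous_on W ?s"
    by (intro smooth_on_continuous smooth_on_add smooth_on_mult smooth_on_const open_W sa smooth_coord)
  then have "open (W \<inter> ?s -` (- {0}))"
    by (rule continuous_open_preimage[OF _ open_W]) auto
  moreover have "m0 \<in> W \<inter> ?s -` (- {0})" using m0 by simp
  ultimately obtain e where e: "e > 0" "ball m0 e \<subseteq> W \<inter> ?s -` (- {0})"
    unfolding open_contains_ball by blast
  interpret B: complex_frame "ball m0 e" F
    by unfold_locales (use e in \<open>auto intro!: smooth_on_subset[OF smooth_F] det_F\<close>)
  have DB: "B.D f a b c" if "D f a b c" for f a b c
    using that e unfolding D_def B.D_def by blast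
  have "\<exists>H :: complex^3^3. det H \<noteq> 0 \<and> (\<forall>m\<in>ball m0 e. \<exists>c. c \<noteq> 0 \<and> H *v vector [1, x m, y m] = c *s vector [1, u m, v m])"
  proof (rule B.projective_map[OF DB[OF u] DB[OF v] d[THEN DB]])
    show "ux m * vy m - uy m * vx m \<noteq> 0" if "m \<in> ball m0 e" for m using J that e(2) by blast
    show "?s m \<noteq> 0" if "m \<in> ball m0 e" for m using that e(2) by blast
  qed
  moreover have "ball m0 e \<subseteq> W" "m0 \<in> ball m0 e" using e by auto
  ultimately show ?thesis using B.complex_frame_axioms by blast
qed

section \<open>Normal forms under reality conditions\<close>

definition cnjv :: "complex^'n \<Rightarrow> complex^'n" where
  "cnjv z = (\<chi> i. cnj (z $ i))"

definition cnjm :: "complex^'n^'m \<Rightarrow> complex^'n^'m" where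
  "cnjm A = (\<chi> i j. cnj (A $ i $ j))"

lemma cnjv_nth [simp]: "cnjv z $ i = cnj (z $ i)" by (simp add: cnjv_def)
lemma cnjm_nth [simp]: "cnjm A $ i $ j = cnj (A $ i $ j)" by (simp add: cnjm_def)

lemma cnjv_mult: "cnjv (A *v z) = cnjm A *v cnjv z"
  by (simp add: vec_eq_iff matrix_vector_mult_def)

lemma cnjv_vmult: "cnjv (z v* A) = cnjv z v* cnjm A"
  by (simp add: vec_eq_iff vector_matrix_mult_def)

lemma cnjm_mult: "cnjm (A ** B) = cnjm A ** cnjm B"
  by (simp add: vec_eq_iff matrix_matrix_mult_def)

lemma cnjv_cnjv [simp]: "cnjv (cnjv z) = z"
  by (simp add: vec_eq_iff)

lemma cnjm_cnjm [simp]: "cnjm (cnjm A) = A"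
  by (simp add: vec_eq_iff)

lemma cnjv_scale: "cnjv (c *s z) = cnj c *s cnjv z"
  by (simp add: vec_eq_iff)

lemma det_cnjm: "det (cnjm (A :: complex^3^3)) = cnj (det A)"
  by (simp add: det_3)

lemma matrix_inv_det:
  fixes A :: "'k::field^'n^'n"
  assumes "det A \<noteq> 0"
  shows "A ** matrix_inv A = mat 1" "matrix_inv A ** A = mat 1"
proof -
  have "invertible A" using assms by (simp add: invertible_det_nz)
  then have "A ** matrix_inv A = mat 1 \<and> matrix_inv A ** A = mat 1"
    unfolding invertible_def matrix_inv_def by (rule someI_ex)
  then show "A ** matrix_inv A = mat 1" "matrix_inv A ** A = mat 1" by auto
qed

context complex_frame begin

definition point_vec where "point_vec m = (vector [1, x m, y m] :: complex^3)"
text \<open>Up to scale, the only form that vanishes on \<open>point_vec m\<close> and on its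
  X-derivative (0, 1, p).\<close>

definition form_vec where "form_vec m = (vector [x m * p m - y m, - p m, 1] :: complex^3)"

lemma point_vec_nth [simp]: "point_vec m $ 1 = 1" "point_vec m $ 2 = x m" "point_vec m $ 3 = y m"
  by (simp_all add: point_vec_def)

lemma form_vec_nth [simp]: "form_vec m $ 1 = x m * p m - y m" "form_vec m $ 2 = - p m" "form_vec m $ 3 = 1"
  by (simp_all add: form_vec_def)

text \<open>The differentials of the conjugates are the conjugates of dx, dy, dp. The conjugate
  Jacobian is the coefficient matrix times the Jacobian, so that matrix is invertible.\<close>

lemma D_cnj:
  assumes D: "D (\<lambda>m. cnj (x m)) ax bx cx" "D (\<lambda>m. cnj (y m)) ay b2 cy" "D (\<lambda>m. cnj (p m)) ap bp cp" and m: "m \<in> W"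
  shows "cnj (dF m v $ 1) = ax m * dF m v $ 1 + bx m * dF m v $ 2 + cx m * dF m v $ 3"
    "cnj (dF m v $ 2) = ay m * dF m v $ 1 + b2 m * dF m v $ 2 + cy m * dF m v $ 3"
    "cnj (dF m v $ 3) = ap m * dF m v $ 1 + bp m * dF m v $ 2 + cp m * dF m v $ 3"
    "det (vector [vector [ax m, bx m, cx m], vector [ay m, b2 m, cy m], vector [ap m, bp m, cp m]] :: complex^3^3) \<noteq> 0"
proof -
  have h: "((\<lambda>m. cnj (F m $ i)) has_derivative (\<lambda>v. cnj (dF m v $ i))) (at m)" for i
    by (intro bounded_linear.has_derivative[OF bounded_linear_cnj] bounded_linear.has_derivative[OF bounded_linear_vec_nth] F_has_derivative m)
  show 1: "cnj (dF m v $ 1) = ax m * dF m v $ 1 + bx m * dF m v $ 2 + cx m * dF m v $ 3" for v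
    using fun_cong[OF has_derivative_unique[OF h D(1)[unfolded D_def, rule_format, OF m]]] .
  show 2: "cnj (dF m v $ 2) = ay m * dF m v $ 1 + b2 m * dF m v $ 2 + cy m * dF m v $ 3" for v
    using fun_cong[OF has_derivative_unique[OF h D(2)[unfolded D_def, rule_format, OF m]]] .
  show 3: "cnj (dF m v $ 3) = ap m * dF m v $ 1 + bp m * dF m v $ 2 + cp m * dF m v $ 3" for v
    using fun_cong[OF has_derivative_unique[OF h D(3)[unfolded D_def, rule_format, OF m]]] .
  let ?B = "vector [vector [ax m, bx m, cx m], vector [ay m, b2 m, cy m], vector [ap m, bp m, cp m]] :: complex^3^3"
  let ?J = "\<chi> i j. dF m (axis j 1) $ i"
  have "cnjm ?J = ?B ** ?J"
    by (simp add: vec_eq_iff forall_3 matrix_matrix_mult_def sum_3 1 2 3)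
  then have "cnj (det ?J) = det ?B * det ?J" by (simp only: det_mul flip: det_cnjm)
  then show "det ?B \<noteq> 0" using det_F[OF m] by auto
qed

lemma smooth_cnj: "smooth_on W (\<lambda>m. cnj (x m))" "smooth_on W (\<lambda>m. cnj (y m))" "smooth_on W (\<lambda>m. cnj (p m))"
  using smooth_coord[THEN smooth_on_linear[OF open_W bounded_linear_cnj]] by blast+

text \<open>Written out, the eigenvector condition is two quadratic relations between x and y, and
  by \<open>quadratic_zero\<close> all their coefficients vanish.\<close>

lemma eigenvector_scalar:
  fixes K :: "complex^3^3"
  assumes "\<And>m. m \<in> W \<Longrightarrow> \<exists>c. K *v point_vec m = c *s point_vec m"
  obtains k where "K = mat k"
proof -
  have K: "(K *v point_vec m) $ i = K $ i $ 1 + K $ i $ 2 * x m + K $ i $ 3 * y m" for m i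
    by (simp add: matrix_vector_mult_def sum_3)
  have e: "K $ 2 $ 1 + K $ 2 $ 2 * x m + K $ 2 $ 3 * y m = (K $ 1 $ 1 + K $ 1 $ 2 * x m + K $ 1 $ 3 * y m) * x m"
    "K $ 3 $ 1 + K $ 3 $ 2 * x m + K $ 3 $ 3 * y m = (K $ 1 $ 1 + K $ 1 $ 2 * x m + K $ 1 $ 3 * y m) * y m" if m: "m \<in> W" for m
  proof -
    obtain c where c: "K *v point_vec m = c *s point_vec m" using assms[OF m] by blast
    have "(K *v point_vec m) $ i = c * point_vec m $ i" for i unfolding c by simp
    from this[of 1] this[of 2] this[of 3]
    show "K $ 2 $ 1 + K $ 2 $ 2 * x m + K $ 2 $ 3 * y m = (K $ 1 $ 1 + K $ 1 $ 2 * x m + K $ 1 $ 3 * y m) * x m"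
     "K $ 3 $ 1 + K $ 3 $ 2 * x m + K $ 3 $ 3 * y m = (K $ 1 $ 1 + K $ 1 $ 2 * x m + K $ 1 $ 3 * y m) * y m"
      unfolding K by simp_all
  qed
  note q1 = quadratic_zero[of "K $ 2 $ 1" "K $ 2 $ 2 - K $ 1 $ 1" "K $ 2 $ 3" "- K $ 1 $ 2" "- K $ 1 $ 3" 0]
  note q2 = quadratic_zero[of "K $ 3 $ 1" "K $ 3 $ 2" "K $ 3 $ 3 - K $ 1 $ 1" 0 "- K $ 1 $ 2" "- K $ 1 $ 3"]
  have 1: "K $ 2 $ 1 + (K $ 2 $ 2 - K $ 1 $ 1) * x m + K $ 2 $ 3 * y m + (- K $ 1 $ 2) * x m * x m + (- K $ 1 $ 3) * x m * y m + 0 * y m * y m = 0"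
    if "m \<in> W" for m using e(1)[OF that] by (simp add: algebra_simps)
  have 2: "K $ 3 $ 1 + K $ 3 $ 2 * x m + (K $ 3 $ 3 - K $ 1 $ 1) * y m + 0 * x m * x m + (- K $ 1 $ 2) * x m * y m + (- K $ 1 $ 3) * y m * y m = 0"
    if "m \<in> W" for m using e(2)[OF that] by (simp add: algebra_simps)
  have "K = mat (K $ 1 $ 1)"
    using q1[OF 1] q2[OF 2] by (simp add: vec_eq_iff forall_3 mat_def)
  then show thesis by (rule that)
qed

text \<open>X kills \<open>w\<close>, so differentiating w H z = 0 along X shows that w H also kills
  X z = (0, 1, p). The forms killing z and X z are the multiples of \<open>form_vec\<close>, whose
  last entry is 1.\<close>

lemma annihilator_multiple:
  fixes w :: "real^3 \<Rightarrow> complex^3" and H :: "complex^3^3"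
  assumes w: "\<And>j. D (\<lambda>m. w m $ j) (a j) (b j) (c j)"
    and X: "\<And>j m. m \<in> W \<Longrightarrow> a j m + p m * b j m = 0"
    and z: "\<And>m. m \<in> W \<Longrightarrow> (\<Sum>j\<in>UNIV. w m $ j * (H *v point_vec m) $ j) = 0" and m: "m \<in> W"
  shows "w m v* H = (w m v* H) $ 3 *s form_vec m"
proof -
  have dH: "D (\<lambda>m. (H *v point_vec m) $ j) (\<lambda>m. H $ j $ 2) (\<lambda>m. H $ j $ 3) (\<lambda>m. 0)" for j
    by (rule D_cong[OF D_add[OF D_add[OF D_const[of "H $ j $ 1"] D_cmult[OF D_coord(1), of "H $ j $ 2"]] D_cmult[OF D_coord(2), of "H $ j $ 3"]]])
      (auto simp: matrix_vector_mult_def sum_3)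
  note g = D_add[OF D_add[OF D_mult[OF w[of 1] dH[of 1]] D_mult[OF w[of 2] dH[of 2]]] D_mult[OF w[of 3] dH[of 3]]]
  have g0: "w m $ 1 * (H *v point_vec m) $ 1 + w m $ 2 * (H *v point_vec m) $ 2 + w m $ 3 * (H *v point_vec m) $ 3 = 0" if "m \<in> W" for m
    using z[OF that] by (simp add: sum_3)
  note u = D_unique[OF D_cong[OF g g0 refl refl refl] D_const m]
  let ?n = "w m v* H"
  have n: "?n $ i = w m $ 1 * H $ 1 $ i + w m $ 2 * H $ 2 $ i + w m $ 3 * H $ 3 $ i" for i
    by (simp add: vector_matrix_mult_def sum_3 mult.commute)
  have ux: "a 1 m * (H *v point_vec m) $ 1 + a 2 m * (H *v point_vec m) $ 2 + a 3 m * (H *v point_vec m) $ 3 + ?n $ 2 = 0"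
    unfolding n using u(1) by (simp add: algebra_simps)
  have uy: "b 1 m * (H *v point_vec m) $ 1 + b 2 m * (H *v point_vec m) $ 2 + b 3 m * (H *v point_vec m) $ 3 + ?n $ 3 = 0"
    unfolding n using u(2) by (simp add: algebra_simps)
  have a: "a j m = - (p m * b j m)" for j using X[OF m, of j] by (simp add: add_eq_0_iff)
  have 2: "?n $ 2 = - (p m * ?n $ 3)"
    using ux uy unfolding a by algebra
  have "?n $ 1 + ?n $ 2 * x m + ?n $ 3 * y m = 0"
    unfolding n using g0[OF m] by (simp add: matrix_vector_mult_def sum_3 algebra_simps)
  then have 1: "?n $ 1 = ?n $ 3 * (x m * p m - y m)"
    unfolding 2 by (simp add: algebra_simps eq_neg_iff_add_eq_0)
  show ?thesis using 1 2 by (simp add: vec_eq_iff[of ?n] forall_3)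
qed

end

text \<open>By completing the square.\<close>

lemma hermitian_normal_form:
  fixes S :: "complex^3^3"
  assumes h: "\<And>i j. cnj (S $ j $ i) = S $ i $ j" and 0: "S $ 1 $ 1 = 0" "S $ 2 $ 1 = 0" "S $ 2 $ 2 = 1" "det S \<noteq> 0"
  obtains A where "det A \<noteq> 0" "transpose (cnjm A) ** J_mat ** A = S"
proof -
  define A :: "complex^3^3" where "A = vector [vector [S $ 3 $ 1, 0, (S $ 3 $ 3 - cnj (S $ 2 $ 3) * S $ 2 $ 3) / 2],
    vector [0, 1, S $ 2 $ 3], vector [0, 0, 1]]"
  have c: "cnj (S $ 3 $ 1) = S $ 1 $ 3" "cnj (S $ 3 $ 3) = S $ 3 $ 3" "cnj (S $ 2 $ 3) = S $ 3 $ 2" "cnj (S $ 3 $ 2) = S $ 2 $ 3"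
    "S $ 1 $ 2 = 0"
    using h 0 by auto (metis complex_cnj_zero)
  have "det S = - S $ 1 $ 3 * S $ 3 $ 1" unfolding det_3 using 0 c by simp
  then have "det A \<noteq> 0" using 0 unfolding det_3 A_def by auto
  moreover have "transpose (cnjm A) ** J_mat ** A = S"
    using 0 c by (simp add: vec_eq_iff forall_3 matrix_matrix_mult_def sum_3 transpose_def A_def J_mat_def field_simps)
  ultimately show thesis by (rule that)
qed

text \<open>\<open>P\<close> and \<open>Q\<close> are the real and imaginary part of the frame field
  dual to dp, whose conjugate points along X. Projective rigidity gives a constant correlation
  \<open>G\<close> from points to conjugate forms. Comparison with its adjoint shows that it is
  Hermitian up to a scalar.\<close>

lemma (in complex_frame) CR_normal_form:
  assumes CR: "\<And>m. m \<in> W \<Longrightarrow> \<exists>P Q \<tau>. dF m P + \<i> *s dF m Q = vector [0, 0, 1] \<and>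
     dF m P - \<i> *s dF m Q = \<tau> *s vector [1, p m, 0]"
    and m0: "m0 \<in> W" "F m0 = 0"
  shows "\<exists>W' A. W' \<subseteq> W \<and> m0 \<in> W' \<and> open W' \<and> det A \<noteq> 0 \<and>
    (\<forall>m\<in>W'. \<exists>c. c \<noteq> 0 \<and> (transpose (cnjm A) ** J_mat ** A) *v point_vec m = c *s cnjv (form_vec m))"
proof -
  obtain ax bx cx where X: "smooth_on W ax" "smooth_on W bx" "smooth_on W cx" "D (\<lambda>m. cnj (x m)) ax bx cx"
    by (rule D_exists[OF smooth_cnj(1)])
  obtain ay b2 cy where Y: "smooth_on W ay" "smooth_on W b2" "smooth_on W cy" "D (\<lambda>m. cnj (y m)) ay b2 cy"
    by (rule D_exists[OF smooth_cnj(2)])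
  obtain ap bp cp where P: "smooth_on W ap" "smooth_on W bp" "smooth_on W cp" "D (\<lambda>m. cnj (p m)) ap bp cp"
    by (rule D_exists[OF smooth_cnj(3)])
  note B = D_cnj[OF X(4) Y(4) P(4)]
  \<comment> \<open>Conjugation exchanges P and X up to the factor \<tau>: P kills conj p, X kills
    conj x and conj y, and P conj y = conj p P conj x. That \<tau> is nonzero follows from
    \<open>p1\<close>.\<close>
  have key: "cp m = 0 \<and> cy m = cnj (p m) * cx m \<and> ax m + p m * bx m = 0 \<and> ay m + p m * b2 m = 0" if m: "m \<in> W" for m
  proof -
    obtain v w \<tau> where 1: "dF m v + \<i> *s dF m w = vector [0, 0, 1]"
      and 2: "dF m v - \<i> *s dF m w = \<tau> *s vector [1, p m, 0]" using CR[OF m] by blast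
    have a: "dF m v $ 1 + \<i> * dF m w $ 1 = 0" "dF m v $ 2 + \<i> * dF m w $ 2 = 0" "dF m v $ 3 + \<i> * dF m w $ 3 = 1"
      using 1 by (auto simp: vec_eq_iff forall_3)
    have b: "dF m v $ 1 - \<i> * dF m w $ 1 = \<tau>" "dF m v $ 2 - \<i> * dF m w $ 2 = \<tau> * p m" "dF m v $ 3 - \<i> * dF m w $ 3 = 0"
      using 2 by (auto simp: vec_eq_iff forall_3)
    have c: "cnj (dF m v $ 1) - \<i> * cnj (dF m w $ 1) = 0" "cnj (dF m v $ 2) - \<i> * cnj (dF m w $ 2) = 0" "cnj (dF m v $ 3) - \<i> * cnj (dF m w $ 3) = 1"
      "cnj (dF m v $ 1) + \<i> * cnj (dF m w $ 1) = cnj \<tau>" "cnj (dF m v $ 2) + \<i> * cnj (dF m w $ 2) = cnj \<tau> * cnj (p m)" "cnj (dF m v $ 3) + \<i> * cnj (dF m w $ 3) = 0"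
      using a[THEN arg_cong[of _ _ cnj]] b[THEN arg_cong[of _ _ cnj]] by auto
    have d: "a1 * (dF m v $ 1 + \<i> * dF m w $ 1) + a2 * (dF m v $ 2 + \<i> * dF m w $ 2) + a3 * (dF m v $ 3 + \<i> * dF m w $ 3) = a3"
        "a1 * (dF m v $ 1 - \<i> * dF m w $ 1) + a2 * (dF m v $ 2 - \<i> * dF m w $ 2) + a3 * (dF m v $ 3 - \<i> * dF m w $ 3) = \<tau> * (a1 + p m * a2)" for a1 a2 a3
      unfolding a b by (simp_all add: algebra_simps)
    have x3: "cx m = cnj \<tau>" using d(1)[of "ax m" "bx m" "cx m"] c(4) unfolding B(1)[OF m] by (simp add: algebra_simps)
    have y3: "cy m = cnj \<tau> * cnj (p m)" using d(1)[of "ay m" "b2 m" "cy m"] c(5) unfolding B(2)[OF m] by (simp add: algebra_simps)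
    have p3: "cp m = 0" using d(1)[of "ap m" "bp m" "cp m"] c(6) unfolding B(3)[OF m] by (simp add: algebra_simps)
    have x1: "\<tau> * (ax m + p m * bx m) = 0" using d(2)[of "ax m" "bx m" "cx m"] c(1) unfolding B(1)[OF m] by (simp add: algebra_simps)
    have y1: "\<tau> * (ay m + p m * b2 m) = 0" using d(2)[of "ay m" "b2 m" "cy m"] c(2) unfolding B(2)[OF m] by (simp add: algebra_simps)
    have p1: "\<tau> * (ap m + p m * bp m) = 1" using d(2)[of "ap m" "bp m" "cp m"] c(3) unfolding B(3)[OF m] by (simp add: algebra_simps)
    show ?thesis using x3 y3 p3 x1 y1 p1 by auto
  qed
  \<comment> \<open>The conjugate form is (- v, - u, 1) in these functions. P kills both, and X v =
    - conj x X u, so r = - conj x, which X kills.\<close>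
  let ?u = "\<lambda>m. cnj (p m)" and ?v = "\<lambda>m. cnj (y m) - cnj (p m) * cnj (x m)" and ?r = "\<lambda>m. - cnj (x m)"
  define vx where "vx m = ay m - (ap m * cnj (x m) + cnj (p m) * ax m)" for m
  define vy where "vy m = b2 m - (bp m * cnj (x m) + cnj (p m) * bx m)" for m
  have du: "D ?u ap bp (\<lambda>m. 0)" by (rule D_cong[OF P(4)]) (auto simp: key)
  have dv: "D ?v vx vy (\<lambda>m. 0)"
    by (rule D_cong[OF D_diff[OF Y(4) D_mult[OF P(4) X(4)]]]) (auto simp: key vx_def vy_def)
  have dr: "D ?r (\<lambda>m. - ax m) (\<lambda>m. - bx m) (\<lambda>m. - cx m)"
    by (rule D_cong[OF D_cmult[OF X(4), of "-1"]]) auto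
  have "\<exists>W' (H :: complex^3^3). W' \<subseteq> W \<and> m0 \<in> W' \<and> complex_frame W' F \<and> det H \<noteq> 0 \<and>
     (\<forall>m\<in>W'. \<exists>c. c \<noteq> 0 \<and> H *v vector [1, x m, y m] = c *s vector [1, ?u m, ?v m])"
  proof (rule locally_projective[OF smooth_cnj(3) _ P(1,2) _ _ du dv dr])
    show "smooth_on W ?v" by (intro smooth_on_diff smooth_on_mult smooth_cnj open_W)
    show "smooth_on W vx" "smooth_on W vy" unfolding vx_def[abs_def] vy_def[abs_def]
      by (intro smooth_on_diff smooth_on_add smooth_on_mult smooth_cnj open_W X Y P)+
    show "- ax m + p m * - bx m = 0" if "m \<in> W" for m using key[OF that] by (simp add: add_eq_0_iff)
    show "vx m + p m * vy m = - cnj (x m) * (ap m + p m * bp m)" if "m \<in> W" for m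
    proof -
      have k: "ax m = - (p m * bx m)" "ay m = - (p m * b2 m)" using key[OF that] by (auto simp: add_eq_0_iff)
      show ?thesis unfolding vx_def vy_def k by (simp add: algebra_simps)
    qed
    \<comment> \<open>Once \<open>cp = 0\<close> and \<open>cy = cnj p * cx\<close> are inserted,
      the determinant of the conjugate frame contains this Jacobian as a factor.\<close>
    show "ap m * vy m - bp m * vx m \<noteq> 0" if m: "m \<in> W" for m
    proof -
      have "det (vector [vector [ax m, bx m, cx m], vector [ay m, b2 m, cy m], vector [ap m, bp m, cp m]] :: complex^3^3)
         = - cx m * (ap m * vy m - bp m * vx m)"
        using key[OF m] unfolding det_3 vx_def vy_def by (simp add: algebra_simps)
      then show ?thesis using B(4)[OF m] by (metis mult_zero_right)
    qed
  qed (use m0 in auto)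
  then obtain W' H where W': "W' \<subseteq> W" "m0 \<in> W'" "complex_frame W' F" and H: "det H \<noteq> 0"
    and Hz: "\<And>m. m \<in> W' \<Longrightarrow> \<exists>c. c \<noteq> 0 \<and> H *v point_vec m = c *s vector [1, ?u m, ?v m]"
    unfolding point_vec_def by blast
  interpret B: complex_frame W' F by fact
  \<comment> \<open>The signed permutation that turns (1, u, v) into the conjugate form (- v, - u,
    1).\<close>
  define E :: "complex^3^3" where "E = vector [vector [0, 0, -1], vector [0, -1, 0], vector [1, 0, 0]]"
  define G where "G = E ** H"
  have "det E = -1" by (simp add: E_def det_3)
  then have G0: "det G \<noteq> 0" using H by (simp add: G_def det_mul)
  have Gz: "\<exists>c. c \<noteq> 0 \<and> G *v point_vec m = c *s cnjv (form_vec m)" if m: "m \<in> W'" for m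
  proof -
    obtain c where c: "c \<noteq> 0" "H *v point_vec m = c *s vector [1, ?u m, ?v m]" using Hz[OF m] by blast
    have "G *v point_vec m = E *v (H *v point_vec m)" by (simp add: G_def matrix_vector_mul_assoc)
    also have "\<dots> = c *s cnjv (form_vec m)"
      unfolding c by (simp add: vec_eq_iff forall_3 E_def matrix_vector_mult_def sum_3 algebra_simps)
    finally show ?thesis using c by blast
  qed
  have DB: "B.D f a b c" if "D f a b c" for f a b c
    using that W'(1) unfolding D_def B.D_def by blast
  \<comment> \<open>The conjugate point kills G z, because l kills z, and X kills the conjugate
    point; so \<open>annihilator_multiple\<close> applies.\<close>
  have ann: "cnjv (point_vec m) v* G = (cnjv (point_vec m) v* G) $ 3 *s form_vec m" if m: "m \<in> W'" for m
  proof (rule B.annihilator_multiple[OF _ _ _ m, where w = "\<lambda>m. cnjv (point_vec m)" and H = G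
        and a = "\<lambda>j m. vector [0, ax m, ay m] $ j" and b = "\<lambda>j m. vector [0, bx m, b2 m] $ j" and c = "\<lambda>j m. vector [0, cx m, cy m] $ j"])
    show "B.D (\<lambda>m. cnjv (point_vec m) $ j) (\<lambda>m. vector [0, ax m, ay m] $ j) (\<lambda>m. vector [0, bx m, b2 m] $ j) (\<lambda>m. vector [0, cx m, cy m] $ j)" for j :: 3
      using exhaust_3[of j] B.D_const[of 1] DB[OF X(4)] DB[OF Y(4)] by auto
    show "vector [0, ax n, ay n] $ j + p n * vector [0, bx n, b2 n] $ j = 0" if "n \<in> W'" for j :: 3 and n
      using exhaust_3[of j] key that W'(1) by auto
    show "(\<Sum>j\<in>UNIV. cnjv (point_vec n) $ j * (G *v point_vec n) $ j) = 0" if n: "n \<in> W'" for n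
    proof -
      obtain c where c: "G *v point_vec n = c *s cnjv (form_vec n)" using Gz[OF n] by blast
      show ?thesis unfolding c by (simp add: sum_3 algebra_simps)
    qed
  qed
  obtain Gi where Gi: "Gi ** G = mat 1" "G ** Gi = mat 1" using G0 by (auto simp: invertible_det_nz[symmetric] invertible_def)
  let ?Ga = "transpose (cnjm G)"
  \<comment> \<open>Conjugating \<open>ann\<close>, the adjoint of \<open>G\<close> sends each point
    to a multiple of the conjugate form. \<open>G\<close> does the same with a nonzero factor, so
    the quotient of the two has every point as an eigenvector.\<close>
  have "\<exists>c. (Gi ** ?Ga) *v point_vec m = c *s point_vec m" if m: "m \<in> W'" for m
  proof -
    obtain c where c: "c \<noteq> 0" "G *v point_vec m = c *s cnjv (form_vec m)" using Gz[OF m] by blast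
    have "?Ga *v point_vec m = cnjv (cnjv (point_vec m) v* G)"
      by (simp add: cnjv_vmult)
    then obtain n where "?Ga *v point_vec m = n *s cnjv (form_vec m)"
      using ann[OF m] by (metis cnjv_scale)
    also have "cnjv (form_vec m) = inverse c *s (G *v point_vec m)" using c by simp
    finally have "?Ga *v point_vec m = (n * inverse c) *s (G *v point_vec m)" by simp
    then have "Gi *v (?Ga *v point_vec m) = (n * inverse c) *s (Gi *v (G *v point_vec m))"
      by (simp add: vector_scalar_commute)
    then have "(Gi ** ?Ga) *v point_vec m = (n * inverse c) *s ((Gi ** G) *v point_vec m)"
      by (simp only: matrix_vector_mul_assoc)
    then show ?thesis by (simp only: Gi matrix_vector_mul_lid) blast
  qed
  then obtain k where k: "Gi ** ?Ga = mat k"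
    using B.eigenvector_scalar by blast
  have "?Ga = G ** (Gi ** ?Ga)" by (simp add: matrix_mul_assoc Gi)
  then have "?Ga = G ** mat k" by (simp add: k)
  then have Gk: "cnj (G $ j $ i) = k * G $ i $ j" for i j
    by (simp add: vec_eq_iff transpose_def matrix_matrix_mult_def mat_def if_distrib cong: if_cong)
  \<comment> \<open>At the base flag the point is (1, 0, 0) and the form (0, 0, 1), which fixes the
    first column of \<open>G\<close> up to a factor.\<close>
  have z0: "point_vec m0 = axis 1 1" "form_vec m0 = axis 3 1"
    using m0 by (simp_all add: vec_eq_iff forall_3 axis_def)
  obtain c0 where c0: "c0 \<noteq> 0" "G *v point_vec m0 = c0 *s cnjv (form_vec m0)" using Gz[OF W'(2)] by blast
  have "G $ i $ 1 = (if i = 3 then c0 else 0)" for i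
    using c0(2)[unfolded vec_eq_iff, rule_format, of i]
    by (simp add: z0 matrix_vector_mult_def axis_def if_distrib[of "\<lambda>t. _ * t"] cong: if_cong split: if_splits)
  then have G1: "G $ 1 $ 1 = 0" "G $ 2 $ 1 = 0" "G $ 3 $ 1 \<noteq> 0" using c0(1) by auto
  have k0: "k \<noteq> 0" using Gk[where i = 1 and j = 3] G1(3) by auto
  have "G $ 1 $ 2 = 0" using Gk[where i = 1 and j = 2] G1 k0 by simp
  then have "det G = - G $ 1 $ 3 * G $ 2 $ 2 * G $ 3 $ 1" unfolding det_3 using G1 by simp
  then have G2: "G $ 2 $ 2 \<noteq> 0" using G0 by auto
  \<comment> \<open>By \<open>Gk\<close> at the middle entry, dividing by that entry absorbs the
    scalar \<open>k\<close>, so \<open>S\<close> is Hermitian; the middle entry is nonzero because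
    it is a factor of the determinant.\<close>
  define S where "S = (\<chi> i j. G $ i $ j / G $ 2 $ 2)"
  have Sz: "S *v v = inverse (G $ 2 $ 2) *s (G *v v)" for v
    by (simp add: vec_eq_iff S_def matrix_vector_mult_def sum_3 field_simps add_divide_distrib)
  have "cnj (S $ j $ i) = S $ i $ j" for i j
    unfolding S_def using k0 by (simp add: Gk)
  moreover have "S $ 1 $ 1 = 0" "S $ 2 $ 1 = 0" "S $ 2 $ 2 = 1" using G1 G2 by (simp_all add: S_def)
  moreover have "G $ 2 $ 2 ^ 3 * det S = det G"
    using G2 unfolding det_3 S_def by (simp add: field_simps power3_eq_cube)
  then have "det S \<noteq> 0" using G0 by auto
  ultimately obtain A where A: "det A \<noteq> 0" "transpose (cnjm A) ** J_mat ** A = S"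
    using hermitian_normal_form by blast
  have "\<exists>c. c \<noteq> 0 \<and> S *v point_vec m = c *s cnjv (form_vec m)" if m: "m \<in> W'" for m
  proof -
    obtain c where c: "c \<noteq> 0" "G *v point_vec m = c *s cnjv (form_vec m)" using Gz[OF m] by blast
    then show ?thesis unfolding Sz using G2 by (intro exI[of _ "inverse (G $ 2 $ 2) * c"]) auto
  qed
  then show ?thesis using W' A B.open_W by blast
qed

text \<open>The determinant is a polynomial in the parameter, nonzero because of its value at
  \<open>c\<close>, and its finitely many roots cannot exhaust the real numbers.\<close>

lemma exists_real_combination_det_nonzero:
  fixes M N :: "complex^3^3"
  assumes "det (\<chi> i j. M $ i $ j + c * N $ i $ j) \<noteq> 0"
  shows "\<exists>s::real. det (\<chi> i j. M $ i $ j + of_real s * N $ i $ j) \<noteq> 0"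
proof (rule ccontr)
  define q where "q = det (\<chi> i j. [:M $ i $ j, N $ i $ j:] :: complex poly ^3^3)"
  have q: "poly q s = det (\<chi> i j. M $ i $ j + s * N $ i $ j)" for s
    by (simp add: q_def det_3 algebra_simps)
  then have "q \<noteq> 0" using assms by (metis poly_0)
  assume "\<not> ?thesis"
  then have "range complex_of_real \<subseteq> {s. poly q s = 0}" using q by auto
  then have "finite (range complex_of_real)" using poly_roots_finite[OF \<open>q \<noteq> 0\<close>] finite_subset by blast
  then show False by (simp add: finite_image_iff inj_on_def infinite_UNIV_char_0)
qed

text \<open>Averaging over conjugation: for every scalar \<xi> the matrix \<xi> + conj \<xi> H
  solves the equation, and only its invertibility has to be arranged.\<close>

lemma hilbert90:
  fixes H :: "complex^3^3"
  assumes "cnjm H ** H = mat 1"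
  obtains A where "det A \<noteq> 0" "cnjm A ** H = A"
proof -
  \<comment> \<open>With \<xi> = 1 + i s the candidate is M + s N. At s = - i this is twice the
    identity, so its determinant is not the zero polynomial.\<close>
  define M where "M = (\<chi> i j. mat 1 $ i $ j + H $ i $ j)"
  define N where "N = (\<chi> i j. \<i> * mat 1 $ i $ j - \<i> * H $ i $ j)"
  have "(\<chi> i j. M $ i $ j + (- \<i>) * N $ i $ j) = (\<chi> i j. 2 * mat 1 $ i $ j)"
    by (simp add: vec_eq_iff M_def N_def algebra_simps)
  then have "det (\<chi> i j. M $ i $ j + (- \<i>) * N $ i $ j) \<noteq> 0"
    by (simp add: det_3 mat_def)
  then obtain s :: real where s: "det (\<chi> i j. M $ i $ j + of_real s * N $ i $ j) \<noteq> 0"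
    using exists_real_combination_det_nonzero by blast
  define \<xi> where "\<xi> = Complex 1 s"
  have \<xi>: "\<xi> = 1 + \<i> * of_real s" "cnj \<xi> = 1 - \<i> * of_real s" by (simp_all add: \<xi>_def complex_eq_iff)
  define A where "A = (\<chi> i j. \<xi> * mat 1 $ i $ j + cnj \<xi> * H $ i $ j)"
  have "A = (\<chi> i j. M $ i $ j + of_real s * N $ i $ j)"
    by (simp add: vec_eq_iff A_def M_def N_def \<xi> algebra_simps)
  with s have "det A \<noteq> 0" by simp
  moreover have "(cnjm A ** H) $ i $ j = A $ i $ j" for i j
  proof -
    have "(cnjm A ** H) $ i $ j = (\<Sum>k\<in>UNIV. cnj \<xi> * (cnj (mat 1 $ i $ k) * H $ k $ j) + \<xi> * (cnj (H $ i $ k) * H $ k $ j))"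
      by (simp add: matrix_matrix_mult_def A_def algebra_simps)
    also have "\<dots> = cnj \<xi> * (mat 1 ** H) $ i $ j + \<xi> * (cnjm H ** H) $ i $ j"
      by (simp add: sum.distrib sum_distrib_left matrix_matrix_mult_def mat_def if_distrib[of cnj] cong: if_cong)
    also have "\<dots> = A $ i $ j" unfolding assms by (simp add: A_def)
    finally show ?thesis .
  qed
  then have "cnjm A ** H = A" unfolding vec_eq_iff by blast
  ultimately show thesis by (rule that)
qed

text \<open>Real vectors along both line fields mean that conjugation preserves the directions of P
  and X, so the conjugate point is the projective image of the point itself under a constant
  \<open>H\<close>. This is a real structure up to scale, and \<open>A\<close> turns it into
  ordinary conjugation.\<close>

lemma (in complex_frame) path_normal_form:
  assumes path: "\<And>m. m \<in> W \<Longrightarrow> \<exists>P \<sigma> Q \<tau>. \<sigma> \<noteq> 0 \<and> \<tau> \<noteq> 0 \<and> dF m P = \<sigma> *s vector [0, 0, 1] \<and>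
     dF m Q = \<tau> *s vector [1, p m, 0]"
    and m0: "m0 \<in> W" "F m0 = 0"
  shows "\<exists>W' A. W' \<subseteq> W \<and> m0 \<in> W' \<and> open W' \<and> det A \<noteq> 0 \<and>
    (\<forall>m\<in>W'. (\<exists>c. cnjv (A *v point_vec m) = c *s (A *v point_vec m)) \<and>
       (\<exists>c. cnjv (form_vec m v* matrix_inv A) = c *s (form_vec m v* matrix_inv A)))"
proof -
  obtain ax bx cx where X: "smooth_on W ax" "smooth_on W bx" "smooth_on W cx" "D (\<lambda>m. cnj (x m)) ax bx cx"
    by (rule D_exists[OF smooth_cnj(1)])
  obtain ay b2 cy where Y: "smooth_on W ay" "smooth_on W b2" "smooth_on W cy" "D (\<lambda>m. cnj (y m)) ay b2 cy"
    by (rule D_exists[OF smooth_cnj(2)])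
  obtain ap bp cp where P: "smooth_on W ap" "smooth_on W bp" "smooth_on W cp" "D (\<lambda>m. cnj (p m)) ap bp cp"
    by (rule D_exists[OF smooth_cnj(3)])
  note B = D_cnj[OF X(4) Y(4) P(4)]
  \<comment> \<open>As \<open>v\<close> and \<open>w\<close> are real, conjugate differentials can
    be evaluated on them directly: P kills conj x and conj y, X kills conj p, and X conj y = conj p
    X conj x.\<close>
  have key: "cx m = 0 \<and> cy m = 0 \<and> ap m + p m * bp m = 0 \<and> ay m + p m * b2 m = cnj (p m) * (ax m + p m * bx m)" if m: "m \<in> W" for m
  proof -
    obtain v \<sigma> w \<tau> where 0: "\<sigma> \<noteq> 0" "\<tau> \<noteq> 0" and 1: "dF m v = \<sigma> *s vector [0, 0, 1]" and 2: "dF m w = \<tau> *s vector [1, p m, 0]"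
      using path[OF m] by blast
    have "cx m = 0" "cy m = 0" using B(1)[OF m, of v] B(2)[OF m, of v] 0 unfolding 1 by auto
    moreover have e: "cnj \<tau> = \<tau> * (ax m + p m * bx m)" "cnj \<tau> * cnj (p m) = \<tau> * (ay m + p m * b2 m)" "\<tau> * (ap m + p m * bp m) = 0"
      using B(1)[OF m, of w] B(2)[OF m, of w] B(3)[OF m, of w] unfolding 2 by (simp_all add: algebra_simps)
    have "\<tau> * (ay m + p m * b2 m) = \<tau> * (cnj (p m) * (ax m + p m * bx m))"
      unfolding e(2)[symmetric] by (subst e(1)) (simp only: mult_ac)
    ultimately show ?thesis using 0 e by simp
  qed
  let ?u = "\<lambda>m. cnj (x m)" and ?v = "\<lambda>m. cnj (y m)" and ?r = "\<lambda>m. cnj (p m)"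
  have du: "D ?u ax bx (\<lambda>m. 0)" by (rule D_cong[OF X(4)]) (auto simp: key)
  have dv: "D ?v ay b2 (\<lambda>m. 0)" by (rule D_cong[OF Y(4)]) (auto simp: key)
  have "\<exists>W' (H :: complex^3^3). W' \<subseteq> W \<and> m0 \<in> W' \<and> complex_frame W' F \<and> det H \<noteq> 0 \<and>
     (\<forall>m\<in>W'. \<exists>c. c \<noteq> 0 \<and> H *v vector [1, x m, y m] = c *s vector [1, ?u m, ?v m])"
  proof (rule locally_projective[OF smooth_cnj(1,2) X(1,2) Y(1,2) du dv P(4)])
    show "ap m + p m * bp m = 0" "ay m + p m * b2 m = cnj (p m) * (ax m + p m * bx m)" if "m \<in> W" for m
      using key[OF that] by auto
    show "ax m * b2 m - bx m * ay m \<noteq> 0" if m: "m \<in> W" for m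
    proof -
      have "det (vector [vector [ax m, bx m, cx m], vector [ay m, b2 m, cy m], vector [ap m, bp m, cp m]] :: complex^3^3)
         = cp m * (ax m * b2 m - bx m * ay m)"
        using key[OF m] unfolding det_3 by (simp add: algebra_simps)
      then show ?thesis using B(4)[OF m] by (metis mult_zero_right)
    qed
  qed (use m0 in auto)
  then obtain W' and H :: "complex^3^3" where W': "W' \<subseteq> W" "m0 \<in> W'" "complex_frame W' F" and H: "det H \<noteq> 0"
    and Hz': "\<And>m. m \<in> W' \<Longrightarrow> \<exists>c. c \<noteq> 0 \<and> H *v point_vec m = c *s vector [1, ?u m, ?v m]"
    unfolding point_vec_def by blast
  have Hz: "\<exists>c. c \<noteq> 0 \<and> H *v point_vec m = c *s cnjv (point_vec m)" if "m \<in> W'" for m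
  proof -
    have "vector [1, ?u m, ?v m] = cnjv (point_vec m)" by (simp add: vec_eq_iff forall_3)
    then show ?thesis using Hz'[OF \<open>m \<in> W'\<close>] by simp
  qed
  interpret B: complex_frame W' F by fact
  have DB: "B.D f a b c" if "D f a b c" for f a b c
    using that W'(1) unfolding D_def B.D_def by blast
  \<comment> \<open>Applying the correspondence twice returns to the same point. The factor is a
    squared modulus, so its square root is real and \<open>H\<close> can be normalised.\<close>
  have KK: "\<exists>c. c \<noteq> 0 \<and> (cnjm H ** H) *v point_vec m = (c * cnj c) *s point_vec m" if m: "m \<in> W'" for m
  proof -
    obtain c where c: "c \<noteq> 0" "H *v point_vec m = c *s cnjv (point_vec m)" using Hz[OF m] by blast
    have "(cnjm H ** H) *v point_vec m = cnjm H *v (c *s cnjv (point_vec m))" by (simp add: c flip: matrix_vector_mul_assoc)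
    also have "\<dots> = c *s cnjv (H *v point_vec m)" by (simp add: cnjv_mult vector_scalar_commute)
    also have "\<dots> = (c * cnj c) *s point_vec m" unfolding c by (simp add: cnjv_scale)
    finally show ?thesis using c by blast
  qed
  then obtain k where k: "cnjm H ** H = mat k"
    using B.eigenvector_scalar by metis
  obtain c1 where c1: "c1 \<noteq> 0" "(cnjm H ** H) *v point_vec m0 = (c1 * cnj c1) *s point_vec m0" using KK[OF W'(2)] by blast
  have "(mat k *v point_vec m0) $ 1 = k" by (simp add: matrix_vector_mult_def mat_def if_distrib[of "\<lambda>t. t * _"] cong: if_cong)
  then have "k = c1 * cnj c1" using c1(2) by (simp add: k)
  then have k': "k = (of_real (cmod c1))\<^sup>2" by (simp flip: complex_norm_square)
  define r where "r = cmod c1"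
  have r: "r > 0" using c1 by (simp add: r_def)
  \<comment> \<open>Division by the real square root of \<open>k\<close> gives the cocycle condition
    of \<open>hilbert90\<close>.\<close>
  define H' where "H' = (\<chi> i j. H $ i $ j / of_real r)"
  have H'v: "H' *v v = inverse (of_real r) *s (H *v v)" "v v* H' = inverse (of_real r) *s (v v* H)" for v
    by (simp_all add: H'_def vec_eq_iff matrix_vector_mult_def vector_matrix_mult_def sum_distrib_left field_simps)
  have "cnjm H' ** H' = mat 1"
  proof -
    have "(cnjm H' ** H') $ i $ j = (cnjm H ** H) $ i $ j / (of_real r)\<^sup>2" for i j
      by (simp add: H'_def matrix_matrix_mult_def sum_divide_distrib power2_eq_square)
    then show ?thesis using r unfolding k k' r_def[symmetric] by (simp add: vec_eq_iff mat_def)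
  qed
  then obtain A where A: "det A \<noteq> 0" "cnjm A ** H' = A" using hilbert90 by blast
  have Ai: "A ** matrix_inv A = mat 1" "matrix_inv A ** A = mat 1"
    using matrix_inv_det[OF A(1)] by auto
  have 1: "\<exists>c. cnjv (A *v point_vec m) = c *s (A *v point_vec m)" if m: "m \<in> W'" for m
  proof -
    obtain c where c: "c \<noteq> 0" "H *v point_vec m = c *s cnjv (point_vec m)" using Hz[OF m] by blast
    have "A *v point_vec m = cnjm A *v (H' *v point_vec m)" by (simp add: matrix_vector_mul_assoc A)
    also have "\<dots> = (inverse (of_real r) * c) *s cnjv (A *v point_vec m)"
      by (simp add: H'v c vector_scalar_commute cnjv_mult)
    finally have f: "A *v point_vec m = (inverse (of_real r) * c) *s cnjv (A *v point_vec m)" .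
    moreover have "inverse (of_real r) * c \<noteq> 0" using r c by simp
    ultimately have "inverse (inverse (of_real r) * c) *s (A *v point_vec m) = cnjv (A *v point_vec m)"
      by (metis left_inverse vector_smult_assoc vector_smult_lid)
    then show ?thesis by metis
  qed
  \<comment> \<open>The conjugate form kills H z, a multiple of the conjugate point, and X kills the
    conjugate form since X conj y = conj p X conj x.\<close>
  have ann: "cnjv (form_vec m) v* H = (cnjv (form_vec m) v* H) $ 3 *s form_vec m" if m: "m \<in> W'" for m
  proof (rule B.annihilator_multiple[OF _ _ _ m, where w = "\<lambda>m. cnjv (form_vec m)" and H = H
        and a = "\<lambda>j m. vector [ax m * cnj (p m) + cnj (x m) * ap m - ay m, - ap m, 0] $ j"
        and b = "\<lambda>j m. vector [bx m * cnj (p m) + cnj (x m) * bp m - b2 m, - bp m, 0] $ j"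
        and c = "\<lambda>j m. vector [cx m * cnj (p m) + cnj (x m) * cp m - cy m, - cp m, 0] $ j"])
    have "D (\<lambda>m. cnj (x m) * cnj (p m) - cnj (y m)) (\<lambda>m. ax m * cnj (p m) + cnj (x m) * ap m - ay m)
        (\<lambda>m. bx m * cnj (p m) + cnj (x m) * bp m - b2 m) (\<lambda>m. cx m * cnj (p m) + cnj (x m) * cp m - cy m)"
      by (rule D_diff[OF D_mult[OF X(4) P(4)] Y(4)])
    moreover have "D (\<lambda>m. - cnj (p m)) (\<lambda>m. - ap m) (\<lambda>m. - bp m) (\<lambda>m. - cp m)"
      by (rule D_cong[OF D_cmult[OF P(4), of "-1"]]) auto
    ultimately show "B.D (\<lambda>m. cnjv (form_vec m) $ j) (\<lambda>m. vector [ax m * cnj (p m) + cnj (x m) * ap m - ay m, - ap m, 0] $ j)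
         (\<lambda>m. vector [bx m * cnj (p m) + cnj (x m) * bp m - b2 m, - bp m, 0] $ j)
         (\<lambda>m. vector [cx m * cnj (p m) + cnj (x m) * cp m - cy m, - cp m, 0] $ j)" for j :: 3
      using exhaust_3[of j] B.D_const[of 1] by (auto dest: DB)
    show "vector [ax n * cnj (p n) + cnj (x n) * ap n - ay n, - ap n, 0] $ j + p n * vector [bx n * cnj (p n) + cnj (x n) * bp n - b2 n, - bp n, 0] $ j = 0"
      if n: "n \<in> W'" for j :: 3 and n
    proof -
      have e: "ap n = - (p n * bp n)" "ay n = cnj (p n) * (ax n + p n * bx n) - p n * b2 n"
        using key[of n] n W'(1) by (auto simp: eq_neg_iff_add_eq_0 eq_diff_eq)
      show ?thesis using exhaust_3[of j] unfolding e by (auto simp: algebra_simps)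
    qed
    show "(\<Sum>j\<in>UNIV. cnjv (form_vec n) $ j * (H *v point_vec n) $ j) = 0" if n: "n \<in> W'" for n
    proof -
      obtain c where c: "H *v point_vec n = c *s cnjv (point_vec n)" using Hz[OF n] by blast
      show ?thesis unfolding c by (simp add: sum_3 algebra_simps)
    qed
  qed
  have 2: "\<exists>c. cnjv (form_vec m v* matrix_inv A) = c *s (form_vec m v* matrix_inv A)" if m: "m \<in> W'" for m
  proof -
    have "cnjm A ** cnjm (matrix_inv A) = mat 1"
    proof -
      have "cnjm (mat 1) = (mat 1 :: complex^3^3)" by (simp add: vec_eq_iff mat_def)
      then show ?thesis by (metis Ai(1) cnjm_mult)
    qed
    have "cnjm (matrix_inv A) ** cnjm A = mat 1"
    proof -
      have "cnjm (mat 1) = (mat 1 :: complex^3^3)" by (simp add: vec_eq_iff mat_def)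
      then show ?thesis by (metis Ai(2) cnjm_mult)
    qed
    then have "cnjm (matrix_inv A) = cnjm (matrix_inv A) ** (cnjm A ** H') ** matrix_inv A"
      by (simp add: A Ai flip: matrix_mul_assoc)
    also have "\<dots> = H' ** matrix_inv A"
      using \<open>cnjm (matrix_inv A) ** cnjm A = mat 1\<close> by (simp add: matrix_mul_assoc)
    \<comment> \<open>The equation for \<open>A\<close> passes to its inverse; together with
      \<open>ann\<close> it makes the moved form a multiple of its conjugate.\<close>
    finally have e: "cnjm (matrix_inv A) = H' ** matrix_inv A" .
    have "cnjv (form_vec m v* matrix_inv A) = (cnjv (form_vec m) v* H') v* matrix_inv A"
      unfolding cnjv_vmult e by (simp add: vector_matrix_mul_assoc)
    also obtain n where "cnjv (form_vec m) v* H' = n *s form_vec m"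
      unfolding H'v using ann[OF m] by (metis vector_smult_assoc)
    also have "(n *s form_vec m) v* matrix_inv A = n *s (form_vec m v* matrix_inv A)"
      by (simp add: vec_eq_iff vector_matrix_mult_def sum_distrib_left mult_ac)
    finally show ?thesis by blast
  qed
  show ?thesis using W'(1,2) B.open_W A(1) 1 2 by blast
qed

section \<open>Charts and tangent vectors\<close>

text \<open>The part of \<open>smooth_manifold\<close> to which tangent vectors and differentials
  refer. For the flag space and the models it is checked on transition maps.\<close>

definition smooth_atlas :: "('a, 'e::euclidean_space) chart set \<Rightarrow> bool" where
  "smooth_atlas M \<longleftrightarrow>
     (\<forall>c\<in>M. inj_on (snd c) (fst c) \<and> open (snd c ` fst c)) \<and>
     (\<forall>c\<in>M. \<forall>d\<in>M. open (snd c ` (fst c \<inter> fst d)) \<and>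
        smooth_on (snd c ` (fst c \<inter> fst d)) (snd d \<circ> chart_inv c))"

lemma smooth_manifold_atlas: "smooth_manifold M \<Longrightarrow> smooth_atlas M"
  by (simp add: smooth_manifold_def smooth_atlas_def)

abbreviation tderiv where
  "tderiv c h q \<equiv> frechet_derivative (h \<circ> chart_inv c) (at (snd c q))"

lemma openin_mtop_chart: "c \<in> M \<Longrightarrow> open S \<Longrightarrow> openin (mtop M) (fst c \<inter> snd c -` S)"
  unfolding mtop_def by (intro topology_generated_by_Basis) blast

lemma openin_mtop_domain: "c \<in> M \<Longrightarrow> openin (mtop M) (fst c)"
  using openin_mtop_chart[of c M UNIV] by simp

locale atlas =
  fixes M :: "('a, 'e::euclidean_space) chart set"
  assumes atlas: "smooth_atlas M"
begin

lemma chart_inj: "c \<in> M \<Longrightarrow> inj_on (snd c) (fst c)"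
  using atlas by (simp add: smooth_atlas_def)

lemma chart_inv_chart [simp]: "c \<in> M \<Longrightarrow> q \<in> fst c \<Longrightarrow> chart_inv c (snd c q) = q"
  unfolding chart_inv_def using chart_inj by (simp add: inv_into_f_f)

lemma open_transition_domain: "c \<in> M \<Longrightarrow> d \<in> M \<Longrightarrow> open (snd c ` (fst c \<inter> fst d))"
  and smooth_transition: "c \<in> M \<Longrightarrow> d \<in> M \<Longrightarrow> smooth_on (snd c ` (fst c \<inter> fst d)) (snd d \<circ> chart_inv c)"
  using atlas by (auto simp: smooth_atlas_def)

text \<open>Induction over the generation of the topology: for a generating set the image is the
  preimage of an open set under a transition map, and injectivity of the chart handles
  intersections.\<close>

lemma open_chart_image:
  assumes "openin (mtop M) S" and c: "c \<in> M"
  shows "open (snd c ` (fst c \<inter> S))"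
proof -
  have "generate_topology_on {fst c \<inter> snd c -` S | c S. c \<in> M \<and> open S} S"
    using assms(1) unfolding mtop_def openin_topology_generated_by_iff .
  then show ?thesis
  proof (induction rule: generate_topology_on.induct)
    case (Int a b)
    have "snd c ` (fst c \<inter> (a \<inter> b)) = snd c ` (fst c \<inter> a) \<inter> snd c ` (fst c \<inter> b)"
      using chart_inj[OF c] by (auto simp: inj_on_def)
    then show ?case using Int by auto
  next
    case (UN K)
    have "snd c ` (fst c \<inter> \<Union>K) = (\<Union>k\<in>K. snd c ` (fst c \<inter> k))" by blast
    then show ?case using UN by auto
  next
    case (Basis s)
    then obtain d S where d: "d \<in> M" "open S" and s: "s = fst d \<inter> snd d -` S" by blast
    have "snd c ` (fst c \<inter> s) = snd c ` (fst c \<inter> fst d) \<inter> (snd d \<circ> chart_inv c) -` S"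
      using c by (auto simp: s)
    moreover have "open \<dots>"
      by (rule continuous_open_preimage[OF smooth_on_continuous[OF smooth_transition[OF c d(1)]] open_transition_domain[OF c d(1)] d(2)])
    ultimately show ?case by simp
  qed simp
qed

lemma openin_mtopI:
  assumes "V \<subseteq> topspace (mtop M)" "\<And>c. c \<in> M \<Longrightarrow> open (snd c ` (fst c \<inter> V))"
  shows "openin (mtop M) V"
proof -
  have "V = (\<Union>c\<in>M. fst c \<inter> snd c -` (snd c ` (fst c \<inter> V)))"
  proof (intro equalityI subsetI)
    fix q assume q: "q \<in> V"
    then obtain c where "c \<in> M" "q \<in> fst c" using assms(1) unfolding topspace_mtop by blast
    then show "q \<in> (\<Union>c\<in>M. fst c \<inter> snd c -` (snd c ` (fst c \<inter> V)))"
      using q by blast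
  next
    fix q assume "q \<in> (\<Union>c\<in>M. fst c \<inter> snd c -` (snd c ` (fst c \<inter> V)))"
    then show "q \<in> V" using chart_inj by (fastforce simp: inj_on_def)
  qed
  moreover have "openin (mtop M) \<dots>"
    using assms(2) openin_mtop_chart by (intro openin_clauses(3)) blast
  ultimately show ?thesis by simp
qed

text \<open>Near \<open>q\<close> the map read in \<open>c\<close> is the map read in
  \<open>d\<close> after the transition map; the identity holds only on the overlap, whose image is
  open.\<close>

lemma chart_change:
  assumes c: "c \<in> charts_at M q" and d: "d \<in> charts_at M q" and h: "(h \<circ> chart_inv d) differentiable (at (snd d q))"
  shows "(h \<circ> chart_inv c) differentiable (at (snd c q))"
    "tderiv c h q v = tderiv d h q (tderiv c (snd d) q v)"
proof -
  have cd: "c \<in> M" "d \<in> M" "q \<in> fst c" "q \<in> fst d" using c d by (auto simp: charts_at_def)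
  have q: "snd c q \<in> snd c ` (fst c \<inter> fst d)" using cd by blast
  have "((snd d \<circ> chart_inv c) has_derivative tderiv c (snd d) q) (at (snd c q))"
    by (rule smooth_on_has_derivative[OF smooth_transition q]) (use cd in auto)
  moreover have "((h \<circ> chart_inv d) has_derivative tderiv d h q) (at ((snd d \<circ> chart_inv c) (snd c q)))"
    using h cd by (simp add: frechet_derivative_works)
  ultimately have "((\<lambda>a. (h \<circ> chart_inv d) ((snd d \<circ> chart_inv c) a)) has_derivative (\<lambda>v. tderiv d h q (tderiv c (snd d) q v))) (at (snd c q))"
    by (rule has_derivative_compose)
  then have D: "((h \<circ> chart_inv c) has_derivative (\<lambda>v. tderiv d h q (tderiv c (snd d) q v))) (at (snd c q))"
    by (rule has_derivative_transform_within_open[OF _ open_transition_domain[OF cd(1,2)] q]) (use cd in auto)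
  then show "(h \<circ> chart_inv c) differentiable (at (snd c q))" by (rule differentiableI)
  show "tderiv c h q v = tderiv d h q (tderiv c (snd d) q v)"
    using fun_cong[OF frechet_derivative_at[OF D], of v] by simp
qed

lemma transition_differentiable:
  assumes "c \<in> charts_at M q" "d \<in> charts_at M q"
  shows "(snd d \<circ> chart_inv c) differentiable (at (snd c q))"
  by (rule smooth_on_differentiable[OF smooth_transition]) (use assms in \<open>auto simp: charts_at_def\<close>)

lemma transition_refl:
  assumes "c \<in> charts_at M q"
  shows "tderiv c (snd c) q v = v"
proof -
  have c: "c \<in> M" "q \<in> fst c" using assms by (auto simp: charts_at_def)
  have "((snd c \<circ> chart_inv c) has_derivative (\<lambda>v. v)) (at (snd c q))"
    by (rule has_derivative_transform_within_open[OF has_derivative_ident open_transition_domain[OF c(1,1)]])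
      (use c in auto)
  from fun_cong[OF frechet_derivative_at[OF this], of v] show ?thesis by simp
qed

lemma tangent_spaceD:
  "v \<in> tangent_space M q \<Longrightarrow> c \<in> charts_at M q \<Longrightarrow> d \<in> charts_at M q \<Longrightarrow> v d = tderiv c (snd d) q (v c)"
  unfolding tangent_space_def by blast

lemma tangent_space_outside: "v \<in> tangent_space M q \<Longrightarrow> c \<notin> charts_at M q \<Longrightarrow> v c = 0"
  unfolding tangent_space_def by blast

lemma tangent_space_eqI:
  assumes "v \<in> tangent_space M q" "w \<in> tangent_space M q" "c \<in> charts_at M q" "v c = w c"
  shows "v = w"
proof
  fix d show "v d = w d"
  proof (cases "d \<in> charts_at M q")
    case True
    show ?thesis unfolding tangent_spaceD[OF assms(1,3) True] tangent_spaceD[OF assms(2,3) True] assms(4) ..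
  next
    case False
    then show ?thesis using tangent_space_outside assms(1,2) by metis
  qed
qed

text \<open>Derivatives of transition maps satisfy the cocycle rule, so coordinates prescribed in
  one chart extend consistently to the others.\<close>

lemma tangent_space_obtain:
  assumes c: "c \<in> charts_at M q"
  obtains v where "v \<in> tangent_space M q" "v c = w"
proof -
  let ?v = "\<lambda>d. if d \<in> charts_at M q then tderiv c (snd d) q w else 0"
  have "tderiv c (snd e) q w = tderiv d (snd e) q (tderiv c (snd d) q w)" if "d \<in> charts_at M q" "e \<in> charts_at M q" for d e
    by (rule chart_change(2)[OF c that(1) transition_differentiable[OF that]])
  note trans = this
  have "?v \<in> tangent_space M q"
    unfolding tangent_space_def
  proof (intro CollectI conjI ballI allI impI)
    fix d e assume "d \<in> charts_at M q" "e \<in> charts_at M q"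
    then show "?v e = tderiv d (snd e) q (?v d)" using trans[of d e] by simp
  qed simp
  moreover have "?v c = w" using c transition_refl by simp
  ultimately show thesis by (rule that)
qed

lemma tangent_space_combination:
  assumes "v \<in> tangent_space M q" "w \<in> tangent_space M q"
  shows "(\<lambda>c. r *\<^sub>R v c + s *\<^sub>R w c) \<in> tangent_space M q"
proof -
  have lin: "linear (tderiv c (snd d) q)" if "c \<in> charts_at M q" "d \<in> charts_at M q" for c d
    using transition_differentiable[OF that] has_derivative_linear unfolding frechet_derivative_works by blast
  have "r *\<^sub>R v d + s *\<^sub>R w d = tderiv c (snd d) q (r *\<^sub>R v c + s *\<^sub>R w c)" if cd: "c \<in> charts_at M q" "d \<in> charts_at M q" for c d
    unfolding linear_add[OF lin[OF cd]] linear_scale[OF lin[OF cd]] tangent_spaceD[OF assms(1) cd] tangent_spaceD[OF assms(2) cd] ..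
  moreover have "r *\<^sub>R v c + s *\<^sub>R w c = 0" if "c \<notin> charts_at M q" for c
    using tangent_space_outside[OF assms(1) that] tangent_space_outside[OF assms(2) that] by simp
  ultimately show ?thesis unfolding tangent_space_def by (intro CollectI conjI ballI allI impI)
qed

lemma tangent_space_zero: "(\<lambda>c. 0) \<in> tangent_space M q"
proof -
  have lin: "linear (tderiv c (snd d) q)" if "c \<in> charts_at M q" "d \<in> charts_at M q" for c d
    using transition_differentiable[OF that] has_derivative_linear unfolding frechet_derivative_works by blast
  show ?thesis unfolding tangent_space_def by (simp add: linear_0[OF lin])
qed

text \<open>\<open>pushforward\<close> uses the arbitrarily chosen chart \<open>c0\<close>. The
  chain rule and the transformation rule of tangent vectors compensate each other when
  \<open>c0\<close> is replaced by \<open>c\<close>.\<close>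

lemma pushforward_chart:
  assumes c: "c \<in> charts_at M q" and v: "v \<in> tangent_space M q" and d: "d \<in> charts_at N (f q)"
    and diff: "(snd d \<circ> f \<circ> chart_inv c) differentiable (at (snd c q))"
  shows "pushforward M N f q v d = tderiv c (snd d \<circ> f) q (v c)"
proof -
  define c0 where "c0 = (SOME c. c \<in> charts_at M q)"
  have c0: "c0 \<in> charts_at M q" unfolding c0_def using c by (rule someI)
  have "tderiv c (snd d \<circ> f) q (v c) = tderiv c0 (snd d \<circ> f) q (tderiv c (snd c0) q (v c))"
    by (rule chart_change(2)[OF c c0 chart_change(1)[OF c0 c diff]])
  also have "tderiv c (snd c0) q (v c) = v c0" using tangent_spaceD[OF v c c0] by simp
  finally have e: "tderiv c (snd d \<circ> f) q (v c) = tderiv c0 (snd d \<circ> f) q (v c0)" .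
  show ?thesis unfolding pushforward_def Let_def c0_def[symmetric] if_P[OF d] e ..
qed

end

lemma pushforward_outside: "d \<notin> charts_at N (f q) \<Longrightarrow> pushforward M N f q v d = 0"
  by (simp add: pushforward_def Let_def)

locale atlas_map = M: atlas M + N: atlas N
  for M :: "('a, 'e::euclidean_space) chart set" and N :: "('b, 'd::euclidean_space) chart set" +
  fixes U :: "'a set" and f :: "'a \<Rightarrow> 'b"
  assumes U: "openin (mtop M) U" and smooth: "smooth_map M U N f"
begin

lemma f_topspace: "q \<in> U \<Longrightarrow> f q \<in> topspace (mtop N)"
  using smooth openin_subset[OF U] unfolding smooth_map_def continuous_map_def by (auto simp: topspace_subtopology)

lemma openin_preimage: "openin (mtop N) S \<Longrightarrow> openin (mtop M) (U \<inter> f -` S)"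
proof -
  assume "openin (mtop N) S"
  then have "openin (subtopology (mtop M) U) {q \<in> topspace (subtopology (mtop M) U). f q \<in> S}"
    using smooth unfolding smooth_map_def continuous_map_def by blast
  moreover have "{q \<in> topspace (subtopology (mtop M) U). f q \<in> S} = U \<inter> f -` S"
    using openin_subset[OF U] by auto
  ultimately show ?thesis using openin_open_subtopology[OF U] by simp
qed

lemma open_domain:
  assumes "c \<in> M" "d \<in> N"
  shows "open (snd c ` (U \<inter> fst c \<inter> f -` fst d))"
proof -
  have "U \<inter> fst c \<inter> f -` fst d = fst c \<inter> (U \<inter> f -` fst d)" by blast
  then show ?thesis using M.open_chart_image[OF openin_preimage[OF openin_mtop_domain[OF assms(2)]] assms(1)] by simp
qed

lemma smooth_local:
  "c \<in> M \<Longrightarrow> d \<in> N \<Longrightarrow> smooth_on (snd c ` (U \<inter> fst c \<inter> f -` fst d)) (snd d \<circ> f \<circ> chart_inv c)"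
  using smooth by (simp add: smooth_map_def)

lemma differentiable:
  assumes "q \<in> U" "c \<in> charts_at M q" "d \<in> charts_at N (f q)"
  shows "(snd d \<circ> f \<circ> chart_inv c) differentiable (at (snd c q))"
  by (rule smooth_on_differentiable[OF smooth_local[of c d]]) (use assms in \<open>auto simp: charts_at_def\<close>)

lemma linear_tderiv:
  assumes "q \<in> U" "c \<in> charts_at M q" "d \<in> charts_at N (f q)"
  shows "linear (tderiv c (snd d \<circ> f) q)"
  using differentiable[OF assms] has_derivative_linear unfolding frechet_derivative_works by blast

lemma pushforward_eq:
  assumes "q \<in> U" "c \<in> charts_at M q" "d \<in> charts_at N (f q)" "v \<in> tangent_space M q"
  shows "pushforward M N f q v d = tderiv c (snd d \<circ> f) q (v c)"
  by (rule M.pushforward_chart[where f = f]) (use assms differentiable in auto)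

lemma chart_change_target:
  assumes q: "q \<in> U" and c: "c \<in> charts_at M q" and d: "d \<in> charts_at N (f q)" and h: "(h \<circ> chart_inv d) differentiable (at (snd d (f q)))"
  shows "(h \<circ> f \<circ> chart_inv c) differentiable (at (snd c q))"
    "tderiv c (h \<circ> f) q v = tderiv d h (f q) (tderiv c (snd d \<circ> f) q v)"
proof -
  have cd: "c \<in> M" "d \<in> N" "q \<in> fst c" "f q \<in> fst d" using c d by (auto simp: charts_at_def)
  have x: "snd c q \<in> snd c ` (U \<inter> fst c \<inter> f -` fst d)" using cd q by blast
  have "((snd d \<circ> f \<circ> chart_inv c) has_derivative tderiv c (snd d \<circ> f) q) (at (snd c q))"
    using differentiable[OF q c d] by (simp add: frechet_derivative_works)
  moreover have "((h \<circ> chart_inv d) has_derivative tderiv d h (f q)) (at ((snd d \<circ> f \<circ> chart_inv c) (snd c q)))"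
    using h cd by (simp add: frechet_derivative_works)
  ultimately have "((\<lambda>a. (h \<circ> chart_inv d) ((snd d \<circ> f \<circ> chart_inv c) a)) has_derivative (\<lambda>v. tderiv d h (f q) (tderiv c (snd d \<circ> f) q v))) (at (snd c q))"
    by (rule has_derivative_compose)
  then have D: "((h \<circ> f \<circ> chart_inv c) has_derivative (\<lambda>v. tderiv d h (f q) (tderiv c (snd d \<circ> f) q v))) (at (snd c q))"
    by (rule has_derivative_transform_within_open[OF _ open_domain[OF cd(1,2)] x]) (use cd in auto)
  then show "(h \<circ> f \<circ> chart_inv c) differentiable (at (snd c q))" by (rule differentiableI)
  show "tderiv c (h \<circ> f) q v = tderiv d h (f q) (tderiv c (snd d \<circ> f) q v)"
    using fun_cong[OF frechet_derivative_at[OF D], of v] by simp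
qed

lemma pushforward_tangent:
  assumes q: "q \<in> U" and v: "v \<in> tangent_space M q"
  shows "pushforward M N f q v \<in> tangent_space N (f q)"
proof -
  obtain c where c: "c \<in> charts_at M q"
    using q openin_subset[OF U] by (auto simp: topspace_mtop charts_at_def)
  show ?thesis
    unfolding tangent_space_def
    by (auto simp: pushforward_outside pushforward_eq[OF q c _ v]
      intro!: chart_change_target(2)[OF q c _ N.transition_differentiable])
qed

end

section \<open>The flag space\<close>

lemma vector_matrix_scale: "(c *s z) v* A = c *s (z v* (A :: 'k::field^'n^'m))"
  by (simp add: vec_eq_iff vector_matrix_mult_def sum_distrib_left mult_ac)

lemma matrix_inv_eqI:
  fixes A :: "'k::field^'n^'n"
  assumes "A ** B = mat 1"
  shows "matrix_inv A = B"
proof -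
  have "det A * det B = 1" using assms by (metis det_I det_mul)
  then have "det A \<noteq> 0" by auto
  note i = matrix_inv_det[OF this]
  have "matrix_inv A = matrix_inv A ** (A ** B)" by (simp add: assms)
  then show ?thesis by (simp add: matrix_mul_assoc i)
qed

lemma matrix_inv_mult:
  fixes A B :: "'k::field^'n^'n"
  assumes "det A \<noteq> 0" "det B \<noteq> 0"
  shows "matrix_inv (A ** B) = matrix_inv B ** matrix_inv A"
proof (rule matrix_inv_eqI)
  have "(A ** B) ** (matrix_inv B ** matrix_inv A) = A ** (B ** matrix_inv B) ** matrix_inv A"
    by (simp add: matrix_mul_assoc)
  then show "(A ** B) ** (matrix_inv B ** matrix_inv A) = mat 1"
    by (simp add: matrix_inv_det assms)
qed

lemma det_matrix_inv:
  fixes A :: "'k::field^'n^'n"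
  assumes "det A \<noteq> 0"
  shows "det (matrix_inv A) = inverse (det A)"
proof -
  have "det A * det (matrix_inv A) = 1"
    by (metis assms det_I det_mul matrix_inv_det(1))
  then show ?thesis using assms by (simp add: field_simps)
qed

lemma matrix_vector_eq_0:
  fixes A :: "'k::field^'n^'n"
  assumes "det A \<noteq> 0"
  shows "A *v z = 0 \<longleftrightarrow> z = 0" "z v* A = 0 \<longleftrightarrow> z = 0"
proof -
  note i = matrix_inv_det[OF assms]
  show "A *v z = 0 \<longleftrightarrow> z = 0"
    by (metis i(2) matrix_vector_mul_assoc matrix_vector_mul_lid matrix_vector_mult_0_right)
  have "z = (z v* A) v* matrix_inv A" by (simp add: vector_matrix_mul_assoc i)
  then show "z v* A = 0 \<longleftrightarrow> z = 0"
    by (metis vector_matrix_mult_0)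
qed

lemma dot_vmult:
  fixes A :: "'k::field^3^3"
  shows "(\<Sum>i\<in>UNIV. l $ i * (A *v z) $ i) = (\<Sum>i\<in>UNIV. (l v* A) $ i * z $ i)"
  by (simp add: vector_matrix_mult_def matrix_vector_mult_def sum_3 algebra_simps)

lemma in_line: "z \<in> line z"
  unfolding line_def by (metis rangeI vector_smult_lid)

lemma line_eqD:
  assumes "line z = line w" "z \<noteq> 0"
  obtains c where "c \<noteq> 0" "z = c *s w"
proof -
  obtain c where "z = c *s w" using in_line[of z] assms(1) by (auto simp: line_def)
  moreover from this assms(2) have "c \<noteq> 0" by auto
  ultimately show thesis by (rule that[rotated])
qed

lemma line_scale_matrix: "c \<noteq> 0 \<Longrightarrow> line ((\<chi> i j. c * A $ i $ j) *v z) = line (A *v (z :: 'k::field^3))"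
proof -
  have "(\<chi> i j. c * A $ i $ j) *v z = c *s (A *v z)"
    by (simp add: vec_eq_iff matrix_vector_mult_def sum_distrib_left mult.assoc)
  then show "c \<noteq> 0 \<Longrightarrow> line ((\<chi> i j. c * A $ i $ j) *v z) = line (A *v z)" by (simp add: line_scale)
qed

lemma chart_inv_param: "inj P \<Longrightarrow> chart_inv (range P, inv P) a = P a"
  unfolding chart_inv_def by (simp add: inv_into_f_eq[OF inj_on_inv_into[of _ P UNIV]])

definition flag_point :: "'k::field^3 \<Rightarrow> 'k^3" where "flag_point a = vector [1, a$1, a$2]"
definition flag_form :: "'k::field^3 \<Rightarrow> 'k^3" where "flag_form a = vector [a$1 * a$3 - a$2, - a$3, 1]"

lemma flag_point_nth [simp]: "flag_point a $ 1 = 1" "flag_point a $ 2 = a $ 1" "flag_point a $ 3 = a $ 2"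
  and flag_form_nth [simp]: "flag_form a $ 1 = a$1 * a$3 - a$2" "flag_form a $ 2 = - a$3" "flag_form a $ 3 = 1"
  by (simp_all add: flag_point_def flag_form_def)

lemma flag_point_flag_form: "(\<Sum>i\<in>UNIV. flag_form a $ i * flag_point a $ i) = 0" "flag_point a \<noteq> 0" "flag_form a \<noteq> 0"
  by (auto simp: sum_3 algebra_simps vec_eq_iff forall_3)

lemma flag_param_eq: "flag_param g a = (line (g *v flag_point a), line (flag_form a v* matrix_inv g))"
  by (simp add: flag_param_def flag_act_line flag_point_def flag_form_def)

text \<open>Moved back by \<open>g\<close>, a flag of the chart has a point with nonzero first entry
  and a form with nonzero last entry. Normalising these to 1 gives the parameters, and incidence
  determines the first coefficient of the form.\<close>

lemma flag_coordinates:
  fixes g :: "'k::field^3^3"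
  assumes g: "det g \<noteq> 0" and zl: "z \<noteq> 0" "l \<noteq> 0" "(\<Sum>i\<in>UNIV. l $ i * z $ i) = 0"
  defines "n \<equiv> matrix_inv g *v z" and "m \<equiv> l v* g"
  shows "flag_param g a = (line z, line l) \<longleftrightarrow> n $ 1 \<noteq> 0 \<and> m $ 3 \<noteq> 0 \<and> a = vector [n $ 2 / n $ 1, n $ 3 / n $ 1, - m $ 2 / m $ 3]"
proof
  note i = matrix_inv_det[OF g]
  have gn: "g *v n = z" and mg: "m v* matrix_inv g = l"
    by (simp_all add: n_def m_def matrix_vector_mul_assoc vector_matrix_mul_assoc i)
  have n0: "n \<noteq> 0" "m \<noteq> 0" using zl gn mg by auto
  have mn: "(\<Sum>i\<in>UNIV. m $ i * n $ i) = 0" unfolding m_def dot_vmult[symmetric] gn by (rule zl)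
  {
    assume "flag_param g a = (line z, line l)"
    then have 1: "line z = line (g *v flag_point a)" "line l = line (flag_form a v* matrix_inv g)" by (simp_all add: flag_param_eq)
    obtain c where c: "c \<noteq> 0" "z = c *s (g *v flag_point a)" using line_eqD[OF 1(1) zl(1)] .
    obtain d where d: "d \<noteq> 0" "l = d *s (flag_form a v* matrix_inv g)" using line_eqD[OF 1(2) zl(2)] .
    have n: "n = c *s flag_point a"
      unfolding n_def c(2) by (simp add: vector_scalar_commute matrix_vector_mul_assoc i)
    have "m = d *s ((flag_form a v* matrix_inv g) v* g)"
      unfolding m_def d(2) by (simp add: vec_eq_iff vector_matrix_mult_def sum_distrib_left mult_ac)
    then have m: "m = d *s flag_form a" by (simp add: vector_matrix_mul_assoc i)
    show "n $ 1 \<noteq> 0 \<and> m $ 3 \<noteq> 0 \<and> a = vector [n $ 2 / n $ 1, n $ 3 / n $ 1, - m $ 2 / m $ 3]"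
      using c d by (simp add: n m vec_eq_iff forall_3)
  }
  {
    assume a: "n $ 1 \<noteq> 0 \<and> m $ 3 \<noteq> 0 \<and> a = vector [n $ 2 / n $ 1, n $ 3 / n $ 1, - m $ 2 / m $ 3]"
    have 1: "flag_point a = inverse (n $ 1) *s n" using a by (simp add: vec_eq_iff forall_3 field_simps)
    have k: "m $ 2 * n $ 2 + m $ 3 * n $ 3 = - (m $ 1 * n $ 1)"
      using mn by (simp add: sum_3 eq_neg_iff_add_eq_0 add_ac)
    have "flag_form a $ 1 = - (m $ 2 * n $ 2 + m $ 3 * n $ 3) / (m $ 3 * n $ 1)"
      using a by (simp add: field_simps)
    also have "\<dots> = inverse (m $ 3) * m $ 1" unfolding k using a by (simp add: field_simps)
    finally have 2: "flag_form a = inverse (m $ 3) *s m" using a by (simp add: vec_eq_iff forall_3 field_simps)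
    have "line (g *v flag_point a) = line z"
      unfolding 1 using a by (simp add: vector_scalar_commute gn line_scale)
    moreover have "(inverse (m $ 3) *s m) v* matrix_inv g = inverse (m $ 3) *s (m v* matrix_inv g)"
      by (simp add: vec_eq_iff vector_matrix_mult_def sum_distrib_left mult_ac)
    then have "line (flag_form a v* matrix_inv g) = line l"
      unfolding 2 using a by (simp add: mg line_scale)
    ultimately show "flag_param g a = (line z, line l)" by (simp add: flag_param_eq)
  }
qed

text \<open>Moving the flag back by \<open>h\<close> leaves only \<open>matrix_inv h ** g\<close>
  and its inverse, so the transition is rational with an explicit domain. The uniqueness of
  \<open>b\<close> also yields injectivity of the charts.\<close>

lemma flag_param_transition:
  fixes g h :: "'k::field^3^3"
  assumes "det g \<noteq> 0" "det h \<noteq> 0"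
  defines "n \<equiv> \<lambda>a. (matrix_inv h ** g) *v flag_point a" and "m \<equiv> \<lambda>a. flag_form a v* (matrix_inv g ** h)"
  shows "flag_param h b = flag_param g a \<longleftrightarrow>
     n a $ 1 \<noteq> 0 \<and> m a $ 3 \<noteq> 0 \<and> b = vector [n a $ 2 / n a $ 1, n a $ 3 / n a $ 1, - m a $ 2 / m a $ 3]"
proof -
  note i = matrix_inv_det[OF assms(1)]
  have 0: "g *v flag_point a \<noteq> 0" "flag_form a v* matrix_inv g \<noteq> 0"
    using assms flag_point_flag_form by (simp_all add: matrix_vector_eq_0 det_matrix_inv)
  have 1: "(\<Sum>i\<in>UNIV. (flag_form a v* matrix_inv g) $ i * (g *v flag_point a) $ i) = 0"
    unfolding dot_vmult by (simp add: vector_matrix_mul_assoc i flag_point_flag_form)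
  show ?thesis
    unfolding flag_param_eq[of g a] flag_coordinates[OF assms(2) 0 1]
    by (simp add: n_def m_def matrix_vector_mul_assoc vector_matrix_mul_assoc)
qed

lemma inj_flag_param: "det (g :: 'k::field^3^3) \<noteq> 0 \<Longrightarrow> inj (flag_param g)"
  by (rule injI) (metis flag_param_transition)

definition flag_chart :: "'k::field^3^3 \<Rightarrow> (('k^3) set \<times> ('k^3) set, 'k^3) chart" where
  "flag_chart g = (range (flag_param g), inv (flag_param g))"

lemma flag_atlas_eq: "flag_atlas = flag_chart ` SL3"
  by (auto simp: flag_atlas_def flag_chart_def)

lemma SL3_det: "g \<in> SL3 \<Longrightarrow> det g \<noteq> 0"
  by (simp add: SL3_def)

lemma flag_chart_simps:
  assumes "det (g :: 'k::field^3^3) \<noteq> 0"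
  shows "snd (flag_chart g) (flag_param g a) = a" "chart_inv (flag_chart g) a = flag_param g a"
    "fst (flag_chart g) = range (flag_param g)" "snd (flag_chart g) ` fst (flag_chart g) = UNIV"
  using inj_flag_param[OF assms] by (auto simp: flag_chart_def chart_inv_param image_image)

lemma smooth_on_flag_point: "open S \<Longrightarrow> smooth_on S (\<lambda>a::complex^3. flag_point a $ i)"
  using exhaust_3[of i]
  by (elim disjE) (simp_all add: smooth_on_const smooth_on_minus smooth_on_diff smooth_on_mult smooth_on_nth[OF _ smooth_on_ident])

lemma smooth_on_flag_form: "open S \<Longrightarrow> smooth_on S (\<lambda>a::complex^3. flag_form a $ i)"
  using exhaust_3[of i]
  by (elim disjE) (simp_all add: smooth_on_const smooth_on_minus smooth_on_diff smooth_on_mult smooth_on_nth[OF _ smooth_on_ident])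

lemma smooth_on_open_nonzero:
  fixes f :: "'a::real_normed_vector \<Rightarrow> complex"
  shows "smooth_on UNIV f \<Longrightarrow> open {a. f a \<noteq> 0}"
  using smooth_on_continuous[of UNIV f] by (intro open_Collect_neq) auto

lemma smooth_atlas_flag: "smooth_atlas F_atlas"
  unfolding smooth_atlas_def flag_atlas_eq
proof (intro conjI ballI)
  fix c :: "(cflag, complex^3) chart" assume "c \<in> flag_chart ` SL3"
  then obtain g where g: "det g \<noteq> 0" and c: "c = flag_chart g" using SL3_det by blast
  show "inj_on (snd c) (fst c)" unfolding c flag_chart_def by (simp add: inj_on_inv_into)
  show "open (snd c ` fst c)" unfolding c flag_chart_simps(4)[OF g] by simp
  fix d :: "(cflag, complex^3) chart" assume "d \<in> flag_chart ` SL3"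
  then obtain h where h: "det h \<noteq> 0" and d: "d = flag_chart h" using SL3_det by blast
  define n m where "n a = (matrix_inv h ** g) *v flag_point a" and "m a = flag_form a v* (matrix_inv g ** h)" for a
  define S where "S = {a. n a $ 1 \<noteq> 0} \<inter> {a. m a $ 3 \<noteq> 0}"
  have t: "flag_param h b = flag_param g a \<longleftrightarrow> a \<in> S \<and> b = vector [n a $ 2 / n a $ 1, n a $ 3 / n a $ 1, - m a $ 2 / m a $ 3]" for a b
    unfolding flag_param_transition[OF g h] by (simp add: n_def m_def S_def)
  have sn: "open T \<Longrightarrow> smooth_on T (\<lambda>a. n a $ i)" and sm: "open T \<Longrightarrow> smooth_on T (\<lambda>a. m a $ i)" for i T
    unfolding n_def m_def matrix_vector_mult_def vector_matrix_mult_def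
    by (simp_all, intro smooth_on_sum smooth_on_mult smooth_on_const smooth_on_flag_point smooth_on_flag_form)+
  have S: "open S" unfolding S_def by (intro open_Int smooth_on_open_nonzero sn sm) auto
  have dom: "snd c ` (fst c \<inter> fst d) = S"
  proof -
    have "fst c \<inter> fst d = flag_param g ` S"
      unfolding c d flag_chart_simps(3)[OF g] flag_chart_simps(3)[OF h] using t by (auto simp: image_iff) metis
    then show ?thesis by (simp add: image_image c flag_chart_simps(1)[OF g])
  qed
  show "open (snd c ` (fst c \<inter> fst d))" unfolding dom by (rule S)
  have "smooth_on S (\<lambda>a. vector [n a $ 2 / n a $ 1, n a $ 3 / n a $ 1, - m a $ 2 / m a $ 3] :: complex^3)"
  proof (rule smooth_on_vec[OF S])
    show "smooth_on S (\<lambda>a. (vector [n a $ 2 / n a $ 1, n a $ 3 / n a $ 1, - m a $ 2 / m a $ 3] :: complex^3) $ i)" for i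
      using exhaust_3[of i] S
      by (auto intro!: smooth_on_divide smooth_on_minus sn sm) (auto simp: S_def)
  qed
  moreover have "vector [n a $ 2 / n a $ 1, n a $ 3 / n a $ 1, - m a $ 2 / m a $ 3] = (snd d \<circ> chart_inv c) a" if "a \<in> S" for a
    using t[of "vector [n a $ 2 / n a $ 1, n a $ 3 / n a $ 1, - m a $ 2 / m a $ 3]" a] that
    by (simp add: c d flag_chart_simps(2)[OF g]) (metis flag_chart_simps(1)[OF h])
  ultimately show "smooth_on (snd c ` (fst c \<inter> fst d)) (snd d \<circ> chart_inv c)"
    unfolding dom by (rule smooth_on_cong[OF S])
qed

interpretation F: atlas F_atlas
  by unfold_locales (rule smooth_atlas_flag)

lemma flag_act_compose: "flag_act g (flag_act h x) = flag_act (g ** h) x"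
  if "det g \<noteq> 0" "det h \<noteq> 0" for g h :: "'k::field^3^3"
  using that by (simp add: flag_act_def proj_act_def image_image matrix_vector_mul_assoc vector_matrix_mul_assoc matrix_inv_mult)

lemma flag_act_id: "flag_act (mat 1) x = (x :: ('k::field^3) set \<times> ('k^3) set)"
proof -
  have "matrix_inv (mat 1) = (mat 1 :: 'k^3^3)" by (rule matrix_inv_eqI) simp
  then show ?thesis by (simp add: flag_act_def proj_act_def)
qed

lemma flag_act_inverse:
  assumes "det (g :: 'k::field^3^3) \<noteq> 0"
  shows "flag_act (matrix_inv g) (flag_act g x) = x" "flag_act g (flag_act (matrix_inv g) x) = x"
  using assms by (simp_all add: flag_act_compose det_matrix_inv matrix_inv_det flag_act_id)

lemma flag_act_param:
  assumes "det g \<noteq> 0" "det h \<noteq> 0"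
  shows "flag_act g (flag_param h a) = flag_param (g ** h) a"
  using flag_act_compose[OF assms] by (simp add: flag_param_def)

lemma flag_chart_act:
  assumes "det g \<noteq> 0" "det h \<noteq> 0"
  shows "flag_act g x \<in> fst (flag_chart (g ** h)) \<longleftrightarrow> x \<in> fst (flag_chart h)"
    "snd (flag_chart (g ** h)) (flag_act g x) = snd (flag_chart h) x"
proof -
  have e: "flag_param (g ** h) a = flag_act g x \<longleftrightarrow> flag_param h a = x" for a
    using flag_act_inverse[OF assms(1)] by (metis flag_act_param[OF assms])
  then show "flag_act g x \<in> fst (flag_chart (g ** h)) \<longleftrightarrow> x \<in> fst (flag_chart h)"
    unfolding flag_chart_def fst_conv image_iff by (metis UNIV_I)
  show "snd (flag_chart (g ** h)) (flag_act g x) = snd (flag_chart h) x"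
    by (simp add: flag_chart_def inv_into_def e)
qed

text \<open>Scalars act trivially on flags and complex numbers have cube roots, so the matrices
  delivered by the normal forms can be replaced by unimodular ones.\<close>

lemma SL3_scale:
  assumes "det (g :: complex^3^3) \<noteq> 0"
  obtains g' \<mu> where "g' \<in> SL3" "\<mu> \<noteq> 0" "g' = (\<chi> i j. \<mu> * g $ i $ j)"
proof -
  obtain \<nu> where \<nu>: "\<nu> ^ 3 = det g"
    by (rule exists_complex_root[of 3 "det g"]) auto
  define \<mu> where "\<mu> = inverse \<nu>"
  have "\<nu> \<noteq> 0" using \<nu> assms by auto
  then have "\<mu> ^ 3 * det g = 1" unfolding \<mu>_def \<nu>[symmetric] by (simp add: field_simps)
  moreover have "det (\<chi> i j. \<mu> * g $ i $ j) = \<mu> ^ 3 * det g"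
    by (simp add: det_3 power3_eq_cube algebra_simps)
  ultimately have "(\<chi> i j. \<mu> * g $ i $ j) \<in> SL3" by (simp add: SL3_def)
  moreover have "\<mu> \<noteq> 0" using \<open>\<nu> \<noteq> 0\<close> by (simp add: \<mu>_def)
  ultimately show thesis using that by blast
qed

lemma flag_act_scale:
  fixes g :: "complex^3^3"
  assumes "\<mu> \<noteq> 0" "det g \<noteq> 0"
  shows "flag_act (\<chi> i j. \<mu> * g $ i $ j) (line z, line l) = flag_act g (line z, line l)"
proof -
  have "matrix_inv (\<chi> i j. \<mu> * g $ i $ j) = (\<chi> i j. inverse \<mu> * matrix_inv g $ i $ j)"
  proof (rule matrix_inv_eqI)
    have "((\<chi> i j. \<mu> * g $ i $ j) ** (\<chi> i j. inverse \<mu> * matrix_inv g $ i $ j)) $ i $ j = (g ** matrix_inv g) $ i $ j" for i j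
      using assms(1) by (simp add: matrix_matrix_mult_def sum_3 field_simps)
    then show "(\<chi> i j. \<mu> * g $ i $ j) ** (\<chi> i j. inverse \<mu> * matrix_inv g $ i $ j) = mat 1"
      unfolding matrix_inv_det(1)[OF assms(2)] vec_eq_iff by blast
  qed
  moreover have "l v* (\<chi> i j. inverse \<mu> * matrix_inv g $ i $ j) = inverse \<mu> *s (l v* matrix_inv g)"
    by (simp add: vec_eq_iff vector_matrix_mult_def sum_distrib_left mult_ac)
  ultimately show ?thesis using assms(1) by (simp add: flag_act_line line_scale_matrix line_scale)
qed

lemma flag_param_scale:
  fixes g :: "complex^3^3"
  assumes "\<mu> \<noteq> 0" "det g \<noteq> 0"
  shows "flag_param (\<chi> i j. \<mu> * g $ i $ j) = flag_param g"
  using flag_act_scale[OF assms] by (simp add: flag_param_def fun_eq_iff)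

section \<open>Totally real maps into the flag space\<close>

lemma has_derivative_vecI:
  fixes f :: "'a::real_normed_vector \<Rightarrow> 'b::real_normed_vector^'n"
  assumes "\<And>i. ((\<lambda>x. f x $ i) has_derivative (\<lambda>v. f' v $ i)) F"
  shows "(f has_derivative f') F"
proof -
  have "((\<lambda>x. \<Sum>i\<in>UNIV. axis i (f x $ i)) has_derivative (\<lambda>v. \<Sum>i\<in>UNIV. axis i (f' v $ i))) F"
    by (intro has_derivative_sum bounded_linear.has_derivative[OF bounded_linear_axis] assms)
  moreover have "(\<Sum>i\<in>UNIV. axis i (z $ i)) = z" for z :: "'b^'n"
    by (simp add: vec_eq_iff axis_def if_distrib cong: if_cong)
  ultimately show ?thesis by simp
qed

section \<open>The two line fields of the flag space in coordinates\<close>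

definition proj_vec :: "'k::field^2 \<Rightarrow> 'k^3" where "proj_vec b = vector [1, b$1, b$2]"

lemma proj_vec_nth [simp]: "proj_vec b $ 1 = 1" "proj_vec b $ 2 = b $ 1" "proj_vec b $ 3 = b $ 2"
  by (simp_all add: proj_vec_def)

lemma proj_param_eq: "proj_param g b = line (g *v proj_vec b)"
  by (simp add: proj_param_def proj_act_line proj_vec_def)

lemma proj_param_transition:
  fixes g h :: "'k::field^3^3"
  assumes g: "det g \<noteq> 0" and h: "det h \<noteq> 0"
  defines "n \<equiv> \<lambda>b. (matrix_inv h ** g) *v proj_vec b"
  shows "proj_param h b' = proj_param g b \<longleftrightarrow> n b $ 1 \<noteq> 0 \<and> b' = vector [n b $ 2 / n b $ 1, n b $ 3 / n b $ 1]"
proof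
  have gn: "h *v n b = g *v proj_vec b"
    by (simp add: n_def matrix_vector_mul_assoc matrix_mul_assoc matrix_inv_det h)
  have hP0: "proj_vec b \<noteq> 0" for b :: "'k^2" by (auto simp: vec_eq_iff forall_3)
  {
    assume "proj_param h b' = proj_param g b"
    then have "line (g *v proj_vec b) = line (h *v proj_vec b')" by (simp add: proj_param_eq)
    moreover have "g *v proj_vec b \<noteq> 0" using g hP0 by (simp add: matrix_vector_eq_0)
    ultimately obtain c where c: "c \<noteq> 0" "g *v proj_vec b = c *s (h *v proj_vec b')" using line_eqD by blast
    have "n b = matrix_inv h *v (g *v proj_vec b)" by (simp add: n_def matrix_vector_mul_assoc)
    also have "\<dots> = c *s proj_vec b'" unfolding c(2) by (simp add: vector_scalar_commute matrix_vector_mul_assoc matrix_inv_det h)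
    finally show "n b $ 1 \<noteq> 0 \<and> b' = vector [n b $ 2 / n b $ 1, n b $ 3 / n b $ 1]"
      using c by (simp add: vec_eq_iff forall_2)
  }
  {
    assume a: "n b $ 1 \<noteq> 0 \<and> b' = vector [n b $ 2 / n b $ 1, n b $ 3 / n b $ 1]"
    then have "proj_vec b' = inverse (n b $ 1) *s n b" by (simp add: vec_eq_iff forall_3 field_simps)
    then show "proj_param h b' = proj_param g b"
      using a by (simp add: proj_param_eq vector_scalar_commute gn line_scale)
  }
qed

lemma inj_proj_param: "det (g :: 'k::field^3^3) \<noteq> 0 \<Longrightarrow> inj (proj_param g)"
  by (rule injI) (metis proj_param_transition)

lemma proj_transition_differentiable:
  fixes g h :: "complex^3^3"
  assumes g: "det g \<noteq> 0" and h: "det h \<noteq> 0" and b: "proj_param g b \<in> range (proj_param h)"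
  shows "(\<lambda>b. inv (proj_param h) (proj_param g b)) differentiable (at b)"
proof -
  define n where "n b = (matrix_inv h ** g) *v proj_vec b" for b
  note t = proj_param_transition[OF g h, folded n_def]
  let ?S = "{b. n b $ 1 \<noteq> 0}"
  have sh: "open T \<Longrightarrow> smooth_on T (\<lambda>b::complex^2. proj_vec b $ i)" for i :: 3 and T
    using exhaust_3[of i]
    by (elim disjE) (simp_all add: smooth_on_const smooth_on_nth[OF _ smooth_on_ident])
  have sn: "open T \<Longrightarrow> smooth_on T (\<lambda>b. n b $ i)" for i T
    unfolding n_def matrix_vector_mult_def
    by (simp, intro smooth_on_sum smooth_on_mult smooth_on_const sh)
  have S: "open ?S" by (intro smooth_on_open_nonzero sn) simp
  have "smooth_on ?S (\<lambda>b. vector [n b $ 2 / n b $ 1, n b $ 3 / n b $ 1] :: complex^2)"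
  proof (rule smooth_on_vec[OF S])
    show "smooth_on ?S (\<lambda>b. (vector [n b $ 2 / n b $ 1, n b $ 3 / n b $ 1] :: complex^2) $ i)" for i
      using exhaust_2[of i] S
      by (auto intro!: smooth_on_divide sn)
  qed
  moreover have "vector [n b $ 2 / n b $ 1, n b $ 3 / n b $ 1] = inv (proj_param h) (proj_param g b)" if "b \<in> ?S" for b
    using t[of "vector [n b $ 2 / n b $ 1, n b $ 3 / n b $ 1]" b] that by (metis (mono_tags) inj_proj_param[OF h] inv_f_eq mem_Collect_eq)
  ultimately have "smooth_on ?S (\<lambda>b. inv (proj_param h) (proj_param g b))"
    by (rule smooth_on_cong[OF S])
  moreover have "b \<in> ?S" using b t by auto
  ultimately show ?thesis by (rule smooth_on_differentiable)
qed

lemma flag_chart_at: "g \<in> SL3 \<Longrightarrow> flag_chart g \<in> charts_at flag_atlas (flag_param g a)"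
  by (auto simp: charts_at_def flag_atlas_eq flag_chart_def)

text \<open>The projection is \<beta> in the chart of \<open>G\<close> and \<beta> followed by a
  transition map in every other chart, so the derivative of \<beta> decides the vanishing in all
  charts at once.\<close>

lemma pushforward_proj_zero:
  fixes pr :: "cflag \<Rightarrow> (complex^3) set" and \<beta> :: "complex^3 \<Rightarrow> complex^2"
  assumes g: "g \<in> SL3" and G: "G \<in> SL3" and pr: "\<And>b. pr (flag_param g b) = proj_param G (\<beta> b)"
    and \<beta>: "(\<beta> has_derivative \<beta>') (at a)" and v: "v \<in> tangent_space F_atlas (flag_param g a)"
  shows "pushforward F_atlas proj_atlas pr (flag_param g a) v = (\<lambda>c. 0) \<longleftrightarrow> \<beta>' (v (flag_chart g)) = 0"
proof -
  let ?c = "flag_chart g" and ?x = "flag_param g a"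
  note target_chart = SL3_det[OF g] and dG = SL3_det[OF G]
  have D: "((snd (range (proj_param h), inv (proj_param h)) \<circ> pr \<circ> chart_inv ?c) has_derivative
     (\<lambda>v. frechet_derivative (\<lambda>b. inv (proj_param h) (proj_param G b)) (at (\<beta> a)) (\<beta>' v))) (at (snd ?c ?x))"
    if "h \<in> SL3" "pr ?x \<in> range (proj_param h)" for h
  proof -
    have "(\<lambda>b. inv (proj_param h) (proj_param G b)) differentiable (at (\<beta> a))"
      using that by (intro proj_transition_differentiable SL3_det) (auto simp: pr G)
    then have "((\<lambda>b. inv (proj_param h) (proj_param G b)) has_derivative frechet_derivative (\<lambda>b. inv (proj_param h) (proj_param G b)) (at (\<beta> a))) (at (\<beta> a))"
      by (simp add: frechet_derivative_works)
    from has_derivative_compose[OF \<beta> this] show ?thesis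
      by (simp add: comp_def flag_chart_simps[OF target_chart] pr)
  qed
  have p: "pushforward F_atlas proj_atlas pr ?x v (range (proj_param h), inv (proj_param h)) =
      frechet_derivative (\<lambda>b. inv (proj_param h) (proj_param G b)) (at (\<beta> a)) (\<beta>' (v ?c))"
    if "h \<in> SL3" "pr ?x \<in> range (proj_param h)" for h
  proof -
    have "(range (proj_param h), inv (proj_param h)) \<in> charts_at proj_atlas (pr ?x)"
      using that by (auto simp: charts_at_def proj_atlas_def)
    from F.pushforward_chart[OF flag_chart_at[OF g] v this differentiableI[OF D[OF that]]]
    have "pushforward F_atlas proj_atlas pr ?x v (range (proj_param h), inv (proj_param h)) =
      tderiv ?c (snd (range (proj_param h), inv (proj_param h)) \<circ> pr) ?x (v ?c)" .
    then show ?thesis using fun_cong[OF frechet_derivative_at[OF D[OF that]], of "v ?c"] by (simp only: o_assoc)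
  qed
  show ?thesis
  proof
    assume z: "pushforward F_atlas proj_atlas pr ?x v = (\<lambda>c. 0)"
    \<comment> \<open>In the chart of \<open>G\<close> itself the transition map is the
      identity.\<close>
    have "(\<lambda>b. inv (proj_param G) (proj_param G b)) = (\<lambda>b. b)" using inj_proj_param[OF dG] by simp
    then show "\<beta>' (v ?c) = 0" using p[OF G] z by (simp add: pr)
  next
    assume z: "\<beta>' (v ?c) = 0"
    show "pushforward F_atlas proj_atlas pr ?x v = (\<lambda>c. 0)"
    proof
      fix e show "pushforward F_atlas proj_atlas pr ?x v e = 0"
      proof (cases "e \<in> charts_at proj_atlas (pr ?x)")
        case True
        then obtain h where h: "h \<in> SL3" and e: "e = (range (proj_param h), inv (proj_param h))" "pr ?x \<in> range (proj_param h)"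
          by (auto simp: charts_at_def proj_atlas_def)
        have "(\<lambda>b. inv (proj_param h) (proj_param G b)) differentiable (at (\<beta> a))"
          using e by (intro proj_transition_differentiable SL3_det h G) (auto simp: pr)
        then have "linear (frechet_derivative (\<lambda>b. inv (proj_param h) (proj_param G b)) (at (\<beta> a)))"
          using has_derivative_linear unfolding frechet_derivative_works by blast
        then show ?thesis using p[OF h e(2)] by (simp add: e(1) z linear_0)
      qed (rule pushforward_outside)
    qed
  qed
qed

text \<open>The point of a flag depends on the first two parameters only.\<close>

lemma T1_F_coordinates:
  assumes g: "g \<in> SL3"
  shows "v \<in> T1_F (flag_param g a) \<longleftrightarrow> v \<in> tangent_space F_atlas (flag_param g a) \<and>
     v (flag_chart g) $ 1 = 0 \<and> v (flag_chart g) $ 2 = 0"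
proof -
  let ?\<beta> = "\<lambda>b::complex^3. vector [b $ 1, b $ 2] :: complex^2"
  have "fst (flag_param g b) = proj_param g (?\<beta> b)" for b
    by (simp add: flag_param_eq proj_param_eq proj_vec_def flag_point_def)
  moreover have "(?\<beta> has_derivative ?\<beta>) (at a)"
  proof (rule has_derivative_vecI)
    show "((\<lambda>b. ?\<beta> b $ i) has_derivative (\<lambda>b. ?\<beta> b $ i)) (at a)" for i
      using exhaust_2[of i] bounded_linear_imp_has_derivative[OF bounded_linear_vec_nth] by auto
  qed
  ultimately show ?thesis
    using pushforward_proj_zero[OF g g, of fst ?\<beta> ?\<beta> a v] by (auto simp: T1_F_def vec_eq_iff forall_2)
qed

text \<open>Up to order and scale the form has affine coordinates - a3 and a1 a3 - a2. Their
  differentials vanish together exactly when da3 = 0 and da2 = a3 da1, the condition dy = p dx on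
  line elements.\<close>

lemma T2_F_coordinates:
  assumes g: "g \<in> SL3"
  shows "v \<in> T2_F (flag_param g a) \<longleftrightarrow> v \<in> tangent_space F_atlas (flag_param g a) \<and>
     v (flag_chart g) $ 3 = 0 \<and> v (flag_chart g) $ 2 = a $ 3 * v (flag_chart g) $ 1"
proof -
  let ?\<beta> = "\<lambda>b::complex^3. vector [- b $ 3, b $ 1 * b $ 3 - b $ 2] :: complex^2"
  let ?\<beta>' = "\<lambda>v::complex^3. vector [- v $ 3, (a $ 1 * v $ 3 + v $ 1 * a $ 3) - v $ 2] :: complex^2"
  \<comment> \<open>Forms move by the inverse transpose. \<open>E\<close> reverses the coordinates,
    because charts of the plane normalise the first entry and \<open>flag_form\<close> the last; the
    signs give it determinant 1.\<close>
  define E :: "complex^3^3" where "E = vector [vector [0, 0, -1], vector [0, -1, 0], vector [-1, 0, 0]]"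
  define G where "G = transpose (matrix_inv g) ** E"
  have "det E = 1" by (simp add: det_3 E_def)
  then have G: "G \<in> SL3" using g by (simp add: G_def SL3_def det_mul det_matrix_inv)
  have "snd (flag_param g b) = proj_param G (?\<beta> b)" for b
  proof -
    have "E *v proj_vec (?\<beta> b) = (- 1) *s flag_form b"
      by (simp add: vec_eq_iff forall_3 E_def matrix_vector_mult_def sum_3)
    then have "G *v proj_vec (?\<beta> b) = (- 1) *s (flag_form b v* matrix_inv g)"
      unfolding G_def matrix_vector_mul_assoc[symmetric]
      by (simp only: vector_scalar_commute transpose_matrix_vector)
    then have "line (G *v proj_vec (?\<beta> b)) = line ((- 1) *s (flag_form b v* matrix_inv g))" by (simp only:)
    also have "\<dots> = line (flag_form b v* matrix_inv g)" by (rule line_scale) simp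
    finally show ?thesis by (simp add: flag_param_eq proj_param_eq)
  qed
  moreover have "(?\<beta> has_derivative ?\<beta>') (at a)"
  proof (rule has_derivative_vecI)
    have n: "((\<lambda>b::complex^3. b $ j) has_derivative (\<lambda>v. v $ j)) (at a)" for j
      by (rule bounded_linear_imp_has_derivative[OF bounded_linear_vec_nth])
    show "((\<lambda>b. ?\<beta> b $ i) has_derivative (\<lambda>b. ?\<beta>' b $ i)) (at a)" for i
      using exhaust_2[of i] has_derivative_minus[OF n[of 3]]
        has_derivative_diff[OF has_derivative_mult[OF n[of 1] n[of 3]] n[of 2]] by auto
  qed
  ultimately have "pushforward F_atlas proj_atlas snd (flag_param g a) v = (\<lambda>c. 0) \<longleftrightarrow> ?\<beta>' (v (flag_chart g)) = 0"
    if "v \<in> tangent_space F_atlas (flag_param g a)"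
    using pushforward_proj_zero[OF g G _ _ that, of snd ?\<beta> ?\<beta>'] by blast
  moreover have "?\<beta>' w = 0 \<longleftrightarrow> w $ 3 = 0 \<and> w $ 2 = a $ 3 * w $ 1" for w
    by (auto simp: vec_eq_iff forall_2 mult.commute)
  ultimately show ?thesis by (auto simp: T2_F_def)
qed

text \<open>The chart of \<open>g ** h\<close> after translation by \<open>g\<close> is the chart of
  \<open>h\<close>, so corresponding charts at the two points have the same transition maps.\<close>

lemma tangent_space_translate:
  assumes g: "g \<in> SL3" and w': "w' \<in> tangent_space F_atlas (flag_act g x)"
    and w: "\<And>h. h \<in> SL3 \<Longrightarrow> w (flag_chart h) = w' (flag_chart (g ** h))"
    and 0: "\<And>c. c \<notin> charts_at F_atlas x \<Longrightarrow> w c = 0"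
  shows "w \<in> tangent_space F_atlas x"
proof -
  have "w d = tderiv c (snd d) x (w c)" if cd: "c \<in> charts_at F_atlas x" "d \<in> charts_at F_atlas x" for c d
  proof -
    obtain h where h: "h \<in> SL3" "c = flag_chart h" "x \<in> fst c" using cd(1) by (auto simp: charts_at_def flag_atlas_eq)
    obtain k where k: "k \<in> SL3" "d = flag_chart k" "x \<in> fst d" using cd(2) by (auto simp: charts_at_def flag_atlas_eq)
    note dt = SL3_det[OF g] SL3_det[OF h(1)] SL3_det[OF k(1)]
    have "g ** h \<in> SL3" "g ** k \<in> SL3" using g h k by (auto simp: SL3_def det_mul)
    then have c': "flag_chart (g ** h) \<in> charts_at F_atlas (flag_act g x)" "flag_chart (g ** k) \<in> charts_at F_atlas (flag_act g x)"
      using h k flag_chart_act(1)[OF dt(1,2)] flag_chart_act(1)[OF dt(1,3)] by (auto simp: charts_at_def flag_atlas_eq)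
    have "snd (flag_chart (g ** k)) \<circ> chart_inv (flag_chart (g ** h)) = snd d \<circ> chart_inv c"
      using dt by (simp add: fun_eq_iff h(2) k(2) flag_chart_simps det_mul flag_chart_act(2) flip: flag_act_param)
    then show ?thesis
      using F.tangent_spaceD[OF w' c'] w[OF h(1)] w[OF k(1)] flag_chart_act(2)[OF dt(1,2)] by (simp add: h(2) k(2))
  qed
  then show ?thesis using 0 unfolding tangent_space_def by blast
qed

locale real_embedding = atlas_map M F_atlas U f
  for M :: "('a, real^3) chart set" and U :: "'a set" and f :: "'a \<Rightarrow> cflag" +
  assumes bij: "q \<in> U \<Longrightarrow> bij_betw (Jpushforward M F_atlas f q) (ctangent_space M q) (tangent_space F_atlas (f q))"
begin

lemma Jpushforward_eq:
  assumes "q \<in> U" "c \<in> charts_at M q" "d \<in> charts_at F_atlas (f q)" "X \<in> ctangent_space M q"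
  shows "Jpushforward M F_atlas f q X d = tderiv c (snd d \<circ> f) q (fst X c) + \<i> *s tderiv c (snd d \<circ> f) q (snd X c)"
  using assms by (auto simp: Jpushforward_def ctangent_space_def pushforward_eq)

lemma derivative_matrix:
  assumes q: "q \<in> U" and c: "c \<in> charts_at M q" and d: "d \<in> charts_at F_atlas (f q)"
  shows "tderiv c (snd d \<circ> f) q u = (\<chi> i j. tderiv c (snd d \<circ> f) q (axis j 1) $ i) *v (\<chi> j. of_real (u $ j))"
proof -
  let ?D = "tderiv c (snd d \<circ> f) q"
  let ?J = "\<chi> i j. ?D (axis j 1) $ i"
  have u: "(\<Sum>j\<in>UNIV. u $ j *\<^sub>R axis j 1) = u" by (simp add: vec_eq_iff axis_def if_distrib cong: if_cong)
  have "?D (\<Sum>j\<in>UNIV. u $ j *\<^sub>R axis j 1) = (\<Sum>j\<in>UNIV. u $ j *\<^sub>R ?D (axis j 1))"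
    by (simp only: linear_scale[OF linear_tderiv[OF q c d]] linear_sum[OF linear_tderiv[OF q c d]])
  then have "?D u = (\<Sum>j\<in>UNIV. u $ j *\<^sub>R ?D (axis j 1))" unfolding u .
  then show ?thesis by (simp add: vec_eq_iff matrix_vector_mult_def) (simp add: scaleR_conv_of_real mult.commute)
qed

text \<open>Complex combinations of the real coordinate vectors are coordinates of complexified
  tangent vectors, so surjectivity of \<open>Jpushforward\<close> becomes surjectivity of the
  complex Jacobian.\<close>

lemma jacobian_nonzero:
  assumes q: "q \<in> U" and c: "c \<in> charts_at M q" and d: "d \<in> charts_at F_atlas (f q)"
  shows "det (\<chi> i j. tderiv c (snd d \<circ> f) q (axis j 1) $ i) \<noteq> 0"
proof -
  let ?D = "tderiv c (snd d \<circ> f) q"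
  let ?J = "\<chi> i j. ?D (axis j 1) $ i"
  note D = derivative_matrix[OF q c d]
  have "surj (\<lambda>z. ?J *v z)"
  proof (rule surjI)
    fix b :: "complex^3"
    define z where "z b = (SOME z. ?J *v z = b)" for b
    obtain Y where Y: "Y \<in> tangent_space F_atlas (f q)" "Y d = b" using F.tangent_space_obtain[OF d] .
    then obtain X where X: "X \<in> ctangent_space M q" "Y = Jpushforward M F_atlas f q X"
      using bij[OF q] unfolding bij_betw_def by (metis imageE)
    have "?J *v ((\<chi> j. of_real (fst X c $ j)) + \<i> *s (\<chi> j. of_real (snd X c $ j))) = b"
      using Jpushforward_eq[OF q c d X(1)] X(2) Y(2) unfolding D[of "fst X c"] D[of "snd X c"]
      by (simp add: matrix_vector_right_distrib vector_scalar_commute)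
    then show "?J *v z b = b" unfolding z_def by (rule someI)
  qed
  then obtain B where "?J ** B = mat 1" using matrix_right_invertible_surjective by blast
  then have "det ?J * det B = 1" by (metis det_I det_mul)
  then show ?thesis by auto
qed

lemma derivative_injective:
  assumes q: "q \<in> U" and c: "c \<in> charts_at M q" and d: "d \<in> charts_at F_atlas (f q)"
    and v: "tderiv c (snd d \<circ> f) q v = 0"
  shows "v = 0"
proof -
  have "(\<chi> j. complex_of_real (v $ j)) = 0"
    using trans[OF derivative_matrix[OF q c d, symmetric] v] matrix_vector_eq_0(1)[OF jacobian_nonzero[OF q c d]] by blast
  then show ?thesis by (simp add: vec_eq_iff)
qed

text \<open>The vector of \<open>T1\<close> over (0, 0, 1) has its conjugate in the second line,
  whose image lies along (1, p, 0). Conjugation changes the sign of the imaginary part, whence the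
  difference.\<close>

lemma CR_pointwise:
  assumes q: "q \<in> U" and c: "c \<in> charts_at M q" and g: "g \<in> SL3" and a: "f q = flag_param g a"
    and T: "T1 \<subseteq> ctangent_space M q" "cconj ` T1 \<subseteq> ctangent_space M q"
    "Jpushforward M F_atlas f q ` T1 = T1_F (f q)" "Jpushforward M F_atlas f q ` cconj ` T1 = T2_F (f q)"
  defines "D \<equiv> tderiv c (snd (flag_chart g) \<circ> f) q"
  shows "\<exists>P Q \<tau>. D P + \<i> *s D Q = vector [0, 0, 1] \<and> D P - \<i> *s D Q = \<tau> *s vector [1, a $ 3, 0]"
proof -
  let ?d = "flag_chart g"
  have d: "?d \<in> charts_at F_atlas (f q)" unfolding a by (rule flag_chart_at[OF g])
  obtain Y where Y: "Y \<in> tangent_space F_atlas (f q)" "Y ?d = vector [0, 0, 1]" using F.tangent_space_obtain[OF d] .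
  then have "Y \<in> T1_F (f q)" unfolding a T1_F_coordinates[OF g] by simp
  then obtain X where X: "X \<in> T1" "Y = Jpushforward M F_atlas f q X" using T(3) by blast
  have 1: "D (fst X c) + \<i> *s D (snd X c) = vector [0, 0, 1]"
    using Jpushforward_eq[OF q c d, of X] X T(1) Y(2) unfolding D_def by auto
  have "cconj X \<in> ctangent_space M q" using X T(2) by auto
  then have "Jpushforward M F_atlas f q (cconj X) ?d = D (fst X c) + \<i> *s D (- snd X c)"
    using Jpushforward_eq[OF q c d, of "cconj X"] by (simp add: cconj_def D_def)
  also have "D (- snd X c) = - D (snd X c)"
    using linear_neg linear_tderiv[OF q c d] D_def by blast
  finally have 2: "Jpushforward M F_atlas f q (cconj X) ?d = D (fst X c) - \<i> *s D (snd X c)"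
    by (simp add: vec_eq_iff)
  have "Jpushforward M F_atlas f q (cconj X) \<in> T2_F (f q)" using X(1) T(4) by blast
  then have "(D (fst X c) - \<i> *s D (snd X c)) $ 3 = 0 \<and> (D (fst X c) - \<i> *s D (snd X c)) $ 2 = a $ 3 * (D (fst X c) - \<i> *s D (snd X c)) $ 1"
    unfolding a T2_F_coordinates[OF g] using 2 by (simp add: a)
  then have "D (fst X c) - \<i> *s D (snd X c) = (D (fst X c) - \<i> *s D (snd X c)) $ 1 *s vector [1, a $ 3, 0]"
    by (simp add: vec_eq_iff forall_3 mult.commute right_diff_distrib left_diff_distrib)
  with 1 show ?thesis by blast
qed

text \<open>Injectivity of \<open>Jpushforward\<close> keeps the image of a nonzero real vector
  nonzero, so it is a nonzero multiple of the vector spanning the line.\<close>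

lemma path_pointwise:
  assumes q: "q \<in> U" and c: "c \<in> charts_at M q" and g: "g \<in> SL3" and a: "f q = flag_param g a"
    and X: "X \<in> tangent_space M q" "X \<noteq> (\<lambda>c. 0)"
  defines "D \<equiv> tderiv c (snd (flag_chart g) \<circ> f) q"
  shows "Jpushforward M F_atlas f q (X, (\<lambda>c. 0)) \<in> T1_F (f q) \<Longrightarrow> \<exists>\<sigma>. \<sigma> \<noteq> 0 \<and> D (X c) = \<sigma> *s vector [0, 0, 1]"
    "Jpushforward M F_atlas f q (X, (\<lambda>c. 0)) \<in> T2_F (f q) \<Longrightarrow> \<exists>\<tau>. \<tau> \<noteq> 0 \<and> D (X c) = \<tau> *s vector [1, a $ 3, 0]"
proof -
  let ?d = "flag_chart g"
  have d: "?d \<in> charts_at F_atlas (f q)" unfolding a by (rule flag_chart_at[OF g])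
  have z: "(\<lambda>c. 0) \<in> tangent_space M q" by (rule M.tangent_space_zero)
  have XX: "(X, (\<lambda>c. 0)) \<in> ctangent_space M q" using X z by (simp add: ctangent_space_def)
  have lin: "linear D" unfolding D_def by (rule linear_tderiv[OF q c d])
  have J: "Jpushforward M F_atlas f q (X, (\<lambda>c. 0)) ?d = D (X c)"
    using Jpushforward_eq[OF q c d XX] linear_0[OF lin] by (simp add: D_def)
  have ne: "D (X c) \<noteq> 0"
  proof
    assume 0: "D (X c) = 0"
    have zz: "((\<lambda>c. 0), (\<lambda>c. 0)) \<in> ctangent_space M q" using z by (simp add: ctangent_space_def)
    have "Jpushforward M F_atlas f q ((\<lambda>c. 0), (\<lambda>c. 0)) ?d = 0"
      using Jpushforward_eq[OF q c d zz] linear_0[OF lin] by (simp add: D_def)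
    moreover have "Jpushforward M F_atlas f q (X, (\<lambda>c. 0)) \<in> tangent_space F_atlas (f q)"
      "Jpushforward M F_atlas f q ((\<lambda>c. 0), (\<lambda>c. 0)) \<in> tangent_space F_atlas (f q)"
      using bij[OF q] XX zz by (auto simp: bij_betw_def)
    ultimately have "Jpushforward M F_atlas f q (X, (\<lambda>c. 0)) = Jpushforward M F_atlas f q ((\<lambda>c. 0), (\<lambda>c. 0))"
      using F.tangent_space_eqI[OF _ _ d] J 0 by simp
    then have "(X, (\<lambda>c. 0)) = ((\<lambda>c. 0), (\<lambda>c. 0))"
      using bij[OF q] XX zz by (auto simp: bij_betw_def inj_on_def)
    then show False using X(2) by simp
  qed
  {
    assume "Jpushforward M F_atlas f q (X, (\<lambda>c. 0)) \<in> T1_F (f q)"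
    then have "D (X c) $ 1 = 0 \<and> D (X c) $ 2 = 0" unfolding a T1_F_coordinates[OF g] using J by (simp add: a)
    then have e: "D (X c) = D (X c) $ 3 *s vector [0, 0, 1]" by (simp add: vec_eq_iff forall_3)
    with ne have "D (X c) $ 3 \<noteq> 0" by (metis vector_smult_lzero)
    with e show "\<exists>\<sigma>. \<sigma> \<noteq> 0 \<and> D (X c) = \<sigma> *s vector [0, 0, 1]" by blast
  }
  {
    assume "Jpushforward M F_atlas f q (X, (\<lambda>c. 0)) \<in> T2_F (f q)"
    then have "D (X c) $ 3 = 0 \<and> D (X c) $ 2 = a $ 3 * D (X c) $ 1" unfolding a T2_F_coordinates[OF g] using J by (simp add: a)
    then have e: "D (X c) = D (X c) $ 1 *s vector [1, a $ 3, 0]" by (simp add: vec_eq_iff forall_3 mult.commute)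
    with ne have "D (X c) $ 1 \<noteq> 0" by (metis vector_smult_lzero)
    with e show "\<exists>\<tau>. \<tau> \<noteq> 0 \<and> D (X c) = \<tau> *s vector [1, a $ 3, 0]" by blast
  }
qed

end

section \<open>Maps into a homogeneous model\<close>

text \<open>Invariance of domain gives openness of the image and continuity of the inverse. The
  derivative of the inverse is the smooth \<open>h\<close> evaluated at the inverse itself, which
  raises its differentiability one order at a time.\<close>

lemma smooth_on_inverse_function:
  fixes K :: "real^3 \<Rightarrow> real^3"
  assumes S: "open S" and K: "smooth_on S K" and inj: "inj_on K S"
    and K': "\<And>x v. x \<in> S \<Longrightarrow> frechet_derivative K (at x) v = 0 \<Longrightarrow> v = 0"
  shows "open (K ` S)" "smooth_on (K ` S) (inv_into S K)"
proof -
  let ?L = "inv_into S K"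
  let ?D = "\<lambda>x. frechet_derivative K (at x)"
  show op: "open (K ` S)" by (rule invariance_of_domain[OF smooth_on_continuous[OF K] S inj])
  obtain L where "homeomorphism S (K ` S) K L"
    by (rule invariance_of_domain_homeomorphism[OF S smooth_on_continuous[OF K] _ inj]) simp
  then have "continuous_on (K ` S) L" "\<And>x. x \<in> S \<Longrightarrow> L (K x) = x" by (auto simp: homeomorphism_def)
  then have cont: "continuous_on (K ` S) ?L"
    by (subst continuous_on_cong[OF refl, of _ _ L]) (auto simp: inv_into_f_f[OF inj])
  have L: "?L y \<in> S" "K (?L y) = y" if "y \<in> K ` S" for y
    using that by (auto simp: inv_into_into f_inv_into_f)
  have lin: "linear (?D x)" if "x \<in> S" for x
    using smooth_on_has_derivative[OF K that] has_derivative_linear by blast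
  have "\<exists>h. linear h \<and> h \<circ> ?D x = id \<and> ?D x \<circ> h = id" if x: "x \<in> S" for x
  proof -
    have "inj (?D x)" using K'[OF x] linear_injective_0[OF lin[OF x]] by blast
    from linear_injective_isomorphism[OF lin[OF x] this]
    show ?thesis by (auto simp: fun_eq_iff)
  qed
  then obtain h where h: "\<And>x. x \<in> S \<Longrightarrow> linear (h x)" "\<And>x. x \<in> S \<Longrightarrow> h x \<circ> ?D x = id" "\<And>x. x \<in> S \<Longrightarrow> ?D x \<circ> h x = id"
    by metis
  have DL: "(?L has_derivative h (?L y)) (at y)" if y: "y \<in> K ` S" for y
  proof (rule has_derivative_inverse_basic[where g = ?L and y = y, OF smooth_on_has_derivative[OF K L(1)[OF y]] _ _ _ op y])
    show "bounded_linear (h (?L y))" using h(1)[OF L(1)[OF y]] linear_conv_bounded_linear by blast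
    show "h (?L y) \<circ> ?D (?L y) = id" by (rule h(2)[OF L(1)[OF y]])
    show "continuous (at y) ?L" using cont op y continuous_on_eq_continuous_at by blast
  qed (use L in auto)
  \<comment> \<open>\<open>h x v\<close> solves the linear system whose matrix is that of
    \<open>?D x\<close>, so Cramer's rule gives smoothness in \<open>x\<close>.\<close>
  have sh: "smooth_on S (\<lambda>x. h x v)" for v
  proof (rule smooth_on_solve[OF S])
    let ?A = "\<lambda>x. matrix (?D x)"
    show "smooth_on S (\<lambda>x. ?A x $ i $ j)" for i j
      by (simp add: matrix_def) (intro smooth_on_nth[OF S] smooth_on_frechet_derivative K)
    show "smooth_on S (\<lambda>x. v $ i)" for i by (rule smooth_on_const)
    show "?A x *v h x v = v" if "x \<in> S" for x
      using fun_cong[OF matrix_vector_mul(2)[OF lin[OF that]], of "h x v"] fun_cong[OF h(3)[OF that], of v] by simp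
    show "det (?A x) \<noteq> 0" if x: "x \<in> S" for x
    proof -
      have "?A x ** matrix (h x) = mat 1"
        using matrix_compose[OF h(1)[OF x] lin[OF x]] h(3)[OF x] by (simp add: matrix_id_mat_1)
      then have "det (?A x) * det (matrix (h x)) = 1" by (metis det_I det_mul)
      then show ?thesis by auto
    qed
  qed
  have "C_k_on k (K ` S) ?L" for k
  proof (induction k)
    case 0
    then show ?case using cont by simp
  next
    case (Suc k)
    have "C_k_on k (K ` S) (\<lambda>y. h (?L y) v)" for v
      by (rule C_k_on_compose[OF op S _ Suc]) (use sh L in \<open>auto simp: smooth_on_def\<close>)
    then show ?case by (intro C_k_on_SucI[OF op DL])
  qed
  then show "smooth_on (K ` S) ?L" by (simp add: smooth_on_def)
qed

text \<open>In every chart of \<open>N\<close> and a matching chart of the flag space, \<open>\<phi>\<close> is one fixed map \<open>\<iota>\<close>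
  with a linear left inverse \<open>\<pi>\<close>. This moves all smoothness questions from \<open>N\<close> to the flag space.\<close>

locale model =
  fixes N :: "('b, real^3) chart set" and \<phi> :: "'b \<Rightarrow> cflag"
    and \<iota> :: "real^3 \<Rightarrow> complex^3" and \<pi> :: "complex^3 \<Rightarrow> real^3"
  assumes chart_N: "e \<in> N \<Longrightarrow> inj_on (snd e) (fst e) \<and> snd e ` fst e = UNIV"
    and flag_chart_ex: "e \<in> N \<Longrightarrow> \<exists>G\<in>SL3. (\<forall>x\<in>fst e. \<phi> x = flag_param G (\<iota> (snd e x))) \<and>
      (\<forall>x\<in>topspace (mtop N). \<phi> x \<in> range (flag_param G) \<longrightarrow> x \<in> fst e)"
    and smooth_iota: "smooth_on UNIV \<iota>" and linear_pi: "bounded_linear \<pi>" and pi_iota: "\<pi> (\<iota> a) = a"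
begin

definition G where "G e = (SOME G. G \<in> SL3 \<and> (\<forall>x\<in>fst e. \<phi> x = flag_param G (\<iota> (snd e x))) \<and>
      (\<forall>x\<in>topspace (mtop N). \<phi> x \<in> range (flag_param G) \<longrightarrow> x \<in> fst e))"

lemma G:
  assumes "e \<in> N"
  shows "G e \<in> SL3" "x \<in> fst e \<Longrightarrow> \<phi> x = flag_param (G e) (\<iota> (snd e x))"
    "x \<in> topspace (mtop N) \<Longrightarrow> \<phi> x \<in> range (flag_param (G e)) \<Longrightarrow> x \<in> fst e"
proof -
  have "G e \<in> SL3 \<and> (\<forall>x\<in>fst e. \<phi> x = flag_param (G e) (\<iota> (snd e x))) \<and>
      (\<forall>x\<in>topspace (mtop N). \<phi> x \<in> range (flag_param (G e)) \<longrightarrow> x \<in> fst e)"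
    unfolding G_def by (rule someI_ex[OF flag_chart_ex[OF assms, unfolded Bex_def]])
  then show "G e \<in> SL3" "x \<in> fst e \<Longrightarrow> \<phi> x = flag_param (G e) (\<iota> (snd e x))"
    "x \<in> topspace (mtop N) \<Longrightarrow> \<phi> x \<in> range (flag_param (G e)) \<Longrightarrow> x \<in> fst e" by blast+
qed

lemma det_G: "e \<in> N \<Longrightarrow> det (G e) \<noteq> 0"
  using G(1) SL3_det by blast

lemma flag_chart_G: "e \<in> N \<Longrightarrow> flag_chart (G e) \<in> F_atlas"
  using G(1) by (auto simp: flag_atlas_eq)

lemma chart_inv_N: "e \<in> N \<Longrightarrow> chart_inv e a \<in> fst e" "e \<in> N \<Longrightarrow> snd e (chart_inv e a) = a"
  "e \<in> N \<Longrightarrow> x \<in> fst e \<Longrightarrow> chart_inv e (snd e x) = x"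
  using chart_N[of e] unfolding chart_inv_def by (auto simp: inv_into_into f_inv_into_f inv_into_f_f)

lemma phi_chart_inv: "e \<in> N \<Longrightarrow> \<phi> (chart_inv e a) = flag_param (G e) (\<iota> a)"
  using G(2) chart_inv_N by metis

lemma in_topspace: "e \<in> N \<Longrightarrow> x \<in> fst e \<Longrightarrow> x \<in> topspace (mtop N)"
  by (auto simp: topspace_mtop)

lemma phi_in_chart: "e \<in> N \<Longrightarrow> x \<in> topspace (mtop N) \<Longrightarrow> \<phi> x \<in> fst (flag_chart (G e)) \<longleftrightarrow> x \<in> fst e"
  unfolding flag_chart_def fst_conv using G(2,3)[of e x] by blast

lemma chart_phi: "e \<in> N \<Longrightarrow> x \<in> fst e \<Longrightarrow> snd (flag_chart (G e)) (\<phi> x) = \<iota> (snd e x)"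
  by (simp add: G(2) flag_chart_simps det_G)

text \<open>The transition maps of \<open>N\<close> are those of the flag space restricted along
  \<iota> and read back by \<pi>.\<close>

lemma smooth_atlas_N: "smooth_atlas N"
  unfolding smooth_atlas_def
proof (intro conjI ballI)
  fix e assume e: "e \<in> N"
  show "inj_on (snd e) (fst e)" "open (snd e ` fst e)" using chart_N[OF e] by auto
  fix e' assume e': "e' \<in> N"
  let ?d = "flag_chart (G e)" and ?d' = "flag_chart (G e')"
  let ?T = "snd ?d ` (fst ?d \<inter> fst ?d')"
  note Gd = flag_chart_G[OF e] flag_chart_G[OF e']
  have dom: "snd e ` (fst e \<inter> fst e') = \<iota> -` ?T"
  proof (intro equalityI subsetI)
    fix a assume "a \<in> snd e ` (fst e \<inter> fst e')"
    then obtain x where x: "x \<in> fst e" "x \<in> fst e'" "a = snd e x" by blast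
    then have "\<phi> x \<in> fst ?d \<inter> fst ?d'" "\<iota> a = snd ?d (\<phi> x)"
      using phi_in_chart in_topspace e e' chart_phi by auto
    then show "a \<in> \<iota> -` ?T" by auto
  next
    fix a assume "a \<in> \<iota> -` ?T"
    then obtain y where y: "y \<in> fst ?d" "y \<in> fst ?d'" "\<iota> a = snd ?d y" by auto
    have "y = flag_param (G e) (\<iota> a)" using y by (auto simp: flag_chart_simps det_G e)
    then have "\<phi> (chart_inv e a) \<in> fst ?d'" using phi_chart_inv[OF e] y by simp
    then have "chart_inv e a \<in> fst e'"
      using phi_in_chart[OF e'] in_topspace[OF e chart_inv_N(1)[OF e]] by blast
    then show "a \<in> snd e ` (fst e \<inter> fst e')" using chart_inv_N[OF e] by (metis IntI image_eqI)
  qed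
  have T: "open ?T" by (rule F.open_transition_domain[OF Gd])
  then show op: "open (snd e ` (fst e \<inter> fst e'))"
    unfolding dom using smooth_on_continuous[OF smooth_iota] by (simp add: continuous_open_vimage continuous_on_eq_continuous_at)
  have "smooth_on (\<iota> -` ?T) (\<lambda>a. \<pi> ((snd ?d' \<circ> chart_inv ?d) (\<iota> a)))"
    by (rule smooth_on_linear[OF _ linear_pi smooth_on_compose[OF _ T F.smooth_transition[OF Gd] smooth_on_subset[OF smooth_iota]]])
      (use op dom in auto)
  moreover have "\<pi> ((snd ?d' \<circ> chart_inv ?d) (\<iota> a)) = (snd e' \<circ> chart_inv e) a" if "a \<in> \<iota> -` ?T" for a
  proof -
    have "a \<in> snd e ` (fst e \<inter> fst e')" using that dom by simp
    then have "chart_inv e a \<in> fst e'" using chart_inv_N(3)[OF e] by auto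
    then have "snd ?d' (\<phi> (chart_inv e a)) = \<iota> (snd e' (chart_inv e a))" by (rule chart_phi[OF e'])
    then show ?thesis using pi_iota by (simp add: flag_chart_simps det_G e phi_chart_inv)
  qed
  ultimately show "smooth_on (snd e ` (fst e \<inter> fst e')) (snd e' \<circ> chart_inv e)"
    unfolding dom by (rule smooth_on_cong[OF op[unfolded dom]])
qed

sublocale N: atlas N by unfold_locales (rule smooth_atlas_N)

end

text \<open>The factorisation of \<open>f\<close> through \<phi> is assumed pointwise, without
  continuity of \<open>k\<close>. That \<open>k\<close> is a diffeomorphism respecting the flag
  structures is deduced below.\<close>

locale model_embedding = real_embedding M U f + model N \<phi> \<iota> \<pi>
  for M :: "('a, real^3) chart set" and U f and N :: "('b, real^3) chart set" and \<phi> \<iota> \<pi> +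
  fixes g :: "complex^3^3" and V :: "'a set" and k :: "'a \<Rightarrow> 'b"
  assumes inj_f: "inj_on f U" and V: "openin (mtop M) V" "V \<subseteq> U" and g: "g \<in> SL3"
    and k: "\<And>q. q \<in> V \<Longrightarrow> k q \<in> topspace (mtop N) \<and> f q = flag_act g (\<phi> (k q))"
begin

text \<open>The flag chart that absorbs the translation by \<open>g\<close>: in it \<open>f\<close>
  reads as \<iota> of the coordinates of \<open>k\<close> in \<open>e\<close>.\<close>

definition target_chart where "target_chart e = flag_chart (g ** G e)"

lemma target_chart: "e \<in> N \<Longrightarrow> target_chart e \<in> F_atlas"
  using g G(1)[of e] by (auto simp: target_chart_def flag_atlas_eq SL3_def det_mul)

lemma in_target_chart: "q \<in> V \<Longrightarrow> e \<in> N \<Longrightarrow> f q \<in> fst (target_chart e) \<longleftrightarrow> k q \<in> fst e"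
  using k[of q] flag_chart_act(1)[OF SL3_det[OF g] det_G] phi_in_chart by (simp add: target_chart_def)

lemma chart_target_chart: "q \<in> V \<Longrightarrow> e \<in> N \<Longrightarrow> k q \<in> fst e \<Longrightarrow> snd (target_chart e) (f q) = \<iota> (snd e (k q))"
  using k[of q] flag_chart_act(2)[OF SL3_det[OF g] det_G] chart_phi by (simp add: target_chart_def)

lemma chart_k: "q \<in> V \<Longrightarrow> e \<in> N \<Longrightarrow> k q \<in> fst e \<Longrightarrow> snd e (k q) = \<pi> (snd (target_chart e) (f q))"
  using chart_target_chart pi_iota by simp

lemma inj_k: "inj_on k V"
  using inj_f V(2) k by (metis inj_on_def subsetD)

lemma domain_eq:
  assumes "c \<in> M" "e \<in> N"
  shows "V \<inter> fst c \<inter> k -` fst e = fst c \<inter> (V \<inter> (U \<inter> f -` fst (target_chart e)))"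
  using in_target_chart[OF _ assms(2)] V(2) by blast

lemma open_k_domain:
  assumes "c \<in> M" "e \<in> N" "openin (mtop M) V'" "V' \<subseteq> V"
  shows "open (snd c ` (V' \<inter> fst c \<inter> k -` fst e))"
proof -
  have "V' \<inter> fst c \<inter> k -` fst e = fst c \<inter> (V' \<inter> (U \<inter> f -` fst (target_chart e)))"
    using domain_eq[OF assms(1,2)] assms(4) V(2) by blast
  moreover have "openin (mtop M) (V' \<inter> (U \<inter> f -` fst (target_chart e)))"
    by (intro openin_Int assms(3) openin_preimage openin_mtop_domain target_chart assms(2))
  ultimately show ?thesis using M.open_chart_image[OF _ assms(1)] by simp
qed

text \<open>Since \<pi> undoes \<iota>, in charts \<open>k\<close> is a linear image of the smooth
  map \<open>f\<close>.\<close>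

lemma smooth_k:
  assumes "c \<in> M" "e \<in> N"
  shows "smooth_on (snd c ` (V \<inter> fst c \<inter> k -` fst e)) (snd e \<circ> k \<circ> chart_inv c)"
proof -
  let ?S = "snd c ` (V \<inter> fst c \<inter> k -` fst e)"
  have S: "open ?S" by (rule open_k_domain[OF assms V(1) order_refl])
  have "?S \<subseteq> snd c ` (U \<inter> fst c \<inter> f -` fst (target_chart e))"
    using domain_eq[OF assms] by blast
  then have "smooth_on ?S (\<lambda>a. \<pi> ((snd (target_chart e) \<circ> f \<circ> chart_inv c) a))"
    using smooth_on_subset[OF smooth_local[OF assms(1) target_chart[OF assms(2)]]] by (intro smooth_on_linear[OF S linear_pi])
  then show ?thesis
  proof (rule smooth_on_cong[OF S])
    fix a assume "a \<in> ?S"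
    then obtain q where q: "q \<in> V" "q \<in> fst c" "k q \<in> fst e" "a = snd c q" by blast
    show "\<pi> ((snd (target_chart e) \<circ> f \<circ> chart_inv c) a) = (snd e \<circ> k \<circ> chart_inv c) a"
      using chart_k[OF q(1) assms(2) q(3)] q assms by simp
  qed
qed

text \<open>The derivative of \<open>f\<close> factors through that of \<open>k\<close>, and it is
  injective on real vectors because \<open>f\<close> is totally real.\<close>

lemma k_derivative_injective:
  assumes q: "q \<in> V" and c: "c \<in> charts_at M q" and e: "e \<in> charts_at N (k q)" and v: "tderiv c (snd e \<circ> k) q v = 0"
  shows "v = 0"
proof -
  have ce: "c \<in> M" "q \<in> fst c" "e \<in> N" "k q \<in> fst e" using c e by (auto simp: charts_at_def)
  have qU: "q \<in> U" using q V by blast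
  have d: "target_chart e \<in> charts_at F_atlas (f q)" using target_chart in_target_chart q ce by (auto simp: charts_at_def)
  let ?S = "snd c ` (V \<inter> fst c \<inter> k -` fst e)"
  have S: "open ?S" by (rule open_k_domain[OF ce(1,3) V(1) order_refl])
  have qS: "snd c q \<in> ?S" using ce q by blast
  have "((\<lambda>a. \<iota> ((snd e \<circ> k \<circ> chart_inv c) a)) has_derivative
     (\<lambda>v. frechet_derivative \<iota> (at ((snd e \<circ> k \<circ> chart_inv c) (snd c q))) (tderiv c (snd e \<circ> k) q v))) (at (snd c q))"
    using has_derivative_compose[OF smooth_on_has_derivative[OF smooth_k[OF ce(1,3)] qS] smooth_on_has_derivative[OF smooth_iota UNIV_I]]
    by (simp add: o_assoc)
  then have "((snd (target_chart e) \<circ> f \<circ> chart_inv c) has_derivative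
     (\<lambda>v. frechet_derivative \<iota> (at ((snd e \<circ> k \<circ> chart_inv c) (snd c q))) (tderiv c (snd e \<circ> k) q v))) (at (snd c q))"
  proof (rule has_derivative_transform_within_open[OF _ S qS])
    fix a assume "a \<in> ?S"
    then obtain r where r: "r \<in> V" "r \<in> fst c" "k r \<in> fst e" "a = snd c r" by blast
    show "\<iota> ((snd e \<circ> k \<circ> chart_inv c) a) = (snd (target_chart e) \<circ> f \<circ> chart_inv c) a"
      using chart_target_chart[OF r(1) ce(3) r(3)] r ce by simp
  qed
  note D = fun_cong[OF frechet_derivative_at[OF this], of v]
  have "linear (frechet_derivative \<iota> (at ((snd e \<circ> k \<circ> chart_inv c) (snd c q))))"
    using smooth_on_has_derivative[OF smooth_iota UNIV_I] has_derivative_linear by blast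
  then have "tderiv c (snd (target_chart e) \<circ> f) q v = 0"
    using D v by (simp add: linear_0)
  then show ?thesis by (rule derivative_injective[OF qU c d])
qed

text \<open>In charts \<open>k\<close> is injective and smooth with injective derivative between
  domains of equal dimension. The statement covers every open \<open>V'\<close> in \<open>V\<close>
  so that it also shows \<open>k\<close> to be open.\<close>

lemma k_local_inverse:
  assumes c: "c \<in> M" and e: "e \<in> N" and V': "openin (mtop M) V'" "V' \<subseteq> V"
  defines "S \<equiv> snd c ` (V' \<inter> fst c \<inter> k -` fst e)" and "K \<equiv> snd e \<circ> k \<circ> chart_inv c"
  shows "open (K ` S)" "smooth_on (K ` S) (inv_into S K)" "inj_on K S" "K ` S = snd e ` (fst e \<inter> k ` (V' \<inter> fst c))"
proof -
  have S: "open S" unfolding S_def by (rule open_k_domain[OF c e V'])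
  have sm: "smooth_on S K" unfolding S_def K_def using V' by (intro smooth_on_subset[OF smooth_k[OF c e]]) blast
  show inj: "inj_on K S"
  proof (rule inj_onI)
    fix a b assume "a \<in> S" "b \<in> S" "K a = K b"
    then obtain q r where q: "q \<in> V'" "q \<in> fst c" "k q \<in> fst e" "a = snd c q" and r: "r \<in> V'" "r \<in> fst c" "k r \<in> fst e" "b = snd c r"
      unfolding S_def by blast
    then have "snd e (k q) = snd e (k r)" using \<open>K a = K b\<close> c by (simp add: K_def)
    then have "k q = k r" using chart_N[OF e] q r by (simp add: inj_on_def)
    then have "q = r" using inj_k q r V' by (meson inj_onD subsetD)
    then show "a = b" using q r by simp
  qed
  have "v = 0" if "a \<in> S" "frechet_derivative K (at a) v = 0" for a v
  proof -
    obtain q where q: "q \<in> V'" "q \<in> fst c" "k q \<in> fst e" "a = snd c q" using \<open>a \<in> S\<close> unfolding S_def by blast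
    show ?thesis
      by (rule k_derivative_injective[of q c e]) (use q c e V' that in \<open>auto simp: charts_at_def K_def o_assoc\<close>)
  qed
  from smooth_on_inverse_function[OF S sm inj this]
  show "open (K ` S)" "smooth_on (K ` S) (inv_into S K)" by auto
  show "K ` S = snd e ` (fst e \<inter> k ` (V' \<inter> fst c))"
  proof (intro equalityI subsetI)
    fix b assume "b \<in> K ` S"
    then obtain q where "q \<in> V'" "q \<in> fst c" "k q \<in> fst e" "b = snd e (k q)"
      unfolding S_def K_def using c by auto
    then show "b \<in> snd e ` (fst e \<inter> k ` (V' \<inter> fst c))" by blast
  next
    fix b assume "b \<in> snd e ` (fst e \<inter> k ` (V' \<inter> fst c))"
    then obtain q where q: "q \<in> V'" "q \<in> fst c" "k q \<in> fst e" "b = snd e (k q)" by auto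
    then have "b = K (snd c q)" "snd c q \<in> S" using c by (auto simp: K_def S_def)
    then show "b \<in> K ` S" by blast
  qed
qed

lemma openin_k_image:
  assumes "openin (mtop M) V'" "V' \<subseteq> V"
  shows "openin (mtop N) (k ` V')"
proof (rule N.openin_mtopI)
  show "k ` V' \<subseteq> topspace (mtop N)" using k assms by blast
  fix e assume e: "e \<in> N"
  have "V' \<subseteq> (\<Union>c\<in>M. fst c)" using openin_subset[OF assms(1)] by (simp add: topspace_mtop)
  then have "snd e ` (fst e \<inter> k ` V') = (\<Union>c\<in>M. snd e ` (fst e \<inter> k ` (V' \<inter> fst c)))" by blast
  moreover have "open \<dots>"
    using k_local_inverse(1,4)[OF _ e assms] by (intro open_UN) auto
  ultimately show "open (snd e ` (fst e \<inter> k ` V'))" by simp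
qed

lemma smooth_map_k: "smooth_map M V N k"
proof -
  have "openin (mtop M) (V \<inter> k -` S)" if S: "openin (mtop N) S" for S
  proof (rule M.openin_mtopI)
    show "V \<inter> k -` S \<subseteq> topspace (mtop M)" using openin_subset[OF V(1)] by blast
    fix c assume c: "c \<in> M"
    let ?R = "\<lambda>e. snd c ` (V \<inter> fst c \<inter> k -` fst e) \<inter> (snd e \<circ> k \<circ> chart_inv c) -` (snd e ` (fst e \<inter> S))"
    have "snd c ` (fst c \<inter> (V \<inter> k -` S)) = (\<Union>e\<in>N. ?R e)"
    proof (intro equalityI subsetI)
      fix a assume "a \<in> snd c ` (fst c \<inter> (V \<inter> k -` S))"
      then obtain q where q: "q \<in> fst c" "q \<in> V" "k q \<in> S" "a = snd c q" by blast
      obtain e where "e \<in> N" "k q \<in> fst e" using k[OF q(2)] by (auto simp: topspace_mtop)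
      then have "a \<in> ?R e" using q c by auto
      then show "a \<in> (\<Union>e\<in>N. ?R e)" using \<open>e \<in> N\<close> by blast
    next
      fix a assume "a \<in> (\<Union>e\<in>N. ?R e)"
      then obtain e where e: "e \<in> N" "a \<in> ?R e" by blast
      then obtain q where q: "q \<in> V" "q \<in> fst c" "k q \<in> fst e" "a = snd c q" by blast
      then have "snd e (k q) \<in> snd e ` (fst e \<inter> S)" using e c by auto
      then have "k q \<in> S" using chart_N[OF e(1)] q by (auto simp: inj_on_def)
      then show "a \<in> snd c ` (fst c \<inter> (V \<inter> k -` S))" using q by blast
    qed
    moreover have "open (?R e)" if e: "e \<in> N" for e
      by (rule continuous_open_preimage[OF smooth_on_continuous[OF smooth_k[OF c e]] open_k_domain[OF c e V(1) order_refl] N.open_chart_image[OF S e]])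
    ultimately show "open (snd c ` (fst c \<inter> (V \<inter> k -` S)))" by auto
  qed
  moreover have "{q \<in> topspace (subtopology (mtop M) V). k q \<in> S} = V \<inter> k -` S" for S
    using openin_subset[OF V(1)] by auto
  ultimately have "continuous_map (subtopology (mtop M) V) (mtop N) k"
    unfolding continuous_map_def using k openin_open_subtopology[OF V(1)] by auto
  then show ?thesis unfolding smooth_map_def using smooth_k by blast
qed

text \<open>Preimages under the inverse are images under the open map \<open>k\<close>; in charts
  the inverse is the function from \<open>k_local_inverse\<close>.\<close>

lemma smooth_map_inverse: "smooth_map N (k ` V) M (inv_into V k)"
  unfolding smooth_map_def
proof (intro conjI ballI)
  have kV: "openin (mtop N) (k ` V)" by (rule openin_k_image[OF V(1) order_refl])
  have inv: "inv_into V k (k q) = q" if "q \<in> V" for q using inj_k that by (simp add: inv_into_f_f)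
  show "continuous_map (subtopology (mtop N) (k ` V)) (mtop M) (inv_into V k)"
    unfolding continuous_map_def
  proof (intro conjI allI impI)
    show "inv_into V k \<in> topspace (subtopology (mtop N) (k ` V)) \<rightarrow> topspace (mtop M)"
      using openin_subset[OF V(1)] inv by auto
    fix S assume S: "openin (mtop M) S"
    have "{x \<in> topspace (subtopology (mtop N) (k ` V)). inv_into V k x \<in> S} = k ` (V \<inter> S)"
      using openin_subset[OF kV] inv by auto
    then show "openin (subtopology (mtop N) (k ` V)) {x \<in> topspace (subtopology (mtop N) (k ` V)). inv_into V k x \<in> S}"
      using openin_k_image[of "V \<inter> S"] V(1) S openin_open_subtopology[OF kV] by auto
  qed
  fix e c assume e: "e \<in> N" and c: "c \<in> M"
  let ?S = "snd c ` (V \<inter> fst c \<inter> k -` fst e)" and ?K = "snd e \<circ> k \<circ> chart_inv c"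
  note loc = k_local_inverse[OF c e V(1) order_refl]
  have "k ` V \<inter> fst e \<inter> inv_into V k -` fst c = fst e \<inter> k ` (V \<inter> fst c)"
    using inv by auto
  then have dom: "snd e ` (k ` V \<inter> fst e \<inter> inv_into V k -` fst c) = ?K ` ?S" using loc(4) by simp
  have "inv_into ?S ?K b = (snd c \<circ> inv_into V k \<circ> chart_inv e) b" if b: "b \<in> ?K ` ?S" for b
  proof -
    obtain q where q: "q \<in> V" "q \<in> fst c" "k q \<in> fst e" "b = snd e (k q)"
    proof -
      obtain a where a: "a \<in> ?S" "b = ?K a" using b by blast
      then obtain q where "q \<in> V" "q \<in> fst c" "k q \<in> fst e" "a = snd c q" by blast
      then show thesis using a c by (intro that[of q]) simp_all
    qed
    have "b = ?K (snd c q)" "snd c q \<in> ?S" using q c by auto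
    then have "inv_into ?S ?K b = snd c q" using inv_into_f_f[OF loc(3)] by simp
    also have "\<dots> = (snd c \<circ> inv_into V k \<circ> chart_inv e) b"
      using q inv chart_inv_N(3)[OF e] by simp
    finally show ?thesis .
  qed
  then show "smooth_on (snd e ` (k ` V \<inter> fst e \<inter> inv_into V k -` fst c)) (snd c \<circ> inv_into V k \<circ> chart_inv e)"
    unfolding dom by (rule smooth_on_cong[OF loc(1,2)])
qed

lemma diffeo_k: "diffeo_onto_open M V N k"
  unfolding diffeo_onto_open_def
  using inj_k openin_k_image[OF V(1) order_refl] smooth_map_k smooth_map_inverse by blast

sublocale K: atlas_map M N V k
  by unfold_locales (rule V(1), rule smooth_map_k)

lemma phi_differentiable:
  assumes e: "e \<in> charts_at N x" and d: "d \<in> charts_at F_atlas (\<phi> x)"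
  shows "(snd d \<circ> \<phi> \<circ> chart_inv e) differentiable (at (snd e x))"
proof -
  have e': "e \<in> N" "x \<in> fst e" using e by (auto simp: charts_at_def)
  let ?d = "flag_chart (G e)"
  have d': "?d \<in> charts_at F_atlas (\<phi> x)"
    using flag_chart_G[OF e'(1)] phi_in_chart[OF e'(1) in_topspace[OF e']] e' by (simp add: charts_at_def)
  have "(snd d \<circ> chart_inv ?d) differentiable (at (\<iota> (snd e x)))"
    using F.transition_differentiable[OF d' d] chart_phi[OF e'] by simp
  moreover have "\<iota> differentiable (at (snd e x))"
    using smooth_on_differentiable[OF smooth_iota] by blast
  ultimately have "((snd d \<circ> chart_inv ?d) \<circ> \<iota>) differentiable (at (snd e x))"
    by (intro differentiable_chain_at)
  moreover have "(snd d \<circ> chart_inv ?d) \<circ> \<iota> = snd d \<circ> \<phi> \<circ> chart_inv e"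
    by (simp add: fun_eq_iff flag_chart_simps det_G e' phi_chart_inv)
  ultimately show ?thesis by simp
qed

lemma cpushforward_tangent:
  "q \<in> V \<Longrightarrow> X \<in> ctangent_space M q \<Longrightarrow> cpushforward M N k q X \<in> ctangent_space N (k q)"
  by (auto simp: cpushforward_def ctangent_space_def K.pushforward_tangent)

text \<open>The chart of \<open>h\<close> reads \<phi> after \<open>k\<close> exactly as the chart
  of \<open>g ** h\<close> reads \<open>f\<close>, so the chain rule identifies the differentials.
  Outside the chart domains both sides are zero by convention.\<close>

lemma Jpushforward_translate:
  assumes q: "q \<in> V" and X: "X \<in> ctangent_space M q" and h: "h \<in> SL3"
  shows "Jpushforward N F_atlas \<phi> (k q) (cpushforward M N k q X) (flag_chart h) = Jpushforward M F_atlas f q X (flag_chart (g ** h))"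
proof -
  have gh: "g ** h \<in> SL3" using g h by (auto simp: SL3_def det_mul)
  have qU: "q \<in> U" using q V by blast
  note act = flag_chart_act[OF SL3_det[OF g] SL3_det[OF h]]
  have iff: "flag_chart (g ** h) \<in> charts_at F_atlas (f q) \<longleftrightarrow> flag_chart h \<in> charts_at F_atlas (\<phi> (k q))"
    using k[OF q] act(1) gh h by (auto simp: charts_at_def flag_atlas_eq)
  show ?thesis
  proof (cases "flag_chart h \<in> charts_at F_atlas (\<phi> (k q))")
    case False
    then show ?thesis using iff by (simp add: Jpushforward_def pushforward_outside)
  next
    case True
    let ?d = "flag_chart h" and ?d' = "flag_chart (g ** h)"
    obtain c where c: "c \<in> charts_at M q"
      using q openin_subset[OF V(1)] by (auto simp: topspace_mtop charts_at_def)
    obtain e where e: "e \<in> charts_at N (k q)"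
      using k[OF q] by (auto simp: topspace_mtop charts_at_def)
    have ce: "c \<in> M" "q \<in> fst c" "e \<in> N" "k q \<in> fst e" using c e by (auto simp: charts_at_def)
    have p: "pushforward N F_atlas \<phi> (k q) (pushforward M N k q v) ?d = tderiv c (snd ?d' \<circ> f) q (v c)"
      if v: "v \<in> tangent_space M q" for v
    proof -
      have "pushforward N F_atlas \<phi> (k q) (pushforward M N k q v) ?d = tderiv e (snd ?d \<circ> \<phi>) (k q) (pushforward M N k q v e)"
        by (rule N.pushforward_chart[OF e K.pushforward_tangent[OF q v] True phi_differentiable[OF e True]])
      also have "\<dots> = tderiv e (snd ?d \<circ> \<phi>) (k q) (tderiv c (snd e \<circ> k) q (v c))"
        by (simp only: K.pushforward_eq[OF q c e v])
      also have "\<dots> = tderiv c ((snd ?d \<circ> \<phi>) \<circ> k) q (v c)"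
        by (rule K.chart_change_target(2)[OF q c e phi_differentiable[OF e True], symmetric])
      also have "\<dots> = tderiv c (snd ?d' \<circ> f) q (v c)"
      proof -
        have D: "(((snd ?d \<circ> \<phi>) \<circ> k \<circ> chart_inv c) has_derivative tderiv c ((snd ?d \<circ> \<phi>) \<circ> k) q) (at (snd c q))"
          using K.chart_change_target(1)[OF q c e phi_differentiable[OF e True]] by (simp add: frechet_derivative_works)
        have S: "open (snd c ` (fst c \<inter> V))" by (rule M.open_chart_image[OF V(1) ce(1)])
        have "((snd ?d' \<circ> f \<circ> chart_inv c) has_derivative tderiv c ((snd ?d \<circ> \<phi>) \<circ> k) q) (at (snd c q))"
        proof (rule has_derivative_transform_within_open[OF D S])
          show "snd c q \<in> snd c ` (fst c \<inter> V)" using q ce by blast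
          fix a assume "a \<in> snd c ` (fst c \<inter> V)"
          then obtain r where r: "r \<in> V" "r \<in> fst c" "a = snd c r" by blast
          show "(snd ?d \<circ> \<phi> \<circ> k \<circ> chart_inv c) a = (snd ?d' \<circ> f \<circ> chart_inv c) a"
            using k[OF r(1)] r ce act(2)[of "\<phi> (k r)"] by simp
        qed
        from fun_cong[OF frechet_derivative_at[OF this], of "v c"] show ?thesis by (simp only: o_assoc)
      qed
      finally show ?thesis .
    qed
    have "Jpushforward N F_atlas \<phi> (k q) (cpushforward M N k q X) ?d = tderiv c (snd ?d' \<circ> f) q (fst X c) + \<i> *s tderiv c (snd ?d' \<circ> f) q (snd X c)"
      using X by (simp add: Jpushforward_def cpushforward_def ctangent_space_def p mem_Times_iff)
    also have "\<dots> = Jpushforward M F_atlas f q X ?d'"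
      by (rule Jpushforward_eq[symmetric, OF qU c _ X]) (use True iff in blast)
    finally show ?thesis .
  qed
qed

text \<open>This is the invariance of the line fields under translation: they are cut out by the
  same equations in corresponding charts, where both vectors have equal coordinates at the same
  parameter.\<close>

lemma induced_iff:
  assumes q: "q \<in> V" and X: "X \<in> ctangent_space M q"
  shows "Jpushforward N F_atlas \<phi> (k q) (cpushforward M N k q X) \<in> T1_F (\<phi> (k q)) \<longleftrightarrow> Jpushforward M F_atlas f q X \<in> T1_F (f q)"
    "Jpushforward N F_atlas \<phi> (k q) (cpushforward M N k q X) \<in> T2_F (\<phi> (k q)) \<longleftrightarrow> Jpushforward M F_atlas f q X \<in> T2_F (f q)"
proof -
  let ?w = "Jpushforward N F_atlas \<phi> (k q) (cpushforward M N k q X)" and ?w' = "Jpushforward M F_atlas f q X"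
  obtain e where e: "e \<in> N" "k q \<in> fst e"
    using k[OF q] by (auto simp: topspace_mtop)
  have gh: "g ** G e \<in> SL3" using g G(1)[OF e(1)] by (auto simp: SL3_def det_mul)
  have 1: "\<phi> (k q) = flag_param (G e) (\<iota> (snd e (k q)))" using G(2) e by blast
  have 2: "f q = flag_param (g ** G e) (\<iota> (snd e (k q)))"
    using k[OF q] 1 flag_act_param[OF SL3_det[OF g] det_G[OF e(1)]] by simp
  have w': "?w' \<in> tangent_space F_atlas (f q)" using bij[of q] q V X by (auto simp: bij_betw_def)
  have w: "?w \<in> tangent_space F_atlas (\<phi> (k q))"
  proof (rule tangent_space_translate[OF g])
    show "?w' \<in> tangent_space F_atlas (flag_act g (\<phi> (k q)))" using w' k[OF q] by simp
    show "?w (flag_chart h) = ?w' (flag_chart (g ** h))" if "h \<in> SL3" for h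
      by (rule Jpushforward_translate[OF q X that])
    show "?w c = 0" if "c \<notin> charts_at F_atlas (\<phi> (k q))" for c
      using that by (simp add: Jpushforward_def pushforward_outside)
  qed
  note eq = Jpushforward_translate[OF q X G(1)[OF e(1)]]
  show "?w \<in> T1_F (\<phi> (k q)) \<longleftrightarrow> ?w' \<in> T1_F (f q)"
    using w w' eq unfolding 1 2 T1_F_coordinates[OF G(1)[OF e(1)]] T1_F_coordinates[OF gh] by simp
  show "?w \<in> T2_F (\<phi> (k q)) \<longleftrightarrow> ?w' \<in> T2_F (f q)"
    using w w' eq unfolding 1 2 T2_F_coordinates[OF G(1)[OF e(1)]] T2_F_coordinates[OF gh] by simp
qed

text \<open>The injective derivative is onto because the dimensions agree; real and imaginary part
  are lifted separately.\<close>

lemma cpushforward_surj: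
  assumes q: "q \<in> V" and Y: "Y \<in> ctangent_space N (k q)"
  obtains X where "X \<in> ctangent_space M q" "cpushforward M N k q X = Y"
proof -
  obtain c where c: "c \<in> charts_at M q"
    using q openin_subset[OF V(1)] by (auto simp: topspace_mtop charts_at_def)
  obtain e where e: "e \<in> charts_at N (k q)"
    using k[OF q] by (auto simp: topspace_mtop charts_at_def)
  have "inj (tderiv c (snd e \<circ> k) q)"
    using k_derivative_injective[OF q c e] linear_injective_0[OF K.linear_tderiv[OF q c e]] by blast
  then have s: "surj (tderiv c (snd e \<circ> k) q)"
    using linear_injective_imp_surjective[OF K.linear_tderiv[OF q c e]] by blast
  have "\<exists>v. v \<in> tangent_space M q \<and> pushforward M N k q v = w" if w: "w \<in> tangent_space N (k q)" for w
  proof -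
    obtain u where u: "tderiv c (snd e \<circ> k) q u = w e" using s by (metis surjD)
    obtain v where v: "v \<in> tangent_space M q" "v c = u" using M.tangent_space_obtain[OF c] .
    have "pushforward M N k q v = w"
      by (rule N.tangent_space_eqI[OF K.pushforward_tangent[OF q v(1)] w e])
        (simp only: K.pushforward_eq[OF q c e v(1)] v(2) u)
    then show ?thesis using v by blast
  qed
  then obtain v1 v2 where "v1 \<in> tangent_space M q" "pushforward M N k q v1 = fst Y" "v2 \<in> tangent_space M q" "pushforward M N k q v2 = snd Y"
    using Y by (metis ctangent_space_def mem_Times_iff)
  then show thesis by (intro that[of "(v1, v2)"]) (auto simp: ctangent_space_def cpushforward_def)
qed

text \<open>One inclusion is \<open>induced_iff\<close>. For the other, a vector of the induced line
  is lifted by \<open>cpushforward_surj\<close>, and injectivity of \<open>Jpushforward\<close> puts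
  the lift into \<open>T\<close>.\<close>

lemma cpushforward_induced:
  assumes q: "q \<in> V" and T: "T \<subseteq> ctangent_space M q"
  shows "Jpushforward M F_atlas f q ` T = T1_F (f q) \<Longrightarrow> cpushforward M N k q ` T = induced N \<phi> T1_F (k q)"
    "Jpushforward M F_atlas f q ` T = T2_F (f q) \<Longrightarrow> cpushforward M N k q ` T = induced N \<phi> T2_F (k q)"
proof -
  have J: "inj_on (Jpushforward M F_atlas f q) (ctangent_space M q)" using bij[of q] q V by (auto simp: bij_betw_def)
  have *: "cpushforward M N k q ` T = induced N \<phi> TF (k q)"
    if im: "Jpushforward M F_atlas f q ` T = TF (f q)" and
      iff: "\<And>X. X \<in> ctangent_space M q \<Longrightarrow> Jpushforward N F_atlas \<phi> (k q) (cpushforward M N k q X) \<in> TF (\<phi> (k q)) \<longleftrightarrow> Jpushforward M F_atlas f q X \<in> TF (f q)" for TF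
  proof (intro equalityI subsetI)
    fix Y assume "Y \<in> cpushforward M N k q ` T"
    then obtain X where X: "X \<in> T" "Y = cpushforward M N k q X" by blast
    then show "Y \<in> induced N \<phi> TF (k q)"
      using iff[of X] T im cpushforward_tangent[OF q, of X] by (auto simp: induced_def)
  next
    fix Y assume Y: "Y \<in> induced N \<phi> TF (k q)"
    then have "Y \<in> ctangent_space N (k q)" by (simp add: induced_def)
    then obtain X where X: "X \<in> ctangent_space M q" "cpushforward M N k q X = Y"
      using cpushforward_surj[OF q] by blast
    then have "Jpushforward M F_atlas f q X \<in> Jpushforward M F_atlas f q ` T"
      using iff[OF X(1)] Y im by (simp add: induced_def)
    then have "X \<in> T" using J T X(1) by (auto simp: inj_on_def)
    then show "Y \<in> cpushforward M N k q ` T" using X by blast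
  qed
  show "Jpushforward M F_atlas f q ` T = T1_F (f q) \<Longrightarrow> cpushforward M N k q ` T = induced N \<phi> T1_F (k q)"
    by (rule *[OF _ induced_iff(1)[OF q]])
  show "Jpushforward M F_atlas f q ` T = T2_F (f q) \<Longrightarrow> cpushforward M N k q ` T = induced N \<phi> T2_F (k q)"
    by (rule *[OF _ induced_iff(2)[OF q]])
qed

end

section \<open>The two models\<close>

definition S3_vec :: "real^3 \<Rightarrow> complex^3" where
  "S3_vec a = vector [Complex (- ((a$1)\<^sup>2 + (a$2)\<^sup>2) / 2) (a$3), Complex (a$1) (a$2), 1]"

definition herm_form :: "complex^3 \<Rightarrow> complex^3" where
  "herm_form z = vector [cnj (z$3), cnj (z$2), cnj (z$1)]"

lemma S3_vec_nth [simp]: "S3_vec a $ 1 = Complex (- ((a$1)\<^sup>2 + (a$2)\<^sup>2) / 2) (a$3)" "S3_vec a $ 2 = Complex (a$1) (a$2)" "S3_vec a $ 3 = 1"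
  by (simp_all add: S3_vec_def)

lemma herm_form_nth [simp]: "herm_form z $ 1 = cnj (z$3)" "herm_form z $ 2 = cnj (z$2)" "herm_form z $ 3 = cnj (z$1)"
  by (simp_all add: herm_form_def)

lemma S3_param_eq: "S3_param g a = line (g *v S3_vec a)"
  by (simp add: S3_param_def proj_act_line S3_vec_def)

lemma herm_form_dot: "(\<Sum>i\<in>UNIV. herm_form w $ i * v $ i) = herm v w"
  by (simp add: herm_eq sum_3 mult.commute)

lemma phi_CR_line: "phi_CR (line z) = (line z, line (herm_form z))"
proof -
  have f: "(\<chi> i. herm (axis i 1) x) = herm_form x" for x
    by (simp add: vec_eq_iff forall_3 herm_eq axis_def)
  have s: "herm_form (d *s z) = cnj d *s herm_form z" for d by (simp add: vec_eq_iff forall_3)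
  have "{c *s herm_form x | c x. x \<in> line z} = line (herm_form z)"
  proof (intro equalityI subsetI)
    fix y assume "y \<in> {c *s herm_form x | c x. x \<in> line z}"
    then obtain c d where "y = c *s herm_form (d *s z)" by (auto simp: line_def)
    then show "y \<in> line (herm_form z)" by (auto simp: s line_def)
  next
    fix y assume "y \<in> line (herm_form z)"
    then obtain c where "y = c *s herm_form z" by (auto simp: line_def)
    then show "y \<in> {c *s herm_form x | c x. x \<in> line z}" using in_line by blast
  qed
  then show ?thesis by (simp add: phi_CR_def f)
qed

text \<open>Heisenberg coordinates normalise the third entry of a point and flag charts the first.
  This matrix exchanges them; the signs make it unimodular.\<close>

definition antidiag :: "complex^3^3" where
  "antidiag = vector [vector [0, 0, -1], vector [0, -1, 0], vector [-1, 0, 0]]"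

text \<open>Flag parameters of the Heisenberg point with its polar form: the affine coordinates of
  the point in reverse order, and minus the conjugate of its second entry.\<close>

definition S3_iota :: "real^3 \<Rightarrow> complex^3" where
  "S3_iota a = vector [Complex (a$1) (a$2), Complex (- ((a$1)\<^sup>2 + (a$2)\<^sup>2) / 2) (a$3), - Complex (a$1) (- (a$2))]"

definition S3_pi :: "complex^3 \<Rightarrow> real^3" where
  "S3_pi b = vector [Re (b$1), Im (b$1), Im (b$2)]"

text \<open>Testing the invariance of the Hermitian form on basis vectors gives the transformation
  of polar forms; its nondegeneracy gives invertibility.\<close>

lemma unitary_herm_form:
  assumes "\<forall>z w. herm (h *v z) (h *v w) = herm z w"
  shows "herm_form (h *v z) v* h = herm_form z" "det h \<noteq> 0"
proof -
  have ax: "(h *v axis i 1) $ j = h $ j $ i" for i j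
    by (simp add: matrix_vector_mult_def axis_def if_distrib[of "\<lambda>t. _ * t"] cong: if_cong)
  show "herm_form (h *v z) v* h = herm_form z"
  proof (subst vec_eq_iff, rule allI)
    fix i
    have "(herm_form (h *v z) v* h) $ i = (\<Sum>j\<in>UNIV. herm_form (h *v z) $ j * (h *v axis i 1) $ j)"
      by (simp add: vector_matrix_mult_def ax mult.commute)
    also have "\<dots> = herm (axis i 1) z" unfolding herm_form_dot using assms by simp
    also have "\<dots> = herm_form z $ i" using exhaust_3[of i] by (auto simp: herm_eq axis_def)
    finally show "(herm_form (h *v z) v* h) $ i = herm_form z $ i" .
  qed
  have "w = 0" if "h *v w = 0" for w
  proof -
    have "herm w v = 0" for v using assms that by (metis (no_types) herm_eq mult_zero_left add_0 zero_index)
    then have "herm w (axis i 1) = 0" for i by blast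
    from this[of 1] this[of 2] this[of 3] show ?thesis
      by (simp add: herm_eq axis_def vec_eq_iff forall_3)
  qed
  then have "\<exists>B. B ** h = mat 1" by (simp add: matrix_left_invertible_ker)
  then obtain B where "B ** h = mat 1" ..
  then have "det B * det h = 1" by (metis det_I det_mul)
  then show "det h \<noteq> 0" by auto
qed

lemma det_antidiag: "det antidiag = 1" and inv_antidiag: "matrix_inv antidiag = antidiag"
proof -
  show "det antidiag = 1" by (simp add: antidiag_def det_3)
  show "matrix_inv antidiag = antidiag"
    by (rule matrix_inv_eqI) (simp add: vec_eq_iff forall_3 antidiag_def matrix_matrix_mult_def sum_3 mat_def)
qed

text \<open>Isometries commute with taking polar forms, so the computation takes place at the
  Heisenberg vector itself; the common signs disappear in \<open>line\<close>.\<close>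

lemma phi_CR_param:
  assumes h: "\<forall>z w. herm (h *v z) (h *v w) = herm z w"
  shows "phi_CR (S3_param h a) = flag_param (h ** antidiag) (S3_iota a)"
proof -
  note u = unitary_herm_form[OF h]
  have d: "det antidiag \<noteq> 0" by (simp add: det_antidiag)
  have 1: "antidiag *v flag_point (S3_iota a) = (- 1) *s S3_vec a"
    by (simp add: vec_eq_iff forall_3 antidiag_def matrix_vector_mult_def sum_3 S3_iota_def)
  have 2: "flag_form (S3_iota a) v* antidiag = (- 1) *s herm_form (S3_vec a)"
    by (simp add: vec_eq_iff forall_3 antidiag_def vector_matrix_mult_def sum_3 S3_iota_def complex_eq_iff power2_eq_square field_simps)
  have "herm_form (h *v S3_vec a) = (herm_form (h *v S3_vec a) v* h) v* matrix_inv h"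
    by (simp add: vector_matrix_mul_assoc matrix_inv_det[OF u(2)])
  then have 3: "herm_form (h *v S3_vec a) = herm_form (S3_vec a) v* matrix_inv h" unfolding u .
  have "(h ** antidiag) *v flag_point (S3_iota a) = (- 1) *s (h *v S3_vec a)"
    by (simp only: matrix_vector_mul_assoc[symmetric] 1 vector_scalar_commute)
  moreover have "flag_form (S3_iota a) v* matrix_inv (h ** antidiag) = (- 1) *s herm_form (h *v S3_vec a)"
    by (simp only: matrix_inv_mult[OF u(2) d] inv_antidiag vector_matrix_mul_assoc[symmetric] 2 3 vector_matrix_scale)
  ultimately have "flag_param (h ** antidiag) (S3_iota a) = (line ((- 1) *s (h *v S3_vec a)), line ((- 1) *s herm_form (h *v S3_vec a)))"
    by (simp only: flag_param_eq)
  also have "\<dots> = (line (h *v S3_vec a), line (herm_form (h *v S3_vec a)))"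
    by (subst (1 2) line_scale) simp_all
  finally show ?thesis by (simp add: S3_param_eq phi_CR_line)
qed

lemma S3_pi_iota: "S3_pi (S3_iota a) = a"
  by (simp add: S3_pi_def S3_iota_def vec_eq_iff forall_3)

text \<open>Moved back by \<open>h\<close> and by the scalar \<open>c\<close>, the point is an
  isotropic vector with last entry - 1. Isotropy fixes the real part of its first entry, and what
  remains are Heisenberg coordinates.\<close>

lemma flag_chart_S3:
  assumes h: "\<forall>z w. herm (h *v z) (h *v w) = herm z w"
    and L: "L \<in> S3" "phi_CR L \<in> range (flag_param (h ** antidiag))"
  shows "L \<in> range (S3_param h)"
proof -
  note u = unitary_herm_form[OF h]
  obtain z where z: "L = line z" "z \<noteq> 0" "herm z z = 0"
    using L(1) by (auto simp: S3_def herm_eq algebra_simps)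
  obtain b where "phi_CR L = flag_param (h ** antidiag) b" using L(2) by auto
  then have "line z = line ((h ** antidiag) *v flag_point b)" by (simp add: z phi_CR_line flag_param_eq)
  then obtain c where c: "c \<noteq> 0" "z = c *s ((h ** antidiag) *v flag_point b)" using line_eqD z(2) by blast
  define w where "w = antidiag *v flag_point b"
  have zw: "z = c *s (h *v w)" unfolding c(2) w_def by (simp add: matrix_vector_mul_assoc)
  have "herm (c *s v) (c *s v) = c * cnj c * herm v v" for v by (simp add: herm_eq algebra_simps)
  then have "herm (h *v w) (h *v w) = 0" using z(3) c(1) unfolding zw by simp
  then have "herm w w = 0" using h by simp
  moreover have w: "w $ 1 = - b $ 2" "w $ 2 = - b $ 1" "w $ 3 = - 1"
    by (simp_all add: w_def antidiag_def matrix_vector_mult_def sum_3)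
  ultimately have "Re (b $ 2) = - ((Re (b $ 1))\<^sup>2 + (Im (b $ 1))\<^sup>2) / 2"
    by (simp add: herm_eq complex_eq_iff power2_eq_square)
  then have "w = (- 1) *s S3_vec (S3_pi b)"
    using w by (simp add: vec_eq_iff forall_3 S3_pi_def complex_eq_iff)
  then have "z = (- c) *s (h *v S3_vec (S3_pi b))" unfolding zw by (simp add: vector_scalar_commute vec_eq_iff matrix_vector_mult_def sum_negf)
  then have "L = S3_param h (S3_pi b)" using c(1) line_scale[of "- c"] unfolding z(1) S3_param_eq by simp
  then show ?thesis by simp
qed

lemma smooth_on_Complex:
  assumes "smooth_on UNIV u" "smooth_on UNIV v"
  shows "smooth_on UNIV (\<lambda>a. Complex (u a) (v a))"
  unfolding Complex_eq
  by (intro smooth_on_add smooth_on_mult smooth_on_const smooth_on_linear[OF _ bounded_linear_of_real] assms open_UNIV)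

lemma model_S3: "model S3_atlas phi_CR S3_iota S3_pi"
proof (rule model.intro)
  show "smooth_on UNIV S3_iota"
  proof (rule smooth_on_vec[OF open_UNIV])
    have n: "smooth_on UNIV (\<lambda>a::real^3. a $ j)" for j by (rule smooth_on_nth[OF open_UNIV smooth_on_ident[OF open_UNIV]])
    have 1: "smooth_on UNIV (\<lambda>a::real^3. Complex (a$1) (a$2))" by (intro smooth_on_Complex n)
    have 2: "smooth_on UNIV (\<lambda>a::real^3. Complex (- ((a$1)\<^sup>2 + (a$2)\<^sup>2) / 2) (a$3))"
      unfolding power2_eq_square
      by (intro smooth_on_Complex smooth_on_divide smooth_on_minus smooth_on_add smooth_on_mult smooth_on_const n open_UNIV) simp
    have 3: "smooth_on UNIV (\<lambda>a::real^3. - Complex (a$1) (- (a$2)))"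
      by (intro smooth_on_minus smooth_on_Complex n open_UNIV)
    show "smooth_on UNIV (\<lambda>a. S3_iota a $ i)" for i
      using exhaust_3[of i] 1 2 3 by (elim disjE) (simp_all only: S3_iota_def vector_3)
  qed
  show "bounded_linear S3_pi"
    unfolding linear_conv_bounded_linear[symmetric]
    by (rule linearI) (simp_all add: S3_pi_def vec_eq_iff forall_3)
  show "S3_pi (S3_iota a) = a" for a by (rule S3_pi_iota)
  fix e assume "e \<in> S3_atlas"
  then obtain h where h: "\<forall>z w. herm (h *v z) (h *v w) = herm z w" and e: "e = (range (S3_param h), inv (S3_param h))"
    by (auto simp: S3_atlas_def)
  have "det (h ** antidiag) \<noteq> 0" using unitary_herm_form(2)[OF h] by (simp add: det_mul det_antidiag)
  \<comment> \<open>Isometries may have a determinant other than 1, so the matrix is rescaled into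
    \<open>SL3\<close>, which leaves \<open>flag_param\<close> unchanged.\<close>
  then obtain G \<mu> where G: "G \<in> SL3" "\<mu> \<noteq> 0" "G = (\<chi> i j. \<mu> * (h ** antidiag) $ i $ j)" by (rule SL3_scale)
  have fG: "flag_param G = flag_param (h ** antidiag)"
    unfolding G(3) by (rule flag_param_scale) fact+
  have inj: "inj (S3_param h)"
  proof (rule injI)
    fix a b assume "S3_param h a = S3_param h b"
    then have "flag_param G (S3_iota a) = flag_param G (S3_iota b)" by (metis phi_CR_param[OF h] fG)
    then have "S3_iota a = S3_iota b" using inj_flag_param[OF SL3_det[OF G(1)]] by (simp add: inj_eq)
    then show "a = b" by (metis S3_pi_iota)
  qed
  then show "inj_on (snd e) (fst e) \<and> snd e ` fst e = UNIV"
    by (simp add: e inj_on_inv_into image_image)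
  show "\<exists>G\<in>SL3. (\<forall>x\<in>fst e. phi_CR x = flag_param G (S3_iota (snd e x))) \<and>
      (\<forall>x\<in>topspace (mtop S3_atlas). phi_CR x \<in> range (flag_param G) \<longrightarrow> x \<in> fst e)"
    using G(1) inj phi_CR_param[OF h] flag_chart_S3[OF h]
    by (intro bexI[of _ G]) (auto simp: e fG topspace_S3_atlas)
qed

section \<open>The real flags inside the complex flags\<close>

definition real_vec :: "real^3 \<Rightarrow> complex^3" where "real_vec v = (\<chi> i. of_real (v $ i))"
definition real_mat :: "real^3^3 \<Rightarrow> complex^3^3" where "real_mat A = (\<chi> i j. of_real (A $ i $ j))"

lemma real_vec_nth [simp]: "real_vec v $ i = of_real (v $ i)" and real_mat_nth [simp]: "real_mat A $ i $ j = of_real (A $ i $ j)"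
  by (simp_all add: real_vec_def real_mat_def)

lemma real_vec_mult: "real_vec (A *v z) = real_mat A *v real_vec z" "real_vec (z v* A) = real_vec z v* real_mat A"
  by (simp_all add: vec_eq_iff matrix_vector_mult_def vector_matrix_mult_def)

lemma real_mat_mult: "real_mat (A ** B) = real_mat A ** real_mat B"
  by (simp add: vec_eq_iff matrix_matrix_mult_def)

lemma det_real_mat: "det (real_mat A) = of_real (det A)"
  by (simp add: det_3)

lemma real_mat_inv: "det A \<noteq> 0 \<Longrightarrow> matrix_inv (real_mat A) = real_mat (matrix_inv A)"
  by (rule matrix_inv_eqI) (simp add: real_mat_mult[symmetric] matrix_inv_det vec_eq_iff mat_def)

lemma complexify_line_eq: "complexify_line (line r) = line (real_vec r)"
proof (intro equalityI subsetI)
  fix y assume "y \<in> complexify_line (line r)"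
  then obtain c d where "y = c *s (\<chi> i. of_real ((d *s r) $ i))" by (auto simp: complexify_line_def line_def)
  then have "y = (c * of_real d) *s real_vec r" by (simp add: vec_eq_iff)
  then show "y \<in> line (real_vec r)" by (auto simp: line_def)
next
  fix y assume "y \<in> line (real_vec r)"
  then obtain c where "y = c *s (\<chi> i. of_real (r $ i))" by (auto simp: line_def real_vec_def)
  then show "y \<in> complexify_line (line r)" using in_line unfolding complexify_line_def by blast
qed

lemma phi_R_line: "phi_R (line z, line l) = (line (real_vec z), line (real_vec l))"
  by (simp add: phi_R_def complexify_line_eq)

lemma phi_R_param:
  assumes "det h \<noteq> 0"
  shows "phi_R (flag_param h b) = flag_param (real_mat h) (real_vec b)"
proof -
  have "real_vec (flag_point b) = flag_point (real_vec b)" "real_vec (flag_form b) = flag_form (real_vec b)" by (simp_all add: vec_eq_iff forall_3)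
  then show ?thesis by (simp add: flag_param_eq phi_R_line real_vec_mult real_mat_inv[OF assms])
qed

lemma real_vec_eq_0: "real_vec z = 0 \<longleftrightarrow> z = 0"
  by (simp add: vec_eq_iff)

lemma model_FR: "model FR_atlas phi_R real_vec (\<lambda>b. \<chi> i. Re (b $ i))"
proof (rule model.intro)
  show "smooth_on UNIV real_vec"
    by (rule smooth_on_vec[OF open_UNIV])
      (simp add: smooth_on_linear[OF open_UNIV bounded_linear_of_real] smooth_on_nth[OF open_UNIV smooth_on_ident[OF open_UNIV]])
  show "bounded_linear (\<lambda>b::complex^3. \<chi> i. Re (b $ i))"
    unfolding linear_conv_bounded_linear[symmetric]
    by (rule linearI) (simp_all add: vec_eq_iff)
  show "(\<chi> i. Re (real_vec a $ i)) = a" for a by (simp add: vec_eq_iff)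
  fix e :: "(rflag, real^3) chart" assume "e \<in> flag_atlas"
  then obtain h where h: "h \<in> SL3" and e: "e = flag_chart h" by (auto simp: flag_atlas_eq)
  note dh = SL3_det[OF h]
  have dG: "det (real_mat h) \<noteq> 0" using dh by (simp add: det_real_mat)
  show "inj_on (snd e) (fst e) \<and> snd e ` fst e = UNIV"
    unfolding e flag_chart_simps(4)[OF dh] by (simp add: flag_chart_def inj_on_inv_into)
  have "x \<in> fst e" if x: "x \<in> flag_space" and r: "phi_R x \<in> range (flag_param (real_mat h))" for x
  proof -
    obtain z l where zl: "x = (line z, line l)" "z \<noteq> 0" "l \<noteq> 0" "(\<Sum>i\<in>UNIV. l $ i * z $ i) = 0"
      using x by (auto simp: flag_space_def)
    have "(\<Sum>i\<in>UNIV. real_vec l $ i * real_vec z $ i) = of_real (\<Sum>i\<in>UNIV. l $ i * z $ i)" by simp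
    then have zl': "real_vec z \<noteq> 0" "real_vec l \<noteq> 0" "(\<Sum>i\<in>UNIV. real_vec l $ i * real_vec z $ i) = 0" using zl by (simp_all add: real_vec_eq_0)
    obtain b where "flag_param (real_mat h) b = (line (real_vec z), line (real_vec l))" using r by (auto simp: zl(1) phi_R_line)
    then have "(matrix_inv (real_mat h) *v real_vec z) $ 1 \<noteq> 0 \<and> (real_vec l v* real_mat h) $ 3 \<noteq> 0"
      unfolding flag_coordinates[OF dG zl'] by blast
    \<comment> \<open>Membership in a chart depends on two entries being nonzero, and
      complexification leaves these real numbers unchanged.\<close>
    then have "(matrix_inv h *v z) $ 1 \<noteq> 0 \<and> (l v* h) $ 3 \<noteq> 0"
      unfolding real_mat_inv[OF dh] real_vec_mult[symmetric] by simp
    then have "\<exists>a. flag_param h a = (line z, line l)"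
      unfolding flag_coordinates[OF dh zl(2-4)] by blast
    then show ?thesis unfolding e flag_chart_def zl(1) by (metis fst_conv rangeI)
  qed
  moreover have "phi_R x = flag_param (real_mat h) (real_vec (snd e x))" if x: "x \<in> fst e" for x
  proof -
    obtain b where "x = flag_param h b" using x by (auto simp: e flag_chart_def)
    then show ?thesis by (simp add: phi_R_param[OF dh] e flag_chart_simps[OF dh])
  qed
  moreover have "real_mat h \<in> SL3" using h by (simp add: SL3_def det_real_mat)
  ultimately show "\<exists>G\<in>SL3. (\<forall>x\<in>fst e. phi_R x = flag_param G (real_vec (snd e x))) \<and>
      (\<forall>x\<in>topspace (mtop flag_atlas). phi_R x \<in> range (flag_param G) \<longrightarrow> x \<in> fst e)"
    unfolding topspace_flag_atlas by blast
qed

section \<open>From the normal forms to the models\<close>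

lemma flag_param_base_point:
  assumes "x \<in> (flag_space :: cflag set)"
  obtains g where "g \<in> SL3" "x = flag_param g 0"
proof -
  have "x \<in> topspace (mtop F_atlas)" using assms by (simp add: topspace_flag_atlas)
  then obtain g a where g: "g \<in> SL3" and x: "x = flag_param g a"
    by (auto simp: topspace_mtop flag_atlas_def)
  \<comment> \<open>The lower unipotent matrix that carries the flag with parameter 0 to the one
    with parameter \<open>a\<close>; composing with it recentres the chart.\<close>
  define n :: "complex^3^3" where "n = vector [vector [1, 0, 0], vector [a $ 1, 1, 0], vector [a $ 2, a $ 3, 1]]"
  have dn: "det n = 1" by (simp add: n_def det_3)
  have "matrix_inv n = vector [vector [1, 0, 0], vector [- a $ 1, 1, 0], vector [a $ 1 * a $ 3 - a $ 2, - a $ 3, 1]]"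
    by (rule matrix_inv_eqI) (simp add: vec_eq_iff forall_3 n_def matrix_matrix_mult_def sum_3 mat_def algebra_simps)
  then have "flag_form 0 v* matrix_inv n = flag_form a"
    by (simp add: vec_eq_iff forall_3 vector_matrix_mult_def sum_3)
  moreover have "n *v flag_point 0 = flag_point a"
    by (simp add: vec_eq_iff forall_3 matrix_vector_mult_def sum_3 n_def)
  ultimately have "flag_param n 0 = (line (flag_point a), line (flag_form a))" by (simp add: flag_param_eq)
  then have "flag_act g (flag_param n 0) = x" by (simp add: x flag_param_def flag_point_def flag_form_def)
  then have "x = flag_param (g ** n) 0"
    using flag_act_param[OF SL3_det[OF g], of n] dn by simp
  moreover have "g ** n \<in> SL3" using g dn by (simp add: SL3_def det_mul)
  ultimately show thesis using that by blast
qed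

context real_embedding begin

text \<open>The flag chart is centred at \<open>f p\<close>, so that the base point has coordinates
  0, as both normal forms require.\<close>

lemma local_frame:
  assumes p: "p \<in> U"
  obtains c g W where "c \<in> charts_at M p" "g \<in> SL3" "f p = flag_param g 0"
    "complex_frame W (snd (flag_chart g) \<circ> f \<circ> chart_inv c)" "snd c p \<in> W"
    "W \<subseteq> snd c ` (U \<inter> fst c \<inter> f -` range (flag_param g))"
proof -
  have "f p \<in> flag_space" using f_topspace[OF p] by (simp add: topspace_flag_atlas)
  then obtain g where g: "g \<in> SL3" "f p = flag_param g 0" by (rule flag_param_base_point)
  obtain c where c: "c \<in> charts_at M p"
    using p openin_subset[OF U] by (auto simp: topspace_mtop charts_at_def)
  have c': "c \<in> M" "p \<in> fst c" using c by (auto simp: charts_at_def)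
  let ?d = "flag_chart g"
  let ?F = "snd ?d \<circ> f \<circ> chart_inv c"
  let ?S = "snd c ` (U \<inter> fst c \<inter> f -` fst ?d)"
  have d: "?d \<in> F_atlas" using g by (auto simp: flag_atlas_eq)
  have "snd c p \<in> ?S" using p c' g by (auto simp: flag_chart_def)
  then obtain r where r: "r > 0" "ball (snd c p) r \<subseteq> ?S"
    using open_domain[OF c'(1) d] open_contains_ball by blast
  have "complex_frame (ball (snd c p) r) ?F"
  proof
    show "smooth_on (ball (snd c p) r) ?F"
      by (rule smooth_on_subset[OF smooth_local[OF c'(1) d] r(2)])
    fix m assume "m \<in> ball (snd c p) r"
    then obtain q where q: "q \<in> U" "q \<in> fst c" "f q \<in> fst ?d" "m = snd c q" using r(2) by blast
    then have "c \<in> charts_at M q" "?d \<in> charts_at F_atlas (f q)" using c' d by (auto simp: charts_at_def)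
    from jacobian_nonzero[OF q(1) this]
    show "det (\<chi> i j. frechet_derivative ?F (at m) (axis j 1) $ i) \<noteq> 0" unfolding q(4) .
  qed (use r in auto)
  moreover have "?S = snd c ` (U \<inter> fst c \<inter> f -` range (flag_param g))" by (simp add: flag_chart_def)
  ultimately show thesis using that[OF c g] r by auto
qed

text \<open>\<open>A\<close> moves the flags of \<open>f\<close>, read in the chart of
  \<open>g\<close>, into the model. Hence \<open>f\<close> is \<phi> translated by
  \<open>g ** matrix_inv A\<close>, once \<open>A\<close> has been rescaled to determinant
  1.\<close>

lemma local_model:
  assumes model: "model N \<phi> \<iota> \<pi>" and inj: "inj_on f U" and c: "c \<in> charts_at M p" and g: "g \<in> SL3"
    and W: "open W" "snd c p \<in> W" "W \<subseteq> snd c ` (U \<inter> fst c \<inter> f -` range (flag_param g))"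
    and A: "det A \<noteq> 0"
    and x: "\<And>q. q \<in> U \<Longrightarrow> q \<in> fst c \<Longrightarrow> snd c q \<in> W \<Longrightarrow> \<exists>x\<in>topspace (mtop N).
       \<phi> x = (line (A *v flag_point (snd (flag_chart g) (f q))), line (flag_form (snd (flag_chart g) (f q)) v* matrix_inv A))"
  shows "\<exists>V h k. p \<in> V \<and> model_embedding M U f N \<phi> \<iota> \<pi> h V k"
proof -
  have c': "c \<in> M" "p \<in> fst c" using c by (auto simp: charts_at_def)
  define V where "V = fst c \<inter> snd c -` W"
  have V: "openin (mtop M) V" unfolding V_def by (rule openin_mtop_chart[OF c'(1) W(1)])
  have VU: "q \<in> U \<and> f q \<in> range (flag_param g)" if q: "q \<in> V" for q
  proof -
    obtain r where "r \<in> U" "r \<in> fst c" "f r \<in> range (flag_param g)" "snd c q = snd c r"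
      using q W(3) unfolding V_def by blast
    then show ?thesis using M.chart_inj[OF c'(1)] q by (auto simp: V_def inj_on_def)
  qed
  obtain B \<mu> where B: "B \<in> SL3" "\<mu> \<noteq> 0" "B = (\<chi> i j. \<mu> * A $ i $ j)" by (rule SL3_scale[OF A])
  note dB = SL3_det[OF B(1)]
  define h where "h = g ** matrix_inv B"
  have h: "h \<in> SL3" using g B(1) by (simp add: h_def SL3_def det_mul det_matrix_inv)
  have "\<exists>x. x \<in> topspace (mtop N) \<and> f q = flag_act h (\<phi> x)" if q: "q \<in> V" for q
  proof -
    let ?a = "snd (flag_chart g) (f q)"
    have "q \<in> U" "q \<in> fst c" "snd c q \<in> W" using VU[OF q] q by (auto simp: V_def)
    from x[OF this] obtain y where y: "y \<in> topspace (mtop N)" "\<phi> y = (line (A *v flag_point ?a), line (flag_form ?a v* matrix_inv A))" by blast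
    obtain a where a: "f q = flag_param g a" using VU[OF q] by blast
    then have aa: "?a = a" by (simp add: flag_chart_simps SL3_det g)
    have "\<phi> y = flag_act A (line (flag_point a), line (flag_form a))" by (simp add: y aa flag_act_line)
    also have "\<dots> = flag_act B (line (flag_point a), line (flag_form a))"
      unfolding B(3) by (rule flag_act_scale[OF B(2) A, symmetric])
    finally have "flag_act h (\<phi> y) = flag_act (g ** matrix_inv B ** B) (line (flag_point a), line (flag_form a))"
      using flag_act_compose[OF SL3_det[OF h] dB] by (simp add: h_def)
    also have "g ** matrix_inv B ** B = g" by (simp add: matrix_inv_det dB flip: matrix_mul_assoc)
    also have "flag_act g (line (flag_point a), line (flag_form a)) = f q" by (simp add: a flag_param_def flag_point_def flag_form_def)
    finally show ?thesis using y(1) by metis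
  qed
  \<comment> \<open>A pointwise choice of points in the model is enough, since
    \<open>model_embedding\<close> supplies the regularity of \<open>k\<close>.\<close>
  then obtain k where k: "\<And>q. q \<in> V \<Longrightarrow> k q \<in> topspace (mtop N) \<and> f q = flag_act h (\<phi> (k q))" by metis
  have "model_embedding M U f N \<phi> \<iota> \<pi> h V k"
    using model inj V VU h k by (intro model_embedding.intro model_embedding_axioms.intro real_embedding_axioms) auto
  moreover have "p \<in> V" using c' W by (simp add: V_def)
  ultimately show ?thesis by blast
qed

end

lemma complex_line_bundle_tangent:
  assumes M: "smooth_manifold M" and T: "complex_line_bundle M T" and q: "q \<in> topspace (mtop M)"
  shows "T q \<subseteq> ctangent_space M q"
proof
  interpret atlas M by unfold_locales (rule smooth_manifold_atlas[OF M])
  obtain W X where W: "q \<in> W" "smooth_vector_field M W (\<lambda>q. fst (X q))" "smooth_vector_field M W (\<lambda>q. snd (X q))"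
    "\<forall>q\<in>W. X q \<noteq> czero \<and> T q = range (\<lambda>z. cscale z (X q))"
    using bspec[OF T[unfolded complex_line_bundle_def] q] by blast
  then have X: "fst (X q) \<in> tangent_space M q" "snd (X q) \<in> tangent_space M q"
    by (auto simp: smooth_vector_field_def)
  fix Y assume "Y \<in> T q"
  then obtain z where "Y = cscale z (X q)" using W(1,4) by auto
  then show "Y \<in> ctangent_space M q"
    using tangent_space_combination[OF X, of "Re z" "- Im z"] tangent_space_combination[OF X(2,1), of "Re z" "Im z"]
    by (simp add: cscale_def ctangent_space_def)
qed

lemma local_embedding_real:
  assumes M: "smooth_manifold M" and f: "local_embedding M T1 T2 U f"
  shows "real_embedding M U f" "inj_on f U"
proof -
  have tr: "openin (mtop M) U" "smooth_map M U F_atlas f" "embedding_map (subtopology (mtop M) U) (mtop F_atlas) f"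
    "\<forall>p\<in>U. bij_betw (Jpushforward M F_atlas f p) (ctangent_space M p) (tangent_space F_atlas (f p))"
    using f by (auto simp: local_embedding_def totally_real_embedding_def)
  show "real_embedding M U f"
    by unfold_locales (use tr smooth_manifold_atlas[OF M] smooth_atlas_flag in auto)
  have "topspace (subtopology (mtop M) U) = U" using openin_subset[OF tr(1)] by auto
  then show "inj_on f U"
    using tr(3) homeomorphic_imp_injective_map unfolding embedding_map_def by metis
qed

lemma CR_local_model:
  assumes M: "smooth_manifold M" and CR: "CR_structure M T1 T2" and f: "local_embedding M T1 T2 U f" and p: "p \<in> U"
  shows "\<exists>V h k. p \<in> V \<and> model_embedding M U f S3_atlas phi_CR S3_iota S3_pi h V k"
proof -
  interpret real_embedding M U f by (rule local_embedding_real[OF M f])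
  obtain c g W where c: "c \<in> charts_at M p" and g: "g \<in> SL3" "f p = flag_param g 0"
    and frame: "complex_frame W (snd (flag_chart g) \<circ> f \<circ> chart_inv c)" and W: "snd c p \<in> W"
    "W \<subseteq> snd c ` (U \<inter> fst c \<inter> f -` range (flag_param g))"
    by (rule local_frame[OF p])
  let ?F = "snd (flag_chart g) \<circ> f \<circ> chart_inv c"
  interpret C: complex_frame W ?F by (rule frame)
  have c': "c \<in> M" "p \<in> fst c" using c by (auto simp: charts_at_def)
  have fl: "complex_line_bundle M T1" "complex_line_bundle M T2" "\<And>q. q \<in> topspace (mtop M) \<Longrightarrow> T2 q = cconj ` T1 q"
    using CR by (auto simp: CR_structure_def flag_structure_def)
  have "\<exists>P Q \<tau>. frechet_derivative ?F (at m) P + \<i> *s frechet_derivative ?F (at m) Q = vector [0, 0, 1] \<and>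
     frechet_derivative ?F (at m) P - \<i> *s frechet_derivative ?F (at m) Q = \<tau> *s vector [1, ?F m $ 3, 0]" if "m \<in> W" for m
  proof -
    obtain q a where q: "q \<in> U" "q \<in> fst c" "f q = flag_param g a" "m = snd c q" using \<open>m \<in> W\<close> W(2) by blast
    have a: "?F m = a" using q c' by (simp add: flag_chart_simps SL3_det g)
    have qt: "q \<in> topspace (mtop M)" using q(1) openin_subset[OF U] by blast
    have "c \<in> charts_at M q" using c' q by (simp add: charts_at_def)
    note CR_pointwise = CR_pointwise[OF q(1) this g(1) q(3)]
    have "Jpushforward M F_atlas f q ` T1 q = T1_F (f q)" "Jpushforward M F_atlas f q ` T2 q = T2_F (f q)"
      using f q(1) unfolding local_embedding_def by blast+
    from CR_pointwise[OF complex_line_bundle_tangent[OF M fl(1) qt] complex_line_bundle_tangent[OF M fl(2) qt, unfolded fl(3)[OF qt]]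
        this[unfolded fl(3)[OF qt]]]
    show ?thesis unfolding a unfolding q(4) .
  qed
  moreover have "?F (snd c p) = 0" using c' g by (simp add: flag_chart_simps SL3_det)
  ultimately obtain W' A where W': "W' \<subseteq> W" "snd c p \<in> W'" "open W'" and A: "det A \<noteq> 0"
    "\<And>m. m \<in> W' \<Longrightarrow> \<exists>b. b \<noteq> 0 \<and> (transpose (cnjm A) ** J_mat ** A) *v C.point_vec m = b *s cnjv (C.form_vec m)"
    using C.CR_normal_form[OF _ W(1)] by blast
  have "\<exists>x\<in>topspace (mtop S3_atlas). phi_CR x = (line (A *v flag_point (snd (flag_chart g) (f q))), line (flag_form (snd (flag_chart g) (f q)) v* matrix_inv A))"
    if q: "q \<in> U" "q \<in> fst c" "snd c q \<in> W'" for q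
  proof -
    let ?a = "snd (flag_chart g) (f q)"
    have zl: "C.point_vec (snd c q) = flag_point ?a" "C.form_vec (snd c q) = flag_form ?a"
      using q c' by (simp_all add: C.point_vec_def C.form_vec_def flag_point_def flag_form_def)
    obtain b where b: "b \<noteq> 0" "(transpose (cnjm A) ** J_mat ** A) *v flag_point ?a = b *s cnjv (flag_form ?a)"
      using A(2)[OF q(3)] unfolding zl by blast
    have J: "herm_form w = cnjv (J_mat *v w)" for w
      by (simp add: vec_eq_iff forall_3 J_mat_def matrix_vector_mult_def sum_3)
    \<comment> \<open>By the normal form, the polar form of A z pulled back by \<open>A\<close> is a
      multiple of l. Thus the moved flag consists of a point and its polar form, and incidence of z
      and l makes A z isotropic.\<close>
    have "herm_form (A *v flag_point ?a) v* A = cnjv ((transpose (cnjm A) ** J_mat ** A) *v flag_point ?a)"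
      by (simp add: J cnjv_vmult flip: matrix_vector_mul_assoc)
    also have "\<dots> = cnj b *s flag_form ?a" unfolding b(2) cnjv_scale by simp
    finally have e: "herm_form (A *v flag_point ?a) v* A = cnj b *s flag_form ?a" .
    have "herm_form (A *v flag_point ?a) = (herm_form (A *v flag_point ?a) v* A) v* matrix_inv A"
      by (simp add: vector_matrix_mul_assoc matrix_inv_det A)
    then have "herm_form (A *v flag_point ?a) = cnj b *s (flag_form ?a v* matrix_inv A)" unfolding e by (simp only: vector_matrix_scale)
    then have "line (herm_form (A *v flag_point ?a)) = line (flag_form ?a v* matrix_inv A)" using b(1) by (simp add: line_scale)
    moreover have "line (A *v flag_point ?a) \<in> S3"
    proof -
      have "herm (A *v flag_point ?a) (A *v flag_point ?a) = (\<Sum>i\<in>UNIV. (herm_form (A *v flag_point ?a) v* A) $ i * flag_point ?a $ i)"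
        unfolding dot_vmult[symmetric] herm_form_dot ..
      also have "\<dots> = 0" unfolding e by (simp add: sum_3 algebra_simps)
      finally have "herm (A *v flag_point ?a) (A *v flag_point ?a) = 0" .
      moreover have "A *v flag_point ?a \<noteq> 0" using A(1) by (simp add: matrix_vector_eq_0 flag_point_flag_form)
      ultimately show ?thesis unfolding S3_def by (auto simp: herm_eq algebra_simps)
    qed
    ultimately show ?thesis by (intro bexI[of _ "line (A *v flag_point ?a)"]) (simp_all add: phi_CR_line topspace_S3_atlas)
  qed
  note x = this
  have "W' \<subseteq> snd c ` (U \<inter> fst c \<inter> f -` range (flag_param g))" using W'(1) W(2) by (rule order_trans)
  from local_model[OF model_S3 local_embedding_real(2)[OF M f] c g(1) W'(3,2) this A(1) x]
  show ?thesis .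
qed

text \<open>Dividing all entries by one nonzero entry cancels the factor \<open>b\<close> under
  conjugation, so the quotients are real.\<close>

lemma real_multiple:
  assumes "w \<noteq> 0" "cnjv w = b *s w"
  obtains \<rho> r where "\<rho> \<noteq> 0" "w = \<rho> *s real_vec r" "r \<noteq> 0"
proof -
  obtain i where i: "w $ i \<noteq> 0" using assms(1) by (auto simp: vec_eq_iff)
  have cw: "cnj (w $ j) = b * w $ j" for j using assms(2) by (metis cnjv_nth vector_smult_component)
  then have b: "b \<noteq> 0" using i by (metis complex_cnj_zero_iff mult_zero_left)
  have "cnj (w $ j / w $ i) = w $ j / w $ i" for j using b i by (simp add: cw)
  then have "of_real (Re (w $ j / w $ i)) = w $ j / w $ i" for j
    by (metis Reals_cnj_iff complex_is_Real_iff of_real_Re)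
  then have w: "w = (w $ i) *s real_vec (\<chi> j. Re (w $ j / w $ i))" using i by (simp add: vec_eq_iff)
  moreover have "(\<chi> j. Re (w $ j / w $ i)) \<noteq> 0" using w assms(1) by (metis real_vec_eq_0 vector_smult_rzero)
  ultimately show thesis using that i by blast
qed

lemma path_local_model:
  assumes M: "smooth_manifold M" and path: "path_structure M T1 T2" and f: "local_embedding M T1 T2 U f" and p: "p \<in> U"
  shows "\<exists>V h k. p \<in> V \<and> model_embedding M U f FR_atlas phi_R real_vec (\<lambda>b. \<chi> i. Re (b $ i)) h V k"
proof -
  interpret real_embedding M U f by (rule local_embedding_real[OF M f])
  obtain c g W where c: "c \<in> charts_at M p" and g: "g \<in> SL3" "f p = flag_param g 0"
    and frame: "complex_frame W (snd (flag_chart g) \<circ> f \<circ> chart_inv c)" and W: "snd c p \<in> W"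
    "W \<subseteq> snd c ` (U \<inter> fst c \<inter> f -` range (flag_param g))"
    by (rule local_frame[OF p])
  let ?F = "snd (flag_chart g) \<circ> f \<circ> chart_inv c"
  interpret C: complex_frame W ?F by (rule frame)
  have c': "c \<in> M" "p \<in> fst c" using c by (auto simp: charts_at_def)
  obtain L1 L2 where L: "real_line_bundle M L1" "real_line_bundle M L2"
    "\<And>q. q \<in> topspace (mtop M) \<Longrightarrow> T1 q = L1 q \<times> L1 q \<and> T2 q = L2 q \<times> L2 q"
    using path unfolding path_structure_def by blast
  \<comment> \<open>A generator of the real line, regarded as a complexified vector with imaginary
    part zero.\<close>
  have gen: "\<exists>X\<in>tangent_space M q. X \<noteq> (\<lambda>c. 0) \<and> (X, \<lambda>c. 0) \<in> L q \<times> L q"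
    if L: "real_line_bundle M L" and q: "q \<in> topspace (mtop M)" for L q
  proof -
    obtain V X where V: "q \<in> V" "smooth_vector_field M V X" "\<forall>q\<in>V. X q \<noteq> (\<lambda>c. 0) \<and> L q = range (\<lambda>r::real. (\<lambda>c. r *\<^sub>R X q c))"
      using bspec[OF L[unfolded real_line_bundle_def] q] by blast
    have "X q \<in> L q" "(\<lambda>c. 0) \<in> L q"
      using V(1,3) by (auto intro: rev_image_eqI[of 1] rev_image_eqI[of 0])
    then show ?thesis using V by (intro bexI[of _ "X q"]) (auto simp: smooth_vector_field_def)
  qed
  have "\<exists>P \<sigma> Q \<tau>. \<sigma> \<noteq> 0 \<and> \<tau> \<noteq> 0 \<and> frechet_derivative ?F (at m) P = \<sigma> *s vector [0, 0, 1] \<and>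
     frechet_derivative ?F (at m) Q = \<tau> *s vector [1, ?F m $ 3, 0]" if "m \<in> W" for m
  proof -
    obtain q a where q: "q \<in> U" "q \<in> fst c" "f q = flag_param g a" "m = snd c q" using \<open>m \<in> W\<close> W(2) by blast
    have a: "?F m = a" using q c' by (simp add: flag_chart_simps SL3_det g)
    have qt: "q \<in> topspace (mtop M)" using q(1) openin_subset[OF U] by blast
    have cq: "c \<in> charts_at M q" using c' q by (simp add: charts_at_def)
    obtain X1 X2 where X1: "X1 \<in> tangent_space M q" "X1 \<noteq> (\<lambda>c. 0)" "(X1, \<lambda>c. 0) \<in> T1 q"
      and X2: "X2 \<in> tangent_space M q" "X2 \<noteq> (\<lambda>c. 0)" "(X2, \<lambda>c. 0) \<in> T2 q"
      using gen[OF L(1) qt] gen[OF L(2) qt] L(3)[OF qt] by auto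
    have "Jpushforward M F_atlas f q (X1, \<lambda>c. 0) \<in> T1_F (f q)" "Jpushforward M F_atlas f q (X2, \<lambda>c. 0) \<in> T2_F (f q)"
      using f q(1) X1(3) X2(3) unfolding local_embedding_def by blast+
    from path_pointwise(1)[OF q(1) cq g(1) q(3) X1(1,2) this(1)] path_pointwise(2)[OF q(1) cq g(1) q(3) X2(1,2) this(2)]
    show ?thesis unfolding a unfolding q(4) by blast
  qed
  moreover have "?F (snd c p) = 0" using c' g by (simp add: flag_chart_simps SL3_det)
  ultimately obtain W' A where W': "W' \<subseteq> W" "snd c p \<in> W'" "open W'" and A: "det A \<noteq> 0"
    "\<And>m. m \<in> W' \<Longrightarrow> (\<exists>b. cnjv (A *v C.point_vec m) = b *s (A *v C.point_vec m)) \<and>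
       (\<exists>b. cnjv (C.form_vec m v* matrix_inv A) = b *s (C.form_vec m v* matrix_inv A))"
    using C.path_normal_form[OF _ W(1)] by blast
  have "\<exists>x\<in>topspace (mtop FR_atlas). phi_R x = (line (A *v flag_point (snd (flag_chart g) (f q))), line (flag_form (snd (flag_chart g) (f q)) v* matrix_inv A))"
    if q: "q \<in> U" "q \<in> fst c" "snd c q \<in> W'" for q
  proof -
    let ?a = "snd (flag_chart g) (f q)"
    have zl: "C.point_vec (snd c q) = flag_point ?a" "C.form_vec (snd c q) = flag_form ?a"
      using q c' by (simp_all add: C.point_vec_def C.form_vec_def flag_point_def flag_form_def)
    have 0: "A *v flag_point ?a \<noteq> 0" "flag_form ?a v* matrix_inv A \<noteq> 0"
      using A(1) by (simp_all add: matrix_vector_eq_0 det_matrix_inv flag_point_flag_form)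
    obtain b1 b2 where b: "cnjv (A *v flag_point ?a) = b1 *s (A *v flag_point ?a)" "cnjv (flag_form ?a v* matrix_inv A) = b2 *s (flag_form ?a v* matrix_inv A)"
      using A(2)[OF q(3)] unfolding zl by blast
    \<comment> \<open>Point and form are multiples of real vectors separately; cancelling the two
      factors leaves the incidence of these real vectors, hence a real flag.\<close>
    obtain \<rho> r where r: "\<rho> \<noteq> 0" "A *v flag_point ?a = \<rho> *s real_vec r" "r \<noteq> 0" by (rule real_multiple[OF 0(1) b(1)])
    obtain \<sigma> s where s: "\<sigma> \<noteq> 0" "flag_form ?a v* matrix_inv A = \<sigma> *s real_vec s" "s \<noteq> 0" by (rule real_multiple[OF 0(2) b(2)])
    have "(\<Sum>i\<in>UNIV. (flag_form ?a v* matrix_inv A) $ i * (A *v flag_point ?a) $ i) = 0"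
      unfolding dot_vmult by (simp add: vector_matrix_mul_assoc matrix_inv_det A flag_point_flag_form)
    then have "\<sigma> * \<rho> * of_real (\<Sum>i\<in>UNIV. s $ i * r $ i) = 0"
      unfolding r(2) s(2) by (simp add: sum_3 algebra_simps)
    then have "of_real (\<Sum>i\<in>UNIV. s $ i * r $ i) = (0::complex)" using r(1) s(1) by simp
    then have "(\<Sum>i\<in>UNIV. s $ i * r $ i) = 0" by (simp only: of_real_eq_0_iff)
    then have "(line r, line s) \<in> topspace (mtop FR_atlas)"
      unfolding topspace_flag_atlas flag_space_def using r(3) s(3) by blast
    then show ?thesis
      by (intro bexI[of _ "(line r, line s)"]) (simp_all add: phi_R_line r s line_scale)
  qed
  note x = this
  have "W' \<subseteq> snd c ` (U \<inter> fst c \<inter> f -` range (flag_param g))" using W'(1) W(2) by (rule order_trans)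
  from local_model[OF model_FR local_embedding_real(2)[OF M f] c g(1) W'(3,2) this A(1) x]
  show ?thesis .
qed

text \<open>The same \<open>V\<close> and \<open>k\<close> serve both conclusions: the differential
  of \<open>k\<close> carries the given lines to the induced ones because \<open>f\<close> maps them
  onto the translation-invariant line fields.\<close>

lemma model_embedding_conclusion:
  assumes M: "smooth_manifold M" and T: "complex_line_bundle M T1" "complex_line_bundle M T2"
    and f: "local_embedding M T1 T2 U f"
    and loc: "\<And>p. p \<in> U \<Longrightarrow> \<exists>V h k. p \<in> V \<and> model_embedding M U f N \<phi> \<iota> \<pi> h V k"
  shows "\<forall>p\<in>U. \<exists>V g k. openin (mtop M) V \<and> p \<in> V \<and> V \<subseteq> U \<and> g \<in> SL3 \<and>
                 diffeo_onto_open M V N k \<and> (\<forall>q\<in>V. f q = flag_act g (\<phi> (k q)))"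
    "locally_equivalent_on M U T1 T2 N (induced N \<phi> T1_F) (induced N \<phi> T2_F)"
proof -
  have main: "\<exists>V g k. openin (mtop M) V \<and> p \<in> V \<and> V \<subseteq> U \<and> g \<in> SL3 \<and> diffeo_onto_open M V N k \<and> (\<forall>q\<in>V. f q = flag_act g (\<phi> (k q)) \<and>
     cpushforward M N k q ` T1 q = induced N \<phi> T1_F (k q) \<and> cpushforward M N k q ` T2 q = induced N \<phi> T2_F (k q))"
    if p: "p \<in> U" for p
  proof -
    obtain V h k where p: "p \<in> V" and "model_embedding M U f N \<phi> \<iota> \<pi> h V k" using loc[OF p] by blast
    then interpret model_embedding M U f N \<phi> \<iota> \<pi> h V k by blast
    have "cpushforward M N k q ` T1 q = induced N \<phi> T1_F (k q)" "cpushforward M N k q ` T2 q = induced N \<phi> T2_F (k q)" if q: "q \<in> V" for q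
    proof -
      have qt: "q \<in> topspace (mtop M)" using q openin_subset[OF V(1)] by blast
      have "Jpushforward M F_atlas f q ` T1 q = T1_F (f q)" "Jpushforward M F_atlas f q ` T2 q = T2_F (f q)"
        using f q V(2) unfolding local_embedding_def by blast+
      from cpushforward_induced(1)[OF q complex_line_bundle_tangent[OF M T(1) qt] this(1)]
        cpushforward_induced(2)[OF q complex_line_bundle_tangent[OF M T(2) qt] this(2)]
      show "cpushforward M N k q ` T1 q = induced N \<phi> T1_F (k q)" "cpushforward M N k q ` T2 q = induced N \<phi> T2_F (k q)" .
    qed
    then show ?thesis
      using p V g diffeo_k k by (intro exI[of _ V] exI[of _ h] exI[of _ k] conjI ballI) simp_all
  qed
  show "\<forall>p\<in>U. \<exists>V g k. openin (mtop M) V \<and> p \<in> V \<and> V \<subseteq> U \<and> g \<in> SL3 \<and>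
                 diffeo_onto_open M V N k \<and> (\<forall>q\<in>V. f q = flag_act g (\<phi> (k q)))"
  proof
    fix p assume "p \<in> U"
    from main[OF this] show "\<exists>V g k. openin (mtop M) V \<and> p \<in> V \<and> V \<subseteq> U \<and> g \<in> SL3 \<and>
                 diffeo_onto_open M V N k \<and> (\<forall>q\<in>V. f q = flag_act g (\<phi> (k q)))"
      by (elim exE conjE) (intro exI conjI, assumption+, simp)
  qed
  show "locally_equivalent_on M U T1 T2 N (induced N \<phi> T1_F) (induced N \<phi> T2_F)"
    unfolding locally_equivalent_on_def
  proof
    fix p assume "p \<in> U"
    from main[OF this] show "\<exists>V k. openin (mtop M) V \<and> p \<in> V \<and> V \<subseteq> U \<and> diffeo_onto_open M V N k \<and>
      (\<forall>q\<in>V. cpushforward M N k q ` T1 q = induced N \<phi> T1_F (k q) \<and> cpushforward M N k q ` T2 q = induced N \<phi> T2_F (k q))"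
      by (elim exE conjE) (intro exI conjI, assumption+, simp)
  qed
qed

text \<open>The condition is imposed point by point on small neighbourhoods, so it passes from the
  members of a cover to the whole set.\<close>

lemma locally_equivalent_on_cover:
  assumes "\<And>p. p \<in> S \<Longrightarrow> \<exists>U. p \<in> U \<and> U \<subseteq> S \<and> locally_equivalent_on M U T1 T2 N S1 S2"
  shows "locally_equivalent_on M S T1 T2 N S1 S2"
  unfolding locally_equivalent_on_def
proof
  fix p assume "p \<in> S"
  then obtain U where U: "p \<in> U" "U \<subseteq> S" "locally_equivalent_on M U T1 T2 N S1 S2" using assms by blast
  then show "\<exists>V k. openin (mtop M) V \<and> p \<in> V \<and> V \<subseteq> S \<and> diffeo_onto_open M V N k \<and>
     (\<forall>q\<in>V. cpushforward M N k q ` T1 q = S1 (k q) \<and> cpushforward M N k q ` T2 q = S2 (k q))"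
    unfolding locally_equivalent_on_def by (meson order_trans)
qed

lemma local_embedding_subset: "local_embedding M T1 T2 U f \<Longrightarrow> U \<subseteq> topspace (mtop M)"
  unfolding local_embedding_def by (blast dest: openin_subset)

theorem theorem5p4:
  fixes M :: "('a, real^3) chart set"
    and T1 T2 :: "'a \<Rightarrow> ('a, real^3) ctvec set"
  assumes "smooth_manifold M"
  shows "(CR_structure M T1 T2 \<longrightarrow>
           (\<forall>U f. local_embedding M T1 T2 U f \<longrightarrow>
              (\<forall>p\<in>U. \<exists>V g k. openin (mtop M) V \<and> p \<in> V \<and> V \<subseteq> U \<and> g \<in> SL3 \<and>
                 diffeo_onto_open M V S3_atlas k \<and>
                 (\<forall>q\<in>V. f q = flag_act g (phi_CR (k q)))) \<and>
              spherical_on M U T1 T2) \<and>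
           ((\<forall>p\<in>topspace (mtop M). \<exists>U f. p \<in> U \<and> local_embedding M T1 T2 U f) \<longrightarrow>
              spherical_on M (topspace (mtop M)) T1 T2)) \<and>
         (path_structure M T1 T2 \<longrightarrow>
           (\<forall>U f. local_embedding M T1 T2 U f \<longrightarrow>
              (\<forall>p\<in>U. \<exists>V g k. openin (mtop M) V \<and> p \<in> V \<and> V \<subseteq> U \<and> g \<in> SL3 \<and>
                 diffeo_onto_open M V FR_atlas k \<and>
                 (\<forall>q\<in>V. f q = flag_act g (phi_R (k q)))) \<and>
              flat_on M U T1 T2) \<and>
           ((\<forall>p\<in>topspace (mtop M). \<exists>U f. p \<in> U \<and> local_embedding M T1 T2 U f) \<longrightarrow>
              flat_on M (topspace (mtop M)) T1 T2))"
proof (intro conjI impI allI)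
  assume CR: "CR_structure M T1 T2"
  then have T: "complex_line_bundle M T1" "complex_line_bundle M T2"
    by (auto simp: CR_structure_def flag_structure_def)
  note loc = model_embedding_conclusion[OF assms T _ CR_local_model[OF assms CR]]
  show "\<forall>p\<in>U. \<exists>V g k. openin (mtop M) V \<and> p \<in> V \<and> V \<subseteq> U \<and> g \<in> SL3 \<and>
                 diffeo_onto_open M V S3_atlas k \<and> (\<forall>q\<in>V. f q = flag_act g (phi_CR (k q)))"
    "spherical_on M U T1 T2" if "local_embedding M T1 T2 U f" for U f
    using loc[OF that that] unfolding spherical_on_def by blast+
  note spherical = this(2)
  assume ex: "\<forall>p\<in>topspace (mtop M). \<exists>U f. p \<in> U \<and> local_embedding M T1 T2 U f"
  show "spherical_on M (topspace (mtop M)) T1 T2"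
    unfolding spherical_on_def
  proof (rule locally_equivalent_on_cover)
    fix p assume "p \<in> topspace (mtop M)"
    then obtain U f where U: "p \<in> U" "local_embedding M T1 T2 U f" using ex by blast
    show "\<exists>U. p \<in> U \<and> U \<subseteq> topspace (mtop M) \<and> locally_equivalent_on M U T1 T2 S3_atlas (induced S3_atlas phi_CR T1_F) (induced S3_atlas phi_CR T2_F)"
      using local_embedding_subset[OF U(2)] spherical[OF U(2), unfolded spherical_on_def] U(1) by (intro exI[of _ U] conjI)
  qed
next
  assume path: "path_structure M T1 T2"
  then have T: "complex_line_bundle M T1" "complex_line_bundle M T2"
    by (auto simp: path_structure_def flag_structure_def)
  note loc = model_embedding_conclusion[OF assms T _ path_local_model[OF assms path]]
  show "\<forall>p\<in>U. \<exists>V g k. openin (mtop M) V \<and> p \<in> V \<and> V \<subseteq> U \<and> g \<in> SL3 \<and>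
                 diffeo_onto_open M V FR_atlas k \<and> (\<forall>q\<in>V. f q = flag_act g (phi_R (k q)))"
    "flat_on M U T1 T2" if "local_embedding M T1 T2 U f" for U f
    using loc[OF that that] unfolding flat_on_def by blast+
  note flat = this(2)
  assume ex: "\<forall>p\<in>topspace (mtop M). \<exists>U f. p \<in> U \<and> local_embedding M T1 T2 U f"
  show "flat_on M (topspace (mtop M)) T1 T2"
    unfolding flat_on_def
  proof (rule locally_equivalent_on_cover)
    fix p assume "p \<in> topspace (mtop M)"
    then obtain U f where U: "p \<in> U" "local_embedding M T1 T2 U f" using ex by blast
    show "\<exists>U. p \<in> U \<and> U \<subseteq> topspace (mtop M) \<and> locally_equivalent_on M U T1 T2 FR_atlas (induced FR_atlas phi_R T1_F) (induced FR_atlas phi_R T2_F)"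
      using local_embedding_subset[OF U(2)] flat[OF U(2), unfolded flat_on_def] U(1) by (intro exI[of _ U] conjI)
  qed
qed

end
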